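(* Let $n\ge1$, let $m$ be a non-negative integer, let $\alpha>0$, let $0<q<\infty$, and let $u:\mathbb{C}^n\to\mathbb{C}$ and $\psi:\mathbb{C}^n\to\mathbb{C}^n$ be entire. Then the following statements are equivalent. (i) $uC_\psi:\mathcal{F}^\infty_{(m,\alpha)}\to\mathcal{F}^q_{(m,\alpha)}$ is bounded; (ii) $uC_\psi:\mathcal{F}^\infty_{(m,\alpha)}\to\mathcal{F}^q_{(m,\alpha)}$ is compact; (iii) $B_{(m,\psi)}(|u|^q)\in L^1$. Furthermore, $$\|uC_\psi\|\simeq\|B_{(m,\psi)}(|u|^q)\|_{L^1}^{1/q}.$$
   Context: $dV$ is Lebesgue measure on $\mathbb{C}^n$, $\langle z,w\rangle=\sum_j z_j\overline{w_j}$, $|z|=\sqrt{\langle z,z\rangle}$, $L^1=L^1(\mathbb{C}^n,dV)$. For $0<p<\infty$ put $\|f\|_p^p=(\frac{\alpha p}{2\pi})^n\int_{\mathbb{C}^n}|f(z)|^pe^{-\frac{\alpha p}{2}|z|^2}dV(z)$, and $\|f\|_\infty=\sup_z|f(z)|e^{-\frac{\alpha}{2}|z|^2}$. The Fock--Sobolev space $\mathcal{F}^p_{(m,\alpha)}$ ($0<p\le\infty$) of order $m$ consists of the entire functions $f$ on $\mathbb{C}^n$ with $\sum_{\beta_1+\dots+\beta_n\le m}\|\partial^\beta f\|_p<\infty$. It is equipped throughout with the equivalent (quasi-)norm $\|f\|_{(p,m)}=\big(C_{(p,m,n)}\int_{\mathbb{C}^n}|z|^{mp}|f(z)|^pe^{-\frac{\alpha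 p}{2}|z|^2}dV(z)\big)^{1/p}$ for $p<\infty$, where $C_{(p,m,n)}=(\frac{\alpha p}{2})^{\frac{mp}{2}+n}\frac{\Gamma(n)}{\pi^n\Gamma(\frac{mp}{2}+n)}$, and $\|f\|_{(\infty,m)}=\sup_z|z|^m|f(z)|e^{-\frac{\alpha}{2}|z|^2}$ for $p=\infty$. The weighted composition operator is $uC_\psi f=u\cdot(f\circ\psi)$. With $k_w(z)=e^{\alpha\langle z,w\rangle-\frac{\alpha}{2}|w|^2}$, for $0<q<\infty$, $$B_{(m,\psi)}(|u|^q)(w)=\int_{\mathbb{C}^n}\frac{|k_w(\psi(z))|^q}{(1+|\psi(z)|)^{mq}}|u(z)|^q|z|^{qm}e^{-\frac{\alpha q}{2}|z|^2}dV(z).$$ $U\simeq V$ means $U\le CV$ and $V\le CU$ with a constant $C$ independent of $u,\psi$. *)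

theory Defs
  imports "HOL-Complex_Analysis.Complex_Analysis"
begin

text \<open>
  \<open>\<complex>\<^sup>n\<close> is \<^typ>\<open>complex ^ 'n\<close>, so \<open>n = CARD('n) \<ge> 1\<close>; its \<^const>\<open>norm\<close> is the Hermitian norm and
  its \<^const>\<open>lborel\<close> is \<open>2n\<close>-dimensional Lebesgue measure.  (The library inner product on this
  type is the real one, the real part of \<open>herm\<close> below.)  Norms and integrals of nonnegative
  functions take values in \<^typ>\<open>ennreal\<close>, so a divergent integral has the value \<open>\<infinity>\<close>.
\<close>

definition herm :: "complex ^ 'n \<Rightarrow> complex ^ 'n \<Rightarrow> complex"
  where "herm z w = (\<Sum>j\<in>UNIV. z $ j * cnj (w $ j))"

text \<open>Power of an element of \<open>[0,\<infinity>]\<close>, for exponents \<open>a > 0\<close> only.\<close>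

definition epowr :: "ennreal \<Rightarrow> real \<Rightarrow> ennreal"
  where "epowr x a = (if x = \<infinity> then \<infinity> else ennreal (enn2real x powr a))"

definition entire :: "(complex ^ 'n \<Rightarrow> complex) \<Rightarrow> bool"
  where "entire f \<longleftrightarrow>
    (\<forall>z. \<exists>D. (f has_derivative D) (at z) \<and> (\<forall>c v. D (c *s v) = c * D v))"

definition entire_map :: "(complex ^ 'n \<Rightarrow> complex ^ 'n) \<Rightarrow> bool"
  where "entire_map \<psi> \<longleftrightarrow> (\<forall>j. entire (\<lambda>z. \<psi> z $ j))"

definition partial_deriv :: "'n \<Rightarrow> (complex ^ 'n \<Rightarrow> complex) \<Rightarrow> complex ^ 'n \<Rightarrow> complex"
  where "partial_deriv j f z = deriv (\<lambda>t. f (z + axis j t)) 0"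

text \<open>
  The index type carries no order, so the coordinates are differentiated in the order of an
  arbitrary fixed enumeration.  For entire functions the partial derivatives commute and the
  enumeration is immaterial.
\<close>

definition coord_list :: "'n::finite list"
  where "coord_list = (SOME js. distinct js \<and> set js = UNIV)"

definition multi_deriv ::
    "('n \<Rightarrow> nat) \<Rightarrow> (complex ^ 'n \<Rightarrow> complex) \<Rightarrow> complex ^ 'n \<Rightarrow> complex"
  where "multi_deriv \<beta> f = foldr (\<lambda>j. partial_deriv j ^^ \<beta> j) coord_list f"

definition multi_indices :: "nat \<Rightarrow> ('n::finite \<Rightarrow> nat) set"
  where "multi_indices m = {\<beta>. (\<Sum>j\<in>UNIV. \<beta> j) \<le> m}"

lemma coord_list: "distinct (coord_list :: 'n::finite list)" "set (coord_list :: 'n list) = UNIV"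
proof -
  have "\<exists>js :: 'n list. distinct js \<and> set js = UNIV"
    using finite_distinct_list[of "UNIV :: 'n set"] by auto
  from someI_ex[OF this] show "distinct (coord_list :: 'n list)" "set (coord_list :: 'n list) = UNIV"
    by (simp_all add: coord_list_def)
qed

lemma finite_multi_indices: "finite (multi_indices m :: ('n::finite \<Rightarrow> nat) set)"
proof (rule finite_subset)
  show "multi_indices m \<subseteq> (PiE UNIV (\<lambda>_. {..m}) :: ('n \<Rightarrow> nat) set)"
  proof
    fix \<beta> :: "'n \<Rightarrow> nat" assume "\<beta> \<in> multi_indices m"
    then have "\<beta> j \<le> m" for j
      using member_le_sum[of j UNIV \<beta>] by (simp add: multi_indices_def)
    then show "\<beta> \<in> PiE UNIV (\<lambda>_. {..m})" by auto
  qed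
  show "finite (PiE UNIV (\<lambda>_. {..m}) :: ('n \<Rightarrow> nat) set)"
    by (intro finite_PiE) auto
qed

text \<open>\<open>\<parallel>f\<parallel>\<^sub>p\<close> for \<open>0 < p \<le> \<infinity>\<close>\<close>

definition fock_norm :: "real \<Rightarrow> ennreal \<Rightarrow> (complex ^ 'n \<Rightarrow> complex) \<Rightarrow> ennreal"
  where "fock_norm \<alpha> p f =
    (if p = \<infinity> then (SUP z. ennreal (norm (f z) * exp (- (\<alpha> / 2) * (norm z)\<^sup>2)))
     else (let r = enn2real p in
       epowr (ennreal ((\<alpha> * r / (2 * pi)) ^ CARD('n)) *
         (\<integral>\<^sup>+ z. ennreal (norm (f z) powr r * exp (- (\<alpha> * r / 2) * (norm z)\<^sup>2)) \<partial>lborel))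
         (1 / r)))"

definition fock_sobolev :: "real \<Rightarrow> ennreal \<Rightarrow> nat \<Rightarrow> (complex ^ 'n \<Rightarrow> complex) set"
  where "fock_sobolev \<alpha> p m =
    {f. entire f \<and> (\<Sum>\<beta>\<in>multi_indices m. fock_norm \<alpha> p (multi_deriv \<beta> f)) < \<infinity>}"

text \<open>
  The (quasi-)norm \<open>\<parallel>f\<parallel>\<^bsub>(p,m)\<^esub>\<close> carried by the Fock-Sobolev space.  The factor \<open>|z|\<^sup>m\<^sup>p\<close> is written
  \<open>(|z| ^ m) powr p\<close> because \<open>0 powr 0 = 0\<close> in the library.
\<close>

definition fs_const :: "real \<Rightarrow> real \<Rightarrow> nat \<Rightarrow> nat \<Rightarrow> real"
  where "fs_const \<alpha> p m n =
    (\<alpha> * p / 2) powr (real m * p / 2 + real n) *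
      (Gamma (real n) / (pi ^ n * Gamma (real m * p / 2 + real n)))"

definition fs_norm :: "real \<Rightarrow> ennreal \<Rightarrow> nat \<Rightarrow> (complex ^ 'n \<Rightarrow> complex) \<Rightarrow> ennreal"
  where "fs_norm \<alpha> p m f =
    (if p = \<infinity> then (SUP z. ennreal (norm z ^ m * norm (f z) * exp (- (\<alpha> / 2) * (norm z)\<^sup>2)))
     else (let r = enn2real p in
       epowr (ennreal (fs_const \<alpha> r m CARD('n)) *
         (\<integral>\<^sup>+ z. ennreal ((norm z ^ m) powr r * norm (f z) powr r *
                          exp (- (\<alpha> * r / 2) * (norm z)\<^sup>2)) \<partial>lborel))
         (1 / r)))"

definition wcomp ::
    "(complex ^ 'n \<Rightarrow> complex) \<Rightarrow> (complex ^ 'n \<Rightarrow> complex ^ 'n) \<Rightarrow>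
     (complex ^ 'n \<Rightarrow> complex) \<Rightarrow> complex ^ 'n \<Rightarrow> complex"
  where "wcomp u \<psi> f = (\<lambda>z. u z * f (\<psi> z))"

definition ker :: "real \<Rightarrow> complex ^ 'n \<Rightarrow> complex ^ 'n \<Rightarrow> complex"
  where "ker \<alpha> w z =
    exp (complex_of_real \<alpha> * herm z w - complex_of_real (\<alpha> / 2 * (norm w)\<^sup>2))"

text \<open>\<open>B\<^bsub>(m,\<psi>)\<^esub>(|u|\<^sup>q)\<close>, as a function with values in \<open>[0,\<infinity>]\<close>\<close>

definition Berezin ::
    "real \<Rightarrow> real \<Rightarrow> nat \<Rightarrow> (complex ^ 'n \<Rightarrow> complex) \<Rightarrow> (complex ^ 'n \<Rightarrow> complex ^ 'n) \<Rightarrow>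
     complex ^ 'n \<Rightarrow> ennreal"
  where "Berezin \<alpha> q m u \<psi> w =
    (\<integral>\<^sup>+ z. ennreal (norm (ker \<alpha> w (\<psi> z)) powr q / (1 + norm (\<psi> z)) powr (real m * q) *
                    norm (u z) powr q * (norm z ^ m) powr q *
                    exp (- (\<alpha> * q / 2) * (norm z)\<^sup>2)) \<partial>lborel)"

definition L1_norm :: "(complex ^ 'n \<Rightarrow> ennreal) \<Rightarrow> ennreal"
  where "L1_norm g = (\<integral>\<^sup>+ w. g w \<partial>lborel)"

definition in_L1 :: "(complex ^ 'n \<Rightarrow> ennreal) \<Rightarrow> bool"
  where "in_L1 g \<longleftrightarrow> g \<in> borel_measurable lborel \<and> L1_norm g < \<infinity>"

text \<open>
  Operators between spaces \<open>X\<close>, \<open>Y\<close> of functions with (quasi-)norms \<open>N\<close>, \<open>M\<close>.  For exponents below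
  1 the quasi-norm satisfies no triangle inequality, so the topology is given by its open sets.
\<close>

definition qnorm_open :: "('a \<Rightarrow> complex) set \<Rightarrow> (('a \<Rightarrow> complex) \<Rightarrow> ennreal) \<Rightarrow>
    ('a \<Rightarrow> complex) set \<Rightarrow> bool"
  where "qnorm_open X N U \<longleftrightarrow>
    U \<subseteq> X \<and> (\<forall>f\<in>U. \<exists>e>0. \<forall>g\<in>X. N (\<lambda>z. g z - f z) < ennreal e \<longrightarrow> g \<in> U)"

definition qnorm_topology :: "('a \<Rightarrow> complex) set \<Rightarrow> (('a \<Rightarrow> complex) \<Rightarrow> ennreal) \<Rightarrow>
    ('a \<Rightarrow> complex) topology"
  where "qnorm_topology X N = topology (qnorm_open X N)"

lemma openin_qnorm_topology: "openin (qnorm_topology X N) = qnorm_open X N"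
  unfolding qnorm_topology_def
proof (rule topology_inverse', unfold istopology_def, intro conjI allI impI)
  fix S T assume S: "qnorm_open X N S" and T: "qnorm_open X N T"
  show "qnorm_open X N (S \<inter> T)"
    unfolding qnorm_open_def
  proof (intro conjI ballI)
    show "S \<inter> T \<subseteq> X" using S by (auto simp: qnorm_open_def)
  next
    fix f assume f: "f \<in> S \<inter> T"
    obtain d where d: "d > 0" "\<forall>g\<in>X. N (\<lambda>z. g z - f z) < ennreal d \<longrightarrow> g \<in> S"
      using S f by (auto simp: qnorm_open_def)
    obtain e where e: "e > 0" "\<forall>g\<in>X. N (\<lambda>z. g z - f z) < ennreal e \<longrightarrow> g \<in> T"
      using T f by (auto simp: qnorm_open_def)
    have "ennreal (min d e) \<le> ennreal d" "ennreal (min d e) \<le> ennreal e"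
      by (auto intro!: ennreal_leI)
    then have "\<forall>g\<in>X. N (\<lambda>z. g z - f z) < ennreal (min d e) \<longrightarrow> g \<in> S \<inter> T"
      using d(2) e(2) by (meson IntI order_less_le_trans)
    then show "\<exists>e>0. \<forall>g\<in>X. N (\<lambda>z. g z - f z) < ennreal e \<longrightarrow> g \<in> S \<inter> T"
      using d(1) e(1) by (intro exI[of _ "min d e"]) simp
  qed
next
  fix K assume "\<forall>S\<in>K. qnorm_open X N S"
  then show "qnorm_open X N (\<Union>K)"
    unfolding qnorm_open_def by (meson Sup_least UnionE UnionI)
qed

definition bounded_op :: "('a \<Rightarrow> complex) set \<Rightarrow> (('a \<Rightarrow> complex) \<Rightarrow> ennreal) \<Rightarrow>
    ('b \<Rightarrow> complex) set \<Rightarrow> (('b \<Rightarrow> complex) \<Rightarrow> ennreal) \<Rightarrow>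
    (('a \<Rightarrow> complex) \<Rightarrow> ('b \<Rightarrow> complex)) \<Rightarrow> bool"
  where "bounded_op X N Y M T \<longleftrightarrow>
    T ` X \<subseteq> Y \<and> (\<exists>C::real. \<forall>f\<in>X. M (T f) \<le> ennreal C * N f)"

text \<open>Compact: bounded sets have relatively compact images.\<close>

definition compact_op :: "('a \<Rightarrow> complex) set \<Rightarrow> (('a \<Rightarrow> complex) \<Rightarrow> ennreal) \<Rightarrow>
    ('b \<Rightarrow> complex) set \<Rightarrow> (('b \<Rightarrow> complex) \<Rightarrow> ennreal) \<Rightarrow>
    (('a \<Rightarrow> complex) \<Rightarrow> ('b \<Rightarrow> complex)) \<Rightarrow> bool"
  where "compact_op X N Y M T \<longleftrightarrow>
    T ` X \<subseteq> Y \<and>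
    (\<forall>S\<subseteq>X. (\<exists>R::real. \<forall>f\<in>S. N f \<le> ennreal R) \<longrightarrow>
       compactin (qnorm_topology Y M) (qnorm_topology Y M closure_of (T ` S)))"

text \<open>The operator norm; it is \<open>\<infinity>\<close> if the operator is unbounded.\<close>

definition op_norm :: "('a \<Rightarrow> complex) set \<Rightarrow> (('a \<Rightarrow> complex) \<Rightarrow> ennreal) \<Rightarrow>
    (('b \<Rightarrow> complex) \<Rightarrow> ennreal) \<Rightarrow> (('a \<Rightarrow> complex) \<Rightarrow> ('b \<Rightarrow> complex)) \<Rightarrow> ennreal"
  where "op_norm X N M T = (SUP f\<in>{f \<in> X. N f \<le> 1}. M (T f))"

end

theory Submission
  imports Defs
begin

text \<open>
  The whole statement is a comparison with one number,
  \<open>I = \<integral> exp (\<alpha> q |\<psi>|\<^sup>2 / 2) (1 + |\<psi>|)\<^sup>-\<^sup>m\<^sup>q |u|\<^sup>q |z|\<^sup>m\<^sup>q exp (- \<alpha> q |z|\<^sup>2 / 2) dV(z)\<close>.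
  Since \<open>|k\<^sub>w(\<zeta>)|\<^sup>q\<close> is \<open>exp (\<alpha> q |\<zeta>|\<^sup>2 / 2)\<close> times a Gaussian centred at \<open>\<zeta>\<close>, Tonelli's theorem and the
  translation invariance of Lebesgue measure show that the \<open>L\<^sup>1\<close> norm of the Berezin-type transform
  is a constant multiple of \<open>I\<close> (\<open>L1_norm_Berezin\<close>).

  \<^bold>\<open>Upper estimate.\<close>  A function of norm \<open>R\<close> in the source space is pointwise at most a constant times
  \<open>R exp (\<alpha> |w|\<^sup>2 / 2) (1 + |w|)\<^sup>-\<^sup>m\<close> (\<open>fs_norm_infinity_pointwise\<close>).  Inserting \<open>w = \<psi>(z)\<close> bounds the
  \<open>q\<close>-th power of the norm of its image by a multiple of \<open>R\<^sup>q I\<close>.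

  \<^bold>\<open>Lower estimate.\<close>  The functions \<open>\<Sum>\<^sub>w \<plusminus> k\<^sub>w / (1 + |w|)\<^sup>m\<close>, with \<open>w\<close> in a finite part of the lattice of
  Gaussian integer vectors, have uniformly bounded norm in the source space, whatever the signs.
  Of the two numbers \<open>|b + a|\<close> and \<open>|b - a|\<close> one is at least \<open>|a|\<close>; hence the mean over all signs of the
  \<open>q\<close>-th power of such a sum is at least half the \<open>q\<close>-th power of each single term, and the term of
  a lattice point near \<open>\<psi>(z)\<close> already has the size \<open>exp (\<alpha> |\<psi>|\<^sup>2 / 2) (1 + |\<psi>|)\<^sup>-\<^sup>m\<close>.  Integrating over \<open>z\<close> and
  exhausting the lattice gives \<open>I \<le> C \<parallel>uC\<^sub>\<psi>\<parallel>\<^sup>q\<close> (\<open>berezin_density_integral_le\<close>).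

  \<^bold>\<open>Derivatives against weights.\<close>  The spaces are defined by derivatives, the norms by powers of \<open>|z|\<close>.
  Two inclusions connect them.  In the source space, integrating the \<open>m\<close>-th pure derivative along
  rays of a coordinate plane gains \<open>m\<close> powers of \<open>|z|\<close> (\<open>fs_norm_infinity_finite\<close>).  For the target space,
  the sub-mean value property on discs of radius \<open>1 / (1 + |z|)\<close>, on which the Gaussian is constant up
  to a factor, shows that each derivative costs one power of \<open>1 + |z|\<close> (\<open>fock_sobolev_memberI\<close>).

  \<^bold>\<open>Compactness.\<close>  If \<open>I\<close> is finite, Montel's theorem extracts from a bounded sequence a pointwise
  convergent one, and the majorant of the upper estimate makes the images converge in norm by
  dominated convergence.  The topology of the target space is that of a metric, so this sequential
  statement is compactness (\<open>compact_op_of_finite_density\<close>).  Conversely, a compact operator is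
  bounded on the unit ball (\<open>bounded_integrals_of_compact_op\<close>), and the lower estimate applies.
\<close>

no_notation fps_nth (infixl \<open>$\<close> 75)

section \<open>Entire functions of several variables\<close>

lemma norm_vec_square: "(norm (z :: complex ^ 'n))\<^sup>2 = (\<Sum>j\<in>UNIV. (norm (z $ j))\<^sup>2)"
  by (simp add: norm_vec_def L2_set_def real_sqrt_pow2 sum_nonneg)

lemma norm_axis_complex [simp]: "norm (axis j (t::complex) :: complex ^ 'n) = norm t"
proof -
  have "(norm (axis j t :: complex ^ 'n))\<^sup>2 = (\<Sum>i\<in>UNIV. if i = j then (norm t)\<^sup>2 else 0)"
    unfolding norm_vec_square by (intro sum.cong) (auto simp: axis_def)
  also have "\<dots> = (norm t)\<^sup>2" by simp
  finally show ?thesis by simp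
qed

lemma axis_smult: "axis j (t::complex) = t *s axis j 1"
  by (simp add: vec_eq_iff axis_def)

lemma axis_add: "axis j (s + t) = axis j s + axis j (t::complex)"
  by (simp add: vec_eq_iff axis_def)

lemma axis_zero [simp]: "axis j (0::complex) = 0"
  by (simp add: vec_eq_iff axis_def)

lemma sum_axis_nth: "(\<Sum>j\<in>UNIV. axis j (v $ j)) = (v :: complex ^ 'n)"
  by (simp add: vec_eq_iff axis_def)

lemma bounded_linear_axis: "bounded_linear (axis j :: complex \<Rightarrow> complex ^ 'n)"
proof (rule bounded_linear_intro[where K = 1])
  show "axis j (r *\<^sub>R x) = r *\<^sub>R axis j x" for r and x :: complex
    by (simp add: vec_eq_iff axis_def)
qed (simp_all add: axis_add)

lemma continuous_on_axis [continuous_intros]: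
  "continuous_on S f \<Longrightarrow> continuous_on S (\<lambda>x. axis j (f x :: complex) :: complex ^ 'n)"
  by (rule bounded_linear.continuous_on[OF bounded_linear_axis])

definition separately_holomorphic :: "(complex ^ 'n \<Rightarrow> complex) \<Rightarrow> bool"
  where "separately_holomorphic f \<longleftrightarrow>
    continuous_on UNIV f \<and> (\<forall>z j. (\<lambda>t. f (z + axis j t)) holomorphic_on UNIV)"

lemma partial_deriv_axis:
  "partial_deriv j f (z + axis j t) = deriv (\<lambda>s. f (z + axis j s)) t"
  by (simp add: partial_deriv_def deriv_shift_0[of "\<lambda>s. f (z + axis j s)" t] o_def axis_add add.assoc)

lemma partial_deriv_bound:
  assumes "separately_holomorphic f" "r > 0" "\<And>t. norm t = r \<Longrightarrow> norm (f (z + axis j t)) \<le> B"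
  shows "norm (partial_deriv j f z) \<le> B / r"
proof -
  have "(\<lambda>t. f (z + axis j t)) holomorphic_on UNIV"
    using assms(1) by (simp add: separately_holomorphic_def)
  then have "norm ((deriv ^^ 1) (\<lambda>t. f (z + axis j t)) 0) \<le> fact 1 * B / r ^ 1"
    using assms(2,3)
    by (intro Cauchy_inequality) (auto intro: holomorphic_on_subset holomorphic_on_imp_continuous_on)
  then show ?thesis by (simp add: partial_deriv_def)
qed

text \<open>
  The explicit error makes the difference quotients of a function on \<open>\<complex>\<^sup>n\<close> converge uniformly on bounded
  sets, which is how a partial derivative inherits continuity and holomorphy.
\<close>
lemma difference_quotient_error:
  assumes g: "g holomorphic_on UNIV" and B: "\<And>t. norm t \<le> 2 \<Longrightarrow> norm (g t) \<le> B"
    and h: "h \<noteq> 0" "norm h \<le> 1"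
  shows "norm ((g h - g 0) / h - deriv g 0) \<le> 2 * B * norm h"
proof -
  have hol: "(deriv ^^ i) g holomorphic_on UNIV" for i
    using g by (induction i) (auto intro: holomorphic_deriv)
  have "norm ((deriv ^^ 0) g h - (\<Sum>i\<le>1. (deriv ^^ i) g 0 * (h - 0) ^ i / fact i))
      \<le> (2 * B) * norm (h - 0) ^ Suc 1 / fact 1"
  proof (rule complex_Taylor[where S = "cball 0 1"])
    show "((deriv ^^ i) g has_field_derivative (deriv ^^ Suc i) g x) (at x within cball 0 1)" for i x
      using hol[of i] by (auto intro!: DERIV_subset[OF holomorphic_derivI])
    show "norm ((deriv ^^ Suc 1) g x) \<le> 2 * B" if "x \<in> cball 0 1" for x
    proof -
      have "norm ((deriv ^^ 2) g x) \<le> fact 2 * B / 1 ^ 2"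
      proof (rule Cauchy_inequality)
        show "norm (g t) \<le> B" if "norm (x - t) = 1" for t
          using that \<open>x \<in> cball 0 1\<close> norm_triangle_ineq4[of x "x - t"] by (intro B) auto
      qed (use g in \<open>auto intro: holomorphic_on_subset holomorphic_on_imp_continuous_on\<close>)
      then show ?thesis by (simp add: numeral_2_eq_2)
    qed
  qed (use h in auto)
  then have le: "norm (g h - g 0 - deriv g 0 * h) \<le> 2 * B * (norm h)\<^sup>2"
    by (simp add: algebra_simps power2_eq_square)
  have "(g h - g 0) / h - deriv g 0 = (g h - g 0 - deriv g 0 * h) / h"
    using h by (simp add: field_simps)
  then have "norm ((g h - g 0) / h - deriv g 0) = norm (g h - g 0 - deriv g 0 * h) / norm h"
    by (simp add: norm_divide)
  also have "\<dots> \<le> (2 * B * (norm h)\<^sup>2) / norm h"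
    using le by (intro divide_right_mono) auto
  also have "\<dots> = 2 * B * norm h"
    using h by (simp add: power2_eq_square)
  finally show ?thesis .
qed

lemma separately_holomorphic_limit:
  fixes F :: "nat \<Rightarrow> complex ^ 'n \<Rightarrow> complex"
  assumes F: "\<And>k. separately_holomorphic (F k)"
    and lim: "\<And>r. uniform_limit (cball 0 r) F f sequentially"
  shows "separately_holomorphic f"
  unfolding separately_holomorphic_def
proof (intro conjI allI)
  show "continuous_on UNIV f"
  proof (subst continuous_on_eq_continuous_at; safe?)
    fix z :: "complex ^ 'n"
    have "continuous_on (cball 0 (norm z + 1)) f"
      by (rule uniform_limit_theorem[OF _ lim])
        (use F in \<open>auto simp: separately_holomorphic_def intro!: always_eventually intro: continuous_on_subset\<close>)
    then have "continuous_on (ball 0 (norm z + 1)) f"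
      by (rule continuous_on_subset) auto
    then show "isCont f z"
      by (simp add: continuous_on_eq_continuous_at)
  qed auto
  fix z :: "complex ^ 'n" and j
  show "(\<lambda>t. f (z + axis j t)) holomorphic_on UNIV"
  proof (rule holomorphic_uniform_sequence[where f = "\<lambda>k t. F k (z + axis j t)"])
    show "(\<lambda>t. F k (z + axis j t)) holomorphic_on UNIV" for k
      using F by (simp add: separately_holomorphic_def)
    fix t :: complex
    have "z + axis j s \<in> cball 0 (norm z + norm t + 1)" if "s \<in> cball t 1" for s
    proof -
      have "norm s \<le> norm t + 1"
        using that norm_triangle_ineq2[of s t] by (auto simp: dist_norm norm_minus_commute)
      then show ?thesis
        using norm_triangle_ineq[of z "axis j s"] by (simp only: mem_cball dist_0_norm norm_axis_complex)
    qed
    then have "uniform_limit (cball t 1) (\<lambda>k s. F k (z + axis j s)) (\<lambda>s. f (z + axis j s)) sequentially"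
      using lim[of "norm z + norm t + 1"] unfolding uniform_limit_iff
      by (elim all_forward imp_forward eventually_mono) (auto simp del: mem_cball)
    then show "\<exists>d>0. cball t d \<subseteq> UNIV \<and>
        uniform_limit (cball t d) (\<lambda>k s. F k (z + axis j s)) (\<lambda>s. f (z + axis j s)) sequentially"
      by (intro exI[of _ 1]) auto
  qed auto
qed

lemma bounded_on_cball:
  fixes f :: "complex ^ 'n \<Rightarrow> complex"
  assumes "continuous_on UNIV f"
  obtains B where "B \<ge> 0" "\<And>z. norm z \<le> r \<Longrightarrow> norm (f z) \<le> B"
proof -
  have "compact (f ` cball 0 r)"
    using assms by (intro compact_continuous_image) (auto intro: continuous_on_subset)
  then obtain B where "\<forall>x\<in>f ` cball 0 r. norm x \<le> B"
    using bounded_iff compact_imp_bounded by blast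
  then show thesis
    by (intro that[of "max B 0"]) (auto simp: max.coboundedI1)
qed

lemma separately_holomorphic_partial_deriv:
  fixes f :: "complex ^ 'n \<Rightarrow> complex"
  assumes f: "separately_holomorphic f"
  shows "separately_holomorphic (partial_deriv j f)"
proof -
  define h where "h k = complex_of_real (1 / (real k + 1))" for k
  have h_norm: "norm (h k) = 1 / (real k + 1)" for k
    unfolding h_def norm_of_real by simp
  have h: "h k \<noteq> 0" "norm (h k) = 1 / (real k + 1)" "norm (h k) \<le> 1" for k
  proof -
    have "norm (h k) > 0" unfolding h_norm by simp
    then show "h k \<noteq> 0" by auto
  qed (simp_all add: h_norm)
  define F where "F k z = (f (z + axis j (h k)) - f z) / h k" for k z
  have cont: "continuous_on UNIV f" and hol: "\<And>z j. (\<lambda>t. f (z + axis j t)) holomorphic_on UNIV"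
    using f by (auto simp: separately_holomorphic_def)
  have "separately_holomorphic (F k)" for k
    unfolding separately_holomorphic_def
  proof (intro conjI allI)
    show "continuous_on UNIV (F k)"
      unfolding F_def using h
      by (intro continuous_intros continuous_on_compose2[OF cont]) auto
    show "(\<lambda>t. F k (z + axis i t)) holomorphic_on UNIV" for z i
    proof -
      have "(\<lambda>t. f (z + axis i t + axis j (h k))) = (\<lambda>t. f ((z + axis j (h k)) + axis i t))"
        by (simp add: algebra_simps)
      then have "(\<lambda>t. f (z + axis i t + axis j (h k))) holomorphic_on UNIV"
        using hol by simp
      then show ?thesis
        unfolding F_def using hol h by (intro holomorphic_intros) auto
    qed
  qed
  moreover have "uniform_limit (cball 0 r) F (partial_deriv j f) sequentially" for r
    unfolding uniform_limit_iff
  proof (intro allI impI)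
    fix e :: real assume e: "e > 0"
    obtain B where B: "B \<ge> 0" "\<And>z. norm z \<le> r + 2 \<Longrightarrow> norm (f z) \<le> B"
      using bounded_on_cball[OF cont] by metis
    have "(\<lambda>k. 1 / (real k + 1)) \<longlonglongrightarrow> 0"
      using LIMSEQ_inverse_real_of_nat by (simp add: inverse_eq_divide add.commute)
    then have "(\<lambda>k. 2 * B * (1 / (real k + 1))) \<longlonglongrightarrow> 2 * B * 0"
      by (intro tendsto_mult tendsto_const)
    then have "\<forall>\<^sub>F k in sequentially. 2 * B * (1 / (real k + 1)) < e"
      using e by (intro order_tendstoD(2)) auto
    then show "\<forall>\<^sub>F k in sequentially. \<forall>z\<in>cball 0 r. dist (F k z) (partial_deriv j f z) < e"
    proof eventually_elim
      case (elim k)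
      have "norm (F k z - partial_deriv j f z) \<le> 2 * B * norm (h k)" if z: "norm z \<le> r" for z
      proof -
        have "norm (f (z + axis j t)) \<le> B" if "norm t \<le> 2" for t
          using z that norm_triangle_ineq[of z "axis j t"] by (intro B) auto
        then show ?thesis
          using difference_quotient_error[OF hol, of z j B "h k"] h
          by (simp add: F_def partial_deriv_def)
      qed
      then show ?case
        using elim h by (fastforce simp: dist_norm)
    qed
  qed
  ultimately show ?thesis
    by (rule separately_holomorphic_limit)
qed

text \<open>
  The partial derivatives are again separately holomorphic, in particular continuous; moving from
  \<open>z\<close> to \<open>z + v\<close> one coordinate at a time then bounds the linearisation error.
\<close>
lemma separately_holomorphic_has_derivative:
  fixes f :: "complex ^ 'n \<Rightarrow> complex"
  assumes f: "separately_holomorphic f"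
  shows "(f has_derivative (\<lambda>v. \<Sum>j\<in>UNIV. v $ j * partial_deriv j f z)) (at z)"
  unfolding has_derivative_at_alt
proof (intro conjI allI impI)
  show "bounded_linear (\<lambda>v. \<Sum>j\<in>UNIV. v $ j * partial_deriv j f z)"
    by (intro bounded_linear_sum bounded_linear_compose[OF bounded_linear_mult_left bounded_linear_vec_nth])
  fix e :: real assume e: "e > 0"
  define n where "n = real CARD('n)"
  have n: "n \<ge> 1" by (simp add: n_def Suc_leI)
  have hol: "\<And>z j. (\<lambda>t. f (z + axis j t)) holomorphic_on UNIV"
    using f by (auto simp: separately_holomorphic_def)
  have "\<exists>\<delta>>0. \<forall>j. \<forall>w. dist w z < \<delta> \<longrightarrow> dist (partial_deriv j f w) (partial_deriv j f z) < e / n"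
  proof -
    have "\<forall>j. \<exists>\<delta>>0. \<forall>w. dist w z < \<delta> \<longrightarrow> dist (partial_deriv j f w) (partial_deriv j f z) < e / n"
    proof
      fix j
      have "continuous_on UNIV (partial_deriv j f)"
        using separately_holomorphic_partial_deriv[OF f] by (simp add: separately_holomorphic_def)
      then show "\<exists>\<delta>>0. \<forall>w. dist w z < \<delta> \<longrightarrow> dist (partial_deriv j f w) (partial_deriv j f z) < e / n"
        using e n by (auto simp: continuous_on_iff)
    qed
    then obtain \<delta> where \<delta>: "\<forall>j. \<delta> j > 0 \<and> (\<forall>w. dist w z < \<delta> j \<longrightarrow> dist (partial_deriv j f w) (partial_deriv j f z) < e / n)"
      by metis
    show ?thesis
      by (rule exI[of _ "Min (range \<delta>)"]) (use \<delta> in \<open>auto simp: Min_gr_iff\<close>)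
  qed
  then obtain \<delta> where \<delta>: "\<delta> > 0"
    "\<And>j w. dist w z < \<delta> \<Longrightarrow> dist (partial_deriv j f w) (partial_deriv j f z) < e / n" by blast
  show "\<exists>d>0. \<forall>y. norm (y - z) < d \<longrightarrow>
      norm (f y - f z - (\<Sum>j\<in>UNIV. (y - z) $ j * partial_deriv j f z)) \<le> e * norm (y - z)"
  proof (intro exI[of _ "\<delta> / (n + 1)"] conjI allI impI)
    show "\<delta> / (n + 1) > 0" using \<delta> n by simp
    fix y assume y: "norm (y - z) < \<delta> / (n + 1)"
    define v where "v = y - z"
    have step: "norm (f (z + (\<Sum>j\<in>J. axis j (v $ j))) - f z - (\<Sum>j\<in>J. v $ j * partial_deriv j f z))
        \<le> card J * (e / n * norm v)" for J
    proof (induction J rule: infinite_finite_induct)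
      case (insert i J)
      define w where "w = z + (\<Sum>j\<in>J. axis j (v $ j))"
      define c where "c = partial_deriv i f z"
      define g where "g t = f (w + axis i t)" for t
      have "norm ((g (v $ i) - c * (v $ i)) - (g 0 - c * 0)) \<le> (e / n) * norm (v $ i - 0)"
      proof (rule field_differentiable_bound[where S = "cball 0 (norm (v $ i))"
            and f' = "\<lambda>t. deriv g t - c" and f = "\<lambda>t. g t - c * t"])
        fix t :: complex assume t: "t \<in> cball 0 (norm (v $ i))"
        have "g holomorphic_on UNIV" using hol[of w i] unfolding g_def .
        then have "(g has_field_derivative deriv g t) (at t)"
          by (rule holomorphic_derivI[OF _ open_UNIV UNIV_I])
        then have "((\<lambda>t. g t - c * t) has_field_derivative deriv g t - c * 1) (at t)"
          by (intro DERIV_diff DERIV_cmult DERIV_ident)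
        then show "((\<lambda>t. g t - c * t) has_field_derivative deriv g t - c) (at t within cball 0 (norm (v $ i)))"
          by (simp add: has_field_derivative_at_within)
        have "norm (\<Sum>j\<in>J. axis j (v $ j)) \<le> (\<Sum>j\<in>J. norm v)"
          by (intro sum_norm_le) (auto simp: Finite_Cartesian_Product.norm_nth_le)
        also have "\<dots> \<le> n * norm v"
          by (auto simp: n_def intro!: mult_right_mono card_mono)
        finally have "norm ((\<Sum>j\<in>J. axis j (v $ j)) + axis i t) \<le> n * norm v + norm v"
          using t Finite_Cartesian_Product.norm_nth_le[of v i]
          by (intro order_trans[OF norm_triangle_ineq] add_mono) auto
        also have "\<dots> < \<delta>"
          using y n by (simp add: v_def field_simps)
        finally have "dist (w + axis i t) z < \<delta>"
          by (simp add: w_def dist_norm add.assoc)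
        then show "norm (deriv g t - c) \<le> e / n"
          using \<delta>(2)[of "w + axis i t" i] by (simp add: g_def[abs_def] c_def partial_deriv_axis dist_norm)
      qed auto
      also have "\<dots> \<le> (e / n) * norm v"
        using e n Finite_Cartesian_Product.norm_nth_le[of v i] by (intro mult_left_mono) auto
      finally have 1: "norm (g (v $ i) - f w - v $ i * c) \<le> e / n * norm v"
        by (simp add: g_def algebra_simps)
      have 2: "norm (f w - f z - (\<Sum>j\<in>J. v $ j * partial_deriv j f z)) \<le> card J * (e / n * norm v)"
        using insert.IH by (simp add: w_def)
      have "f (z + (\<Sum>j\<in>insert i J. axis j (v $ j))) = g (v $ i)"
        using insert by (simp add: g_def w_def algebra_simps)
      then have "f (z + (\<Sum>j\<in>insert i J. axis j (v $ j))) - f z - (\<Sum>j\<in>insert i J. v $ j * partial_deriv j f z)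
          = (g (v $ i) - f w - v $ i * c) + (f w - f z - (\<Sum>j\<in>J. v $ j * partial_deriv j f z))"
        using insert by (simp add: c_def)
      also have "norm \<dots> \<le> e / n * norm v + card J * (e / n * norm v)"
        by (rule norm_triangle_mono[OF 1 2])
      also have "\<dots> = card (insert i J) * (e / n * norm v)"
        using insert by (simp add: algebra_simps add_divide_distrib)
      finally show ?case .
    qed auto
    show "norm (f y - f z - (\<Sum>j\<in>UNIV. (y - z) $ j * partial_deriv j f z)) \<le> e * norm (y - z)"
      using step[of UNIV] n unfolding sum_axis_nth by (simp add: v_def n_def)
  qed
qed

text \<open>
  The easy half of Osgood's lemma, with continuity assumed.  It replaces Frechet derivatives by
  slices in one variable, which are stable under limits and under differentiation.
\<close>
theorem entire_iff_separately_holomorphic: "entire f \<longleftrightarrow> separately_holomorphic f"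
proof
  assume f: "entire f"
  show "separately_holomorphic f"
    unfolding separately_holomorphic_def
  proof (intro conjI allI)
    show "continuous_on UNIV f"
      using f by (auto simp: entire_def continuous_on_eq_continuous_at intro: has_derivative_continuous)
    fix z j
    show "(\<lambda>t. f (z + axis j t)) holomorphic_on UNIV"
    proof (subst holomorphic_on_def, intro ballI)
      fix t :: complex
      obtain D where D: "(f has_derivative D) (at (z + axis j t))" "\<And>c v. D (c *s v) = c * D v"
        using f unfolding entire_def by blast
      have "((\<lambda>t. z + axis j t) has_derivative axis j) (at t)"
        using has_derivative_add[OF has_derivative_const bounded_linear_imp_has_derivative[OF bounded_linear_axis]]
        by simp
      then have "((\<lambda>t. f (z + axis j t)) has_derivative (\<lambda>h. D (axis j h))) (at t)"
        using has_derivative_compose[of "\<lambda>t. z + axis j t" "axis j" t UNIV f D] D(1) by simp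
      moreover have "(\<lambda>h. D (axis j h)) = (*) (D (axis j 1))"
      proof
        fix h
        have "D (axis j h) = D (h *s axis j 1)" by (rule arg_cong[OF axis_smult])
        also have "\<dots> = D (axis j 1) * h" unfolding D(2) by (rule mult.commute)
        finally show "D (axis j h) = D (axis j 1) * h" .
      qed
      ultimately have "((\<lambda>t. f (z + axis j t)) has_field_derivative D (axis j 1)) (at t)"
        unfolding has_field_derivative_def by (simp only:)
      then show "(\<lambda>t. f (z + axis j t)) field_differentiable at t within UNIV"
        by (auto simp: field_differentiable_def)
    qed
  qed
next
  assume f: "separately_holomorphic f"
  show "entire f"
    unfolding entire_def
  proof (intro allI)
    fix z
    have "(\<Sum>j\<in>UNIV. (c *s v) $ j * partial_deriv j f z) = c * (\<Sum>j\<in>UNIV. v $ j * partial_deriv j f z)"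
      for c v by (simp add: sum_distrib_left mult.assoc)
    then show "\<exists>D. (f has_derivative D) (at z) \<and> (\<forall>c v. D (c *s v) = c * D v)"
      using separately_holomorphic_has_derivative[OF f, of z] by blast
  qed
qed

lemma entire_continuous: "entire f \<Longrightarrow> continuous_on UNIV f"
  by (simp add: entire_iff_separately_holomorphic separately_holomorphic_def)

lemma entire_slice: "entire f \<Longrightarrow> (\<lambda>t. f (z + axis j t)) holomorphic_on UNIV"
  by (simp add: entire_iff_separately_holomorphic separately_holomorphic_def)

lemma entire_partial_deriv: "entire f \<Longrightarrow> entire (partial_deriv j f)"
  by (simp add: entire_iff_separately_holomorphic separately_holomorphic_partial_deriv)

lemma entire_has_derivative:
  "entire f \<Longrightarrow> (f has_derivative (\<lambda>v. \<Sum>j\<in>UNIV. v $ j * partial_deriv j f z)) (at z)"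
  by (simp add: entire_iff_separately_holomorphic separately_holomorphic_has_derivative)

lemma entire_lipschitz_on_cball:
  fixes f :: "complex ^ 'n \<Rightarrow> complex"
  assumes f: "entire f" and B: "\<And>z. norm z \<le> r + 1 \<Longrightarrow> norm (f z) \<le> B"
    and xy: "norm x \<le> r" "norm y \<le> r"
  shows "norm (f x - f y) \<le> real CARD('n) * B * norm (x - y)"
proof (rule differentiable_bound[where S = "cball 0 r"])
  fix z :: "complex ^ 'n" assume z: "z \<in> cball 0 r"
  show "(f has_derivative (\<lambda>v. \<Sum>j\<in>UNIV. v $ j * partial_deriv j f z)) (at z within cball 0 r)"
    using entire_has_derivative[OF f] by (rule has_derivative_at_withinI)
  show "onorm (\<lambda>v. \<Sum>j\<in>UNIV. v $ j * partial_deriv j f z) \<le> real CARD('n) * B"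
  proof (rule onorm_le)
    fix v :: "complex ^ 'n"
    have d: "norm (partial_deriv j f z) \<le> B" for j
    proof -
      have "norm (f (z + axis j t)) \<le> B" if "norm t = 1" for t
        using z that norm_triangle_ineq[of z "axis j t"] by (intro B) auto
      then show ?thesis
        using partial_deriv_bound[of f 1 z j B] f by (simp add: entire_iff_separately_holomorphic)
    qed
    have "norm (\<Sum>j\<in>UNIV. v $ j * partial_deriv j f z) \<le> (\<Sum>j\<in>(UNIV::'n set). norm v * B)"
      unfolding norm_mult
      by (intro sum_norm_le)
        (auto simp: norm_mult intro!: mult_mono d Finite_Cartesian_Product.norm_nth_le)
    then show "norm (\<Sum>j\<in>UNIV. v $ j * partial_deriv j f z) \<le> real CARD('n) * B * norm v"
      by (simp add: mult_ac)
  qed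
qed (use xy in auto)

lemma entire_uniform_limit:
  assumes "\<And>k. entire (F k)" "\<And>r. uniform_limit (cball 0 r) F f sequentially"
  shows "entire f"
  using assms separately_holomorphic_limit unfolding entire_iff_separately_holomorphic by blast

text \<open>
  Cauchy's estimate in each coordinate turns the local bounds into local Lipschitz bounds; the rest
  is the Arzela-Ascoli theorem on the balls of integer radius and a diagonal sequence.
\<close>
lemma entire_Montel:
  fixes F :: "nat \<Rightarrow> complex ^ 'n \<Rightarrow> complex"
  assumes F: "\<And>k. entire (F k)" and bd: "\<And>r. \<exists>B. \<forall>k z. norm z \<le> r \<longrightarrow> norm (F k z) \<le> B"
  obtains f s where "entire f" "strict_mono (s :: nat \<Rightarrow> nat)" "\<And>z. (\<lambda>k. F (s k) z) \<longlonglongrightarrow> f z"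
proof -
  define P where "P i s \<longleftrightarrow> (\<exists>g. uniform_limit (cball 0 (real i)) (\<lambda>k. F (s k)) g sequentially)"
    for i and s :: "nat \<Rightarrow> nat"
  obtain s where s: "strict_mono (s :: nat \<Rightarrow> nat)" "\<And>i. P i (id \<circ> s)"
  proof (rule subsequence_diagonalization_lemma[where P = P and r = id])
    fix i and r :: "nat \<Rightarrow> nat"
    obtain B where B: "\<And>k z. norm z \<le> real i + 1 \<Longrightarrow> norm (F k z) \<le> B"
      using bd by blast
    have B0: "B \<ge> 0" using order_trans[OF norm_ge_zero B[of 0 0]] by simp
    define L where "L = real CARD('n) * B + 1"
    have L: "L > 0" using B0 by (simp add: L_def add_nonneg_pos)
    obtain g k where k: "strict_mono (k :: nat \<Rightarrow> nat)" and
      lim: "\<And>e. 0 < e \<Longrightarrow> \<exists>N. \<forall>n x. n \<ge> N \<and> x \<in> cball 0 (real i) \<longrightarrow> norm ((F \<circ> r) (k n) x - g x) < e"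
    proof (rule Arzela_Ascoli[of "cball 0 (real i)" "F \<circ> r" B])
      show "norm ((F \<circ> r) n x) \<le> B" if "x \<in> cball 0 (real i)" for n x
        using that by (auto intro!: B)
      show "\<exists>d>0. \<forall>n y. y \<in> cball 0 (real i) \<and> norm (x - y) < d \<longrightarrow> norm ((F \<circ> r) n x - (F \<circ> r) n y) < e"
        if x: "x \<in> cball 0 (real i)" and e: "e > 0" for x e
      proof (intro exI[of _ "e / L"] conjI allI impI)
        fix n y assume y: "y \<in> cball 0 (real i) \<and> norm (x - y) < e / L"
        have "norm (F (r n) x - F (r n) y) \<le> real CARD('n) * B * norm (x - y)"
          using x y by (intro entire_lipschitz_on_cball[OF F B]) auto
        also have "\<dots> \<le> L * norm (x - y)"
          by (intro mult_right_mono) (auto simp: L_def)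
        also have "\<dots> < e"
          using y L by (simp add: field_simps)
        finally show "norm ((F \<circ> r) n x - (F \<circ> r) n y) < e" by simp
      qed (use e L in auto)
    qed auto
    have "P i (r \<circ> k)"
      unfolding P_def uniform_limit_sequentially_iff
    proof (intro exI[of _ g] allI impI)
      fix e :: real assume "e > 0"
      from lim[OF this] obtain N where
        "\<And>n x. n \<ge> N \<Longrightarrow> x \<in> cball 0 (real i) \<Longrightarrow> norm ((F \<circ> r) (k n) x - g x) < e" by blast
      then show "\<exists>N. \<forall>n\<ge>N. \<forall>x\<in>cball 0 (real i). dist (F ((r \<circ> k) n) x) (g x) < e"
        by (intro exI[of _ N]) (simp add: dist_norm)
    qed
    then show "\<exists>k. strict_mono k \<and> P i (r \<circ> k)"
      using k by blast
  next
    fix i and r k1 k2 :: "nat \<Rightarrow> nat" and N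
    assume "P i (r \<circ> k1)" and sub: "\<And>j. N \<le> j \<Longrightarrow> \<exists>j'\<ge>j. k2 j = k1 j'"
    then obtain g where g: "uniform_limit (cball 0 (real i)) (\<lambda>k. F ((r \<circ> k1) k)) g sequentially"
      by (auto simp: P_def)
    have "uniform_limit (cball 0 (real i)) (\<lambda>k. F ((r \<circ> k2) k)) g sequentially"
      unfolding uniform_limit_sequentially_iff
    proof (intro allI impI)
      fix e :: real assume "e > 0"
      then obtain M where M: "\<And>n x. n \<ge> M \<Longrightarrow> x \<in> cball 0 (real i) \<Longrightarrow> dist (F ((r \<circ> k1) n) x) (g x) < e"
        using g unfolding uniform_limit_sequentially_iff by meson
      show "\<exists>M. \<forall>n\<ge>M. \<forall>x\<in>cball 0 (real i). dist (F ((r \<circ> k2) n) x) (g x) < e"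
      proof (intro exI allI impI ballI)
        fix n and x :: "complex ^ 'n" assume n: "max M N \<le> n" and x: "x \<in> cball 0 (real i)"
        obtain j' where "j' \<ge> n" "k2 n = k1 j'" using sub[of n] n by auto
        then show "dist (F ((r \<circ> k2) n) x) (g x) < e"
          using M[of j' x] n x by simp
      qed
    qed
    then show "P i (r \<circ> k2)"
      by (auto simp: P_def)
  qed (rule that)
  define f where "f z = Topological_Spaces.lim (\<lambda>k. F (s k) z)" for z
  have unif: "uniform_limit (cball 0 (real i)) (\<lambda>k. F (s k)) f sequentially" for i
  proof -
    obtain g where g: "uniform_limit (cball 0 (real i)) (\<lambda>k. F (s k)) g sequentially"
      using s(2)[of i] by (auto simp: P_def)
    have "g z = f z" if "z \<in> cball 0 (real i)" for z
      using tendsto_uniform_limitI[OF g that] by (simp add: f_def limI)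
    then show ?thesis
      using g by (auto intro: uniform_limit_cong'[THEN iffD1, rotated -1])
  qed
  show thesis
  proof (rule that[of f s])
    show "entire f"
    proof (rule entire_uniform_limit)
      fix r :: real
      obtain i where "r \<le> real i" using real_arch_simple by blast
      then show "uniform_limit (cball 0 r) (\<lambda>k. F (s k)) f sequentially"
        by (intro uniform_limit_on_subset[OF unif[of i]]) auto
    qed (rule F)
    fix z :: "complex ^ 'n"
    obtain i where "norm z \<le> real i" using real_arch_simple by blast
    then show "(\<lambda>k. F (s k) z) \<longlonglongrightarrow> f z"
      by (intro tendsto_uniform_limitI[OF unif[of i]]) auto
  qed (rule s)
qed

section \<open>Integral bounds for entire functions of one variable\<close>

lemma nn_integral_translate:
  fixes f :: "'a::euclidean_space \<Rightarrow> ennreal"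
  assumes [measurable]: "f \<in> borel_measurable borel"
  shows "(\<integral>\<^sup>+ x. f (c + x) \<partial>lborel) = (\<integral>\<^sup>+ x. f x \<partial>lborel)"
  by (subst (2) lborel_distr_plus[symmetric, of c]) (simp add: nn_integral_distr)

lemma lborel_Fubini:
  fixes f :: "'a::euclidean_space \<Rightarrow> 'b::euclidean_space \<Rightarrow> ennreal"
  assumes "case_prod f \<in> borel_measurable (borel \<Otimes>\<^sub>M borel)"
  shows "(\<integral>\<^sup>+ y. \<integral>\<^sup>+ x. f x y \<partial>lborel \<partial>lborel) = (\<integral>\<^sup>+ x. \<integral>\<^sup>+ y. f x y \<partial>lborel \<partial>lborel)"
proof (rule lborel_pair.Fubini')
  show "case_prod f \<in> borel_measurable (lborel \<Otimes>\<^sub>M lborel)"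
    using assms measurable_cong_sets[OF sets_pair_measure_cong[OF sets_lborel sets_lborel] refl] by blast
qed

text \<open>
  Cauchy's formula on the circle of radius \<open>r / 2\<close> about \<open>z + w\<close>.  Letting the centre vary instead of the
  radius prepares an area mean that uses nothing but translations of the plane: \<open>z\<close> stays at distance
  at least \<open>r / 4\<close> from all these circles.
\<close>
lemma Cauchy_offcentre_bound:
  assumes g: "g holomorphic_on UNIV" and r: "r > 0" and w: "norm w < r / 4"
  shows "ennreal (norm (g z)) \<le>
    2 * (\<integral>\<^sup>+ \<theta>. indicator {0..1} \<theta> * ennreal (norm (g (z + w + r / 2 * exp (2 * pi * \<i> * of_real \<theta>)))) \<partial>lborel)"
proof -
  define \<gamma> where "\<gamma> = circlepath (z + w) (r / 2)"
  have \<gamma>: "\<gamma> \<theta> = z + w + r / 2 * exp (2 * pi * \<i> * of_real \<theta>)" for \<theta>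
    by (simp add: \<gamma>_def circlepath)
  have contg: "continuous_on UNIV g" using g by (rule holomorphic_on_imp_continuous_on)
  have "((\<lambda>u. g u / (u - z)) has_contour_integral (2 * of_real pi * \<i> * g z)) \<gamma>"
    unfolding \<gamma>_def using g w r
    by (intro Cauchy_integral_circlepath_simple) (auto intro: holomorphic_on_subset simp: norm_minus_commute)
  then have 1: "((\<lambda>x. g (\<gamma> x) / (\<gamma> x - z) * vector_derivative \<gamma> (at x within {0..1}))
      has_integral (2 * of_real pi * \<i> * g z)) {0..1}"
    by (simp add: has_contour_integral_def)
  have cont: "continuous_on {0..1} (\<lambda>x. norm (g (\<gamma> x)))"
    unfolding \<gamma> by (intro continuous_intros continuous_on_compose2[OF contg]) auto
  then obtain I where I: "((\<lambda>x. norm (g (\<gamma> x))) has_integral I) {0..1}"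
    using integrable_continuous_interval[OF cont] unfolding integrable_on_def by blast
  have "norm (2 * of_real pi * \<i> * g z) \<le> integral {0..1} (\<lambda>x. 4 * pi * norm (g (\<gamma> x)))"
    unfolding integral_unique[OF 1, symmetric]
  proof (rule integral_norm_bound_integral)
    show "(\<lambda>x. 4 * pi * norm (g (\<gamma> x))) integrable_on {0..1}"
      using I by (intro integrable_on_mult_right) (auto simp: integrable_on_def)
    fix x :: real assume x: "x \<in> {0..1}"
    have "norm (w + r / 2 * exp (2 * pi * \<i> * of_real x)) \<ge> norm (r / 2 * exp (2 * pi * \<i> * of_real x)) - norm w"
      using norm_diff_ineq[of "r / 2 * exp (2 * pi * \<i> * of_real x)" w] by (simp add: add.commute)
    also have "norm (r / 2 * exp (2 * pi * \<i> * of_real x)) = r / 2"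
      using r by (simp add: norm_mult norm_divide)
    finally have d: "norm (\<gamma> x - z) \<ge> r / 4" using w by (simp add: \<gamma>)
    have "norm (g (\<gamma> x) / (\<gamma> x - z) * vector_derivative \<gamma> (at x within {0..1}))
        = norm (g (\<gamma> x)) * (pi * r) / norm (\<gamma> x - z)"
      using x r by (simp add: \<gamma>_def vector_derivative_circlepath01 norm_mult norm_divide)
    also have "\<dots> \<le> norm (g (\<gamma> x)) * (pi * r) / (r / 4)"
      using d r by (intro divide_left_mono mult_pos_pos) auto
    finally show "norm (g (\<gamma> x) / (\<gamma> x - z) * vector_derivative \<gamma> (at x within {0..1})) \<le> 4 * pi * norm (g (\<gamma> x))"
      using r by (simp add: mult_ac)
  qed (use 1 in \<open>auto simp: integrable_on_def\<close>)
  also have "\<dots> = 4 * pi * I"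
    using I by (simp add: integral_unique)
  finally have "norm (g z) \<le> 2 * I"
    by (simp add: norm_mult)
  moreover have "(\<integral>\<^sup>+ \<theta>. indicator {0..1} \<theta> * ennreal (norm (g (\<gamma> \<theta>))) \<partial>lborel) = ennreal I"
    using nn_integral_has_integral_lebesgue[OF _ I] by (simp add: ennreal_mult' ennreal_indicator)
  moreover have "I \<ge> 0"
    using I by (rule has_integral_nonneg) auto
  ultimately show ?thesis
    unfolding \<gamma> by (simp add: ennreal_leI flip: ennreal_mult' ennreal_numeral)
qed

text \<open>
  Average the preceding bound over \<open>|w| < r / 4\<close> and exchange the integrals: for every angle, the
  translated disc of centres lies in the disc of radius \<open>r\<close> about \<open>z\<close>.
\<close>
lemma norm_le_area_integral:
  assumes g: "g holomorphic_on UNIV" and r: "r > 0"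
  shows "ennreal (norm (g z) * (pi * r\<^sup>2 / 32)) \<le>
    (\<integral>\<^sup>+ x. indicator (ball z r) x * ennreal (norm (g x)) \<partial>lborel)" (is "_ \<le> ?J")
proof -
  define e where "e \<theta> = r / 2 * exp (2 * pi * \<i> * complex_of_real \<theta>)" for \<theta>
  have norm_e: "norm (e \<theta>) = r / 2" for \<theta>
    using r by (simp add: e_def norm_mult norm_divide)
  have contg: "continuous_on UNIV g" using g by (rule holomorphic_on_imp_continuous_on)
  have gm [measurable]: "g \<in> borel_measurable borel"
    using contg by (rule borel_measurable_continuous_onI)
  have [measurable]: "ball c s \<in> sets borel" for c :: complex and s by simp
  have em [measurable]: "e \<in> borel_measurable borel"
    unfolding e_def by (intro borel_measurable_continuous_onI continuous_intros)
  have "ennreal (norm (g z) * (pi * r\<^sup>2 / 16)) = ennreal (norm (g z)) * emeasure lborel (ball 0 (r / 4) :: complex set)"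
    using r ennreal_mult'[of "pi * r\<^sup>2 / 16" "norm (g z)"]
    by (simp add: emeasure_ball unit_ball_vol_2 power_divide mult.commute)
  also have "\<dots> = (\<integral>\<^sup>+ w. ennreal (norm (g z)) * indicator (ball 0 (r / 4) :: complex set) w \<partial>lborel)"
    by (rule nn_integral_cmult_indicator[symmetric]) simp
  also have "\<dots> \<le> (\<integral>\<^sup>+ w. (\<integral>\<^sup>+ \<theta>. 2 * indicator {0..1} \<theta> *
      (indicator (ball 0 (r / 4)) w * ennreal (norm (g (z + w + e \<theta>)))) \<partial>lborel) \<partial>lborel)"
  proof (rule nn_integral_mono)
    fix w :: complex
    show "ennreal (norm (g z)) * indicator (ball 0 (r / 4)) w \<le> (\<integral>\<^sup>+ \<theta>. 2 * indicator {0..1} \<theta> *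
      (indicator (ball 0 (r / 4)) w * ennreal (norm (g (z + w + e \<theta>)))) \<partial>lborel)"
      using Cauchy_offcentre_bound[OF g r, of w z]
      by (auto simp: indicator_def[of "ball 0 (r/4)"] e_def mult.assoc nn_integral_cmult)
  qed
  also have "\<dots> = (\<integral>\<^sup>+ \<theta>. (\<integral>\<^sup>+ w. 2 * indicator {0..1} \<theta> *
      (indicator (ball 0 (r / 4)) w * ennreal (norm (g (z + w + e \<theta>)))) \<partial>lborel) \<partial>lborel)"
    by (rule lborel_Fubini) measurable
  also have "\<dots> \<le> (\<integral>\<^sup>+ \<theta>. 2 * indicator {0..1::real} \<theta> * ?J \<partial>lborel)"
  proof (rule nn_integral_mono)
    fix \<theta> :: real
    have "(\<integral>\<^sup>+ w. indicator (ball 0 (r / 4)) w * ennreal (norm (g (z + w + e \<theta>))) \<partial>lborel)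
        \<le> (\<integral>\<^sup>+ w. indicator (ball z r) ((z + e \<theta>) + w) * ennreal (norm (g ((z + e \<theta>) + w))) \<partial>lborel)"
    proof (rule nn_integral_mono)
      fix w :: complex
      have "(z + e \<theta>) + w \<in> ball z r" if "w \<in> ball 0 (r / 4)"
      proof -
        have "dist z ((z + e \<theta>) + w) = norm (e \<theta> + w)"
          using norm_minus_cancel[of "e \<theta> + w"] by (simp add: dist_norm)
        then show ?thesis
          using that norm_triangle_ineq[of "e \<theta>" w] norm_e[of \<theta>] r by simp
      qed
      then show "indicator (ball 0 (r / 4)) w * ennreal (norm (g (z + w + e \<theta>)))
          \<le> indicator (ball z r) ((z + e \<theta>) + w) * ennreal (norm (g ((z + e \<theta>) + w)))"
        by (auto simp: indicator_def ac_simps)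
    qed
    also have "\<dots> = ?J"
      by (rule nn_integral_translate) measurable
    finally show "(\<integral>\<^sup>+ w. 2 * indicator {0..1} \<theta> *
      (indicator (ball 0 (r / 4)) w * ennreal (norm (g (z + w + e \<theta>)))) \<partial>lborel) \<le> 2 * indicator {0..1} \<theta> * ?J"
      by (subst nn_integral_cmult) (auto intro!: mult_left_mono)
  qed
  also have "\<dots> = 2 * ?J"
    by (simp add: nn_integral_multc nn_integral_cmult)
  finally have le: "ennreal (norm (g z) * (pi * r\<^sup>2 / 16)) \<le> 2 * ?J" .
  show ?thesis
  proof (cases ?J)
    case (real x)
    then have "norm (g z) * (pi * r\<^sup>2 / 16) \<le> 2 * x"
      using le by (simp flip: ennreal_numeral ennreal_mult')
    then show ?thesis
      unfolding real by (intro ennreal_leI) simp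
  qed auto
qed

text \<open>
  For exponents below 1 the \<open>q\<close>-th power is not convex, so this does not follow from the case \<open>q = 1\<close> by
  Jensen's inequality.  Instead take the maximum point \<open>y\<close> of \<open>(r - |x|)\<^sup>2 |g(x)|\<^sup>q\<close>: around \<open>y\<close> the
  function is at most a multiple of \<open>|g(y)|\<close>, so that \<open>|g|\<close> is dominated there by a small multiple of
  \<open>|g(y)|\<close>, to be absorbed, plus a multiple of \<open>|g(y)|\<^sup>1\<^sup>-\<^sup>q |g|\<^sup>q\<close>.  This works for all \<open>q > 0\<close>.
\<close>
lemma sub_mean_value_powr:
  fixes q :: real
  assumes q: "q > 0"
  shows "\<exists>C>0. \<forall>g r z. g holomorphic_on UNIV \<longrightarrow> r > 0 \<longrightarrow> norm z \<le> r / 2 \<longrightarrow>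
      ennreal (norm (g z) powr q * r\<^sup>2) \<le>
      ennreal C * (\<integral>\<^sup>+ x. indicator (ball 0 r) x * ennreal (norm (g x) powr q) \<partial>lborel)"
proof -
  define C where "C = 4 * (256 * 4 powr (1 / q) * 64 powr q)"
  have C: "C > 0" by (simp add: C_def)
  have "ennreal (norm (g z) powr q * r\<^sup>2) \<le> ennreal C * J"
    if g: "g holomorphic_on UNIV" and r: "r > 0" and z: "norm z \<le> r / 2"
      and J: "J = (\<integral>\<^sup>+ x. indicator (ball 0 r) x * ennreal (norm (g x) powr q) \<partial>lborel)" for g r z J
  proof (cases J)
    case (real j)
    have contg: "continuous_on UNIV g" using g by (rule holomorphic_on_imp_continuous_on)
    then have gm [measurable]: "g \<in> borel_measurable borel"
      by (rule borel_measurable_continuous_onI)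
    define H where "H x = (r - norm x)\<^sup>2 * norm (g x) powr q" for x
    have "continuous_on (cball 0 r) H"
      unfolding H_def using q
      by (intro continuous_intros continuous_on_powr' continuous_on_subset[OF contg]) auto
    then obtain y where y: "y \<in> cball 0 r" "\<And>x. x \<in> cball 0 r \<Longrightarrow> H x \<le> H y"
      using continuous_attains_sup[of "cball 0 r" H] r by auto
    define d where "d = r - norm y"
    define a where "a = norm (g y)"
    have Hy: "H y \<le> C / 4 * j"
    proof (cases "H y = 0")
      case True then show ?thesis using real by (simp add: C_def)
    next
      case False
      then have a: "a > 0" and d: "d > 0"
        using y(1) by (auto simp: H_def a_def d_def)
      define M where "M = 4 powr (1 / q) * a"
      have M: "M > 0" using a by (simp add: M_def)
      \<comment> \<open>Maximality of \<open>y\<close> controls \<open>g\<close> on the half-size disc by the value at its centre.\<close>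
      have loc: "norm x < r \<and> norm (g x) \<le> M" if x: "x \<in> ball y (d / 2)" for x
      proof -
        have nx: "norm x < norm y + d / 2"
          using x norm_triangle_ineq[of y "x - y"] by (simp add: dist_norm norm_minus_commute)
        then have xr: "r - norm x > d / 2" by (simp add: d_def field_simps)
        then have "(d / 2)\<^sup>2 * norm (g x) powr q \<le> H x"
          unfolding H_def using d by (intro mult_right_mono power_mono) auto
        also have "\<dots> \<le> H y" using xr d by (intro y(2)) auto
        also have "\<dots> = d\<^sup>2 * a powr q" by (simp add: H_def d_def a_def)
        finally have "norm (g x) powr q \<le> 4 * a powr q"
          using d by (simp add: power_divide field_simps)
        also have "\<dots> = M powr q"
          using a q by (simp add: M_def powr_mult powr_powr)
        finally have "norm (g x) \<le> M"
          using q M by (metis norm_ge_zero not_le powr_less_mono2 less_eq_real_def)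
        then show ?thesis using xr d by simp
      qed
      \<comment> \<open>A value \<open>t\<close> above the small threshold \<open>l\<close> is at most \<open>M\<close>, and there \<open>1 \<le> (t / l) powr q\<close>.\<close>
      define l where "l = a / 64"
      have l: "l > 0" using a by (simp add: l_def)
      define K where "K = M / l powr q"
      have K: "K > 0" using M l by (simp add: K_def)
      have pt: "t \<le> l + K * t powr q" if t: "0 \<le> t" "t \<le> M" for t
      proof (cases "t \<le> l")
        case True then show ?thesis using K by (simp add: add_increasing2)
      next
        case False
        then have "l powr q \<le> t powr q" using l q by (intro powr_mono2) auto
        then have "M * 1 \<le> M * (t powr q / l powr q)" using l M by (intro mult_left_mono) auto
        then show ?thesis using t l by (simp add: K_def)
      qed
      have [measurable]: "ball c s \<in> sets borel" for c :: complex and s by simp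
      have "ennreal (a * (pi * (d / 2)\<^sup>2 / 32)) \<le> (\<integral>\<^sup>+ x. indicator (ball y (d / 2)) x * ennreal (norm (g x)) \<partial>lborel)"
        unfolding a_def using d by (intro norm_le_area_integral[OF g]) simp
      also have "\<dots> \<le> (\<integral>\<^sup>+ x. ennreal l * indicator (ball y (d / 2)) x
          + ennreal K * (indicator (ball 0 r) x * ennreal (norm (g x) powr q)) \<partial>lborel)"
      proof (rule nn_integral_mono)
        fix x
        have "ennreal (norm (g x)) \<le> ennreal l + ennreal K * ennreal (norm (g x) powr q)" if "norm (g x) \<le> M"
          using pt[OF norm_ge_zero that] l K by (simp flip: ennreal_mult' ennreal_plus)
        then show "indicator (ball y (d / 2)) x * ennreal (norm (g x)) \<le> ennreal l * indicator (ball y (d / 2)) x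
            + ennreal K * (indicator (ball 0 r) x * ennreal (norm (g x) powr q))"
          using loc[of x] by (auto simp: indicator_def)
      qed
      also have "\<dots> = (\<integral>\<^sup>+ x. ennreal l * indicator (ball y (d / 2)) x \<partial>lborel)
          + (\<integral>\<^sup>+ x. ennreal K * (indicator (ball 0 r) x * ennreal (norm (g x) powr q)) \<partial>lborel)"
        by (rule nn_integral_add) measurable
      also have "(\<integral>\<^sup>+ x. ennreal l * indicator (ball y (d / 2)) x \<partial>lborel) = ennreal l * emeasure lborel (ball y (d / 2))"
        by (rule nn_integral_cmult_indicator) simp
      also have "(\<integral>\<^sup>+ x. ennreal K * (indicator (ball 0 r) x * ennreal (norm (g x) powr q)) \<partial>lborel) = ennreal K * J"
        unfolding J by (rule nn_integral_cmult) measurable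
      also have "ennreal l * emeasure lborel (ball y (d / 2)) + ennreal K * J = ennreal (l * (pi * d\<^sup>2 / 4) + K * j)"
        using l d K real by (simp add: emeasure_ball unit_ball_vol_2 power_divide flip: ennreal_mult' ennreal_plus)
      finally have "a * (pi * (d / 2)\<^sup>2 / 32) \<le> l * (pi * d\<^sup>2 / 4) + K * j"
        using l K real by (subst (asm) ennreal_le_iff) auto
      then have "a * (pi * d\<^sup>2 / 256) \<le> K * j"
        by (simp add: l_def power_divide algebra_simps)
      also have "K * j = a * (4 powr (1 / q) * 64 powr q / a powr q * j)"
        using a by (simp add: K_def M_def l_def powr_divide)
      finally have "pi * d\<^sup>2 / 256 \<le> 4 powr (1 / q) * 64 powr q / a powr q * j"
        by (simp only: mult_le_cancel_left_pos[OF a])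
      moreover have "1 * d\<^sup>2 / 256 \<le> pi * d\<^sup>2 / 256"
        using pi_ge_two by (intro divide_right_mono mult_right_mono) auto
      ultimately have "d\<^sup>2 / 256 \<le> 4 powr (1 / q) * 64 powr q / a powr q * j" by simp
      then show ?thesis
        using a by (simp add: H_def a_def d_def C_def field_simps)
    qed
    have "(r / 2)\<^sup>2 * norm (g z) powr q \<le> H z"
      unfolding H_def using z r by (intro mult_right_mono power_mono) auto
    also have "\<dots> \<le> C / 4 * j"
      using z r by (intro order_trans[OF y(2) Hy]) auto
    finally have "norm (g z) powr q * r\<^sup>2 \<le> C * j"
      by (simp add: power_divide mult_ac)
    then show ?thesis
      using real by (simp add: C_def ennreal_leI flip: ennreal_mult')
  qed (simp add: C_def ennreal_mult_top)
  then show ?thesis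
    using C by (intro exI[of _ C] conjI allI impI) auto
qed

lemma deriv_powr_le_area_integral:
  fixes q :: real
  assumes q: "q > 0"
  shows "\<exists>C>0. \<forall>g r. g holomorphic_on UNIV \<longrightarrow> r > 0 \<longrightarrow>
      ennreal (norm (deriv g 0) powr q * r powr (q + 2)) \<le>
      ennreal C * (\<integral>\<^sup>+ x. indicator (ball 0 r) x * ennreal (norm (g x) powr q) \<partial>lborel)"
proof -
  obtain C where C: "C > 0"
    "\<forall>g r z. g holomorphic_on UNIV \<longrightarrow> r > 0 \<longrightarrow> norm z \<le> r / 2 \<longrightarrow>
      ennreal (norm (g z) powr q * r\<^sup>2) \<le>
      ennreal C * (\<integral>\<^sup>+ x. indicator (ball 0 r) x * ennreal (norm (g x) powr q) \<partial>lborel)"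
    using sub_mean_value_powr[OF q] by blast
  show ?thesis
  proof (intro exI[of _ "2 powr q * C"] conjI allI impI)
    show "2 powr q * C > 0" using C by simp
    fix g :: "complex \<Rightarrow> complex" and r :: real
    assume g: "g holomorphic_on UNIV" and r: "r > 0"
    define J where "J = (\<integral>\<^sup>+ x. indicator (ball 0 r) x * ennreal (norm (g x) powr q) \<partial>lborel)"
    show "ennreal (norm (deriv g 0) powr q * r powr (q + 2)) \<le> ennreal (2 powr q * C) *
      (\<integral>\<^sup>+ x. indicator (ball 0 r) x * ennreal (norm (g x) powr q) \<partial>lborel)"
      unfolding J_def[symmetric]
    proof (cases J)
      case (real j)
      define B where "B = (C * j / r\<^sup>2) powr (1 / q)"
      have B: "norm (g z) \<le> B" if "norm z = r / 2" for z
      proof -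
        have "ennreal (norm (g z) powr q * r\<^sup>2) \<le> ennreal C * J"
          unfolding J_def using C(2) g r that by simp
        then have "norm (g z) powr q * r\<^sup>2 \<le> C * j"
          using real C by (simp flip: ennreal_mult')
        then have "norm (g z) powr q \<le> C * j / r\<^sup>2"
          using r by (simp add: field_simps)
        then have "(norm (g z) powr q) powr (1 / q) \<le> B"
          unfolding B_def using q by (intro powr_mono2) auto
        then show ?thesis using q by (simp add: powr_powr)
      qed
      have "norm ((deriv ^^ 1) g 0) \<le> fact 1 * B / (r / 2) ^ 1"
        using r B
        by (intro Cauchy_inequality) (auto intro: holomorphic_on_subset[OF g] holomorphic_on_imp_continuous_on)
      then have "norm (deriv g 0) * r \<le> 2 * B"
        using r by (simp add: field_simps)
      then have "(norm (deriv g 0) * r) powr q \<le> (2 * B) powr q"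
        using q r by (intro powr_mono2) auto
      also have "(2 * B) powr q = 2 powr q * (C * j / r\<^sup>2)"
        using q C real by (simp add: B_def powr_mult powr_powr)
      finally have "norm (deriv g 0) powr q * r powr q * r\<^sup>2 \<le> 2 powr q * C * j"
        using r by (simp add: powr_mult field_simps)
      moreover have "r powr (q + 2) = r powr q * r\<^sup>2"
        using r by (simp add: powr_add)
      ultimately show "ennreal (norm (deriv g 0) powr q * r powr (q + 2)) \<le> ennreal (2 powr q * C) * J"
        using real C by (simp add: mult_ac flip: ennreal_mult')
    qed (use C in \<open>simp add: ennreal_mult_top\<close>)
  qed
qed

section \<open>Weighted integrals of derivatives\<close>

lemma borel_measurable_axis [measurable]: "(axis j :: complex \<Rightarrow> complex ^ 'n) \<in> borel_measurable borel"
  by (intro borel_measurable_continuous_onI continuous_intros)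

text \<open>
  The weight \<open>1 + |z|\<close> is bounded below, unlike the weight \<open>|z|\<close> of the norm; this makes the
  integrals increase with \<open>k\<close>, so that one induction treats the derivatives of all orders.
\<close>
definition weighted_integral :: "real \<Rightarrow> real \<Rightarrow> nat \<Rightarrow> (complex ^ 'n \<Rightarrow> complex) \<Rightarrow> ennreal"
  where "weighted_integral \<alpha> q k f =
    (\<integral>\<^sup>+ z. ennreal ((1 + norm z) powr (real k * q) * norm (f z) powr q * exp (- (\<alpha> * q / 2) * (norm z)\<^sup>2)) \<partial>lborel)"

definition sobolev_integral :: "real \<Rightarrow> real \<Rightarrow> nat \<Rightarrow> (complex ^ 'n \<Rightarrow> complex) \<Rightarrow> ennreal"
  where "sobolev_integral \<alpha> q m f =
    (\<integral>\<^sup>+ z. ennreal ((norm z ^ m) powr q * norm (f z) powr q * exp (- (\<alpha> * q / 2) * (norm z)\<^sup>2)) \<partial>lborel)"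

lemma epowr_less_top_iff: "epowr x a < top \<longleftrightarrow> x < top"
  by (simp add: epowr_def less_top)

lemma fs_const_pos: "\<alpha> > 0 \<Longrightarrow> q > 0 \<Longrightarrow> n > 0 \<Longrightarrow> fs_const \<alpha> q m n > 0"
  unfolding fs_const_def
  by (intro mult_pos_pos divide_pos_pos Gamma_real_pos zero_less_power pi_gt_zero)
    (auto intro!: add_nonneg_pos)

lemma fs_norm_eq:
  "q > 0 \<Longrightarrow> fs_norm \<alpha> (ennreal q) m (f :: complex ^ 'n \<Rightarrow> complex) =
    epowr (ennreal (fs_const \<alpha> q m CARD('n)) * sobolev_integral \<alpha> q m f) (1 / q)"
  by (simp add: fs_norm_def sobolev_integral_def Let_def infinity_ennreal_def)

lemma fs_norm_less_top_iff:
  assumes "\<alpha> > 0" "q > 0"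
  shows "fs_norm \<alpha> (ennreal q) m (f :: complex ^ 'n \<Rightarrow> complex) < \<infinity> \<longleftrightarrow> sobolev_integral \<alpha> q m f < \<infinity>"
proof -
  have "fs_const \<alpha> q m CARD('n) > 0" using assms by (intro fs_const_pos) auto
  then show ?thesis
    by (auto simp: fs_norm_eq[OF assms(2)] epowr_less_top_iff ennreal_mult_less_top)
qed

text \<open>
  Apply the one-variable bound to the slice in direction \<open>j\<close> on the disc of radius \<open>1 / (1 + |z|)\<close>.  On it
  \<open>|z|\<^sup>2\<close> grows by at most 3, so weight and Gaussian may be moved from \<open>z\<close> to the shifted point.  Tonelli's
  theorem and translation in \<open>\<complex>\<^sup>n\<close> then leave a factor \<open>(1 + |z|)\<^sup>q\<^sup>+\<^sup>2\<close> times the area of a disc of radius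
  \<open>2 / (1 + |z|)\<close>: one power of \<open>(1 + |z|)\<^sup>q\<close> is lost.
\<close>
lemma weighted_integral_partial_deriv:
  fixes f :: "complex ^ 'n \<Rightarrow> complex"
  assumes f: "entire f" and \<alpha>: "\<alpha> > 0" and q: "q > 0"
    and fin: "weighted_integral \<alpha> q (Suc k) f < \<infinity>"
  shows "weighted_integral \<alpha> q k (partial_deriv j f) < \<infinity>"
proof -
  obtain C where C: "C > 0"
    "\<forall>g r. g holomorphic_on UNIV \<longrightarrow> r > 0 \<longrightarrow>
      ennreal (norm (deriv g 0) powr q * r powr (q + 2)) \<le>
      ennreal C * (\<integral>\<^sup>+ x. indicator (ball 0 r) x * ennreal (norm (g x) powr q) \<partial>lborel)"
    using deriv_powr_le_area_integral[OF q] by blast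
  define E where "E z = exp (- (\<alpha> * q / 2) * (norm z)\<^sup>2)" for z :: "complex ^ 'n"
  define s where "s = real (Suc k) * q"
  have s: "s > 0" using q by (simp add: s_def)
  define K where "K = 2 powr (s + 2) * exp (3 * \<alpha> * q / 2)"
  have K: "K > 0" by (simp add: K_def)
  define \<Psi> where "\<Psi> z = (1 + norm z) powr (s + 2) * norm (f z) powr q * E z" for z
  define \<Phi> where "\<Phi> z \<eta> = (if norm \<eta> * (1 + norm z) < 2 then ennreal (\<Psi> z) else 0)"
    for z :: "complex ^ 'n" and \<eta> :: complex
  have fm [measurable]: "f \<in> borel_measurable borel"
    using entire_continuous[OF f] by (rule borel_measurable_continuous_onI)
  have Em [measurable]: "E \<in> borel_measurable borel"
    unfolding E_def by (intro borel_measurable_continuous_onI continuous_intros)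
  have \<Psi>m [measurable]: "\<Psi> \<in> borel_measurable borel"
    unfolding \<Psi>_def by measurable
  have \<Psi>0: "\<Psi> z \<ge> 0" for z by (simp add: \<Psi>_def E_def)
  have shift: "norm (f (z + axis j \<eta>)) powr q * ((1 + norm z) powr (s + 2) * E z) \<le> K * \<Psi> (z + axis j \<eta>)
      \<and> norm \<eta> * (1 + norm (z + axis j \<eta>)) < 2"
    if \<eta>: "norm \<eta> < 1 / (1 + norm z)" for z \<eta>
  proof -
    define z' where "z' = z + axis j \<eta>"
    have pos: "1 + norm z > 0" by (simp add: add_pos_nonneg)
    have r1: "1 / (1 + norm z) \<le> 1" using pos by (simp add: field_simps)
    have \<eta>1: "norm \<eta> * (1 + norm z) < 1" using \<eta> pos by (simp add: field_simps)
    have up: "norm z' \<le> norm z + norm \<eta>"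
      unfolding z'_def by (rule norm_triangle_le) simp
    have dn: "norm z \<le> norm z' + norm \<eta>"
      using norm_triangle_ineq[of z' "- axis j \<eta>"] by (simp add: z'_def)
    have "norm \<eta> < 1" using \<eta> r1 by (rule less_le_trans)
    with dn have "norm z \<le> norm z' + 1" by (rule order_trans[OF _ add_left_mono[OF less_imp_le]])
    then have "1 + norm z \<le> norm z' + 2" by simp
    also have "\<dots> \<le> 2 * (1 + norm z')" by simp
    finally have "1 + norm z \<le> 2 * (1 + norm z')" .
    then have 1: "(1 + norm z) powr (s + 2) \<le> 2 powr (s + 2) * (1 + norm z') powr (s + 2)"
      using s by (subst powr_mult[symmetric]) (auto intro!: powr_mono2)
    have "(norm z')\<^sup>2 \<le> (norm z + norm \<eta>)\<^sup>2" using up by (intro power_mono) auto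
    also have "\<dots> = (norm z)\<^sup>2 + 2 * (norm \<eta> * norm z) + norm \<eta> * norm \<eta>"
      by (simp add: power2_eq_square algebra_simps)
    also have "\<dots> \<le> (norm z)\<^sup>2 + 2 * 1 + 1 * 1"
    proof -
      have "norm \<eta> * norm z \<le> norm \<eta> * (1 + norm z)" by (intro mult_left_mono) auto
      also have "\<dots> \<le> 1" using \<eta>1 by (rule less_imp_le)
      finally have "norm \<eta> * norm z \<le> 1" .
      moreover have "norm \<eta> * norm \<eta> \<le> 1 * 1"
        using \<eta> r1 by (intro mult_mono) auto
      ultimately show ?thesis by simp
    qed
    finally have "(\<alpha> * q / 2) * (norm z')\<^sup>2 \<le> (\<alpha> * q / 2) * ((norm z)\<^sup>2 + 3)"
      using \<alpha> q by (intro mult_left_mono) auto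
    then have 2: "E z \<le> exp (3 * \<alpha> * q / 2) * E z'"
      unfolding E_def exp_add[symmetric] by (simp add: algebra_simps)
    have "(1 + norm z) powr (s + 2) * E z \<le> (2 powr (s + 2) * (1 + norm z') powr (s + 2)) * (exp (3 * \<alpha> * q / 2) * E z')"
      using 1 2 by (intro mult_mono) (auto simp: E_def)
    then have "norm (f z') powr q * ((1 + norm z) powr (s + 2) * E z) \<le>
        norm (f z') powr q * ((2 powr (s + 2) * (1 + norm z') powr (s + 2)) * (exp (3 * \<alpha> * q / 2) * E z'))"
      by (rule mult_left_mono) simp
    also have "\<dots> = K * \<Psi> z'" by (simp add: K_def \<Psi>_def mult_ac)
    finally have A: "norm (f z') powr q * ((1 + norm z) powr (s + 2) * E z) \<le> K * \<Psi> z'" .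
    have "norm \<eta> * (1 + norm z') \<le> norm \<eta> * (1 + norm z) + norm \<eta> * norm \<eta>"
      using mult_left_mono[OF up, of "norm \<eta>"] by (simp add: algebra_simps)
    also have "norm \<eta> * norm \<eta> \<le> 1 * 1" using \<eta> r1 by (intro mult_mono) auto
    finally have "norm \<eta> * (1 + norm z') < 2" using \<eta>1 by linarith
    with A show ?thesis by (simp add: z'_def)
  qed
  have pt: "ennreal ((1 + norm z) powr (real k * q) * norm (partial_deriv j f z) powr q * E z)
      \<le> ennreal (C * K) * (\<integral>\<^sup>+ \<eta>. \<Phi> (z + axis j \<eta>) \<eta> \<partial>lborel)" for z
  proof -
    define \<rho> where "\<rho> = 1 / (1 + norm z)"
    have pos: "1 + norm z > 0" by (simp add: add_pos_nonneg)
    have \<rho>: "\<rho> > 0" using pos by (simp add: \<rho>_def)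
    define c where "c = (1 + norm z) powr (s + 2) * E z"
    have c0: "c \<ge> 0" by (simp add: c_def E_def)
    have hol: "(\<lambda>t. f (z + axis j t)) holomorphic_on UNIV" by (rule entire_slice[OF f])
    have "\<rho> powr (q + 2) * (1 + norm z) powr (s + 2) = (1 + norm z) powr (real k * q)"
      using pos by (simp add: \<rho>_def powr_divide field_simps s_def flip: powr_add)
    then have eq: "(1 + norm z) powr (real k * q) * norm (partial_deriv j f z) powr q * E z
        = c * (norm (partial_deriv j f z) powr q * \<rho> powr (q + 2))"
      by (simp add: c_def mult_ac)
    have "ennreal ((1 + norm z) powr (real k * q) * norm (partial_deriv j f z) powr q * E z)
        = ennreal c * ennreal (norm (partial_deriv j f z) powr q * \<rho> powr (q + 2))"
      unfolding eq by (rule ennreal_mult'[OF c0])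
    also have "\<dots> \<le> ennreal c * (ennreal C *
        (\<integral>\<^sup>+ \<eta>. indicator (ball 0 \<rho>) \<eta> * ennreal (norm (f (z + axis j \<eta>)) powr q) \<partial>lborel))"
      using C(2)[rule_format, OF hol \<rho>] by (intro mult_left_mono) (auto simp: partial_deriv_def)
    also have "\<dots> = ennreal C * (ennreal c *
        (\<integral>\<^sup>+ \<eta>. indicator (ball 0 \<rho>) \<eta> * ennreal (norm (f (z + axis j \<eta>)) powr q) \<partial>lborel))"
      by (rule mult.left_commute)
    also have "ennreal c * (\<integral>\<^sup>+ \<eta>. indicator (ball 0 \<rho>) \<eta> * ennreal (norm (f (z + axis j \<eta>)) powr q) \<partial>lborel)
        = (\<integral>\<^sup>+ \<eta>. ennreal c * (indicator (ball 0 \<rho>) \<eta> * ennreal (norm (f (z + axis j \<eta>)) powr q)) \<partial>lborel)"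
    proof -
      have [measurable]: "ball (0::complex) \<rho> \<in> sets borel" by simp
      show ?thesis by (rule nn_integral_cmult[symmetric]) measurable
    qed
    also have "\<dots> \<le> (\<integral>\<^sup>+ \<eta>. ennreal K * \<Phi> (z + axis j \<eta>) \<eta> \<partial>lborel)"
    proof (rule nn_integral_mono)
      fix \<eta> :: complex
      show "ennreal c * (indicator (ball 0 \<rho>) \<eta> * ennreal (norm (f (z + axis j \<eta>)) powr q))
          \<le> ennreal K * \<Phi> (z + axis j \<eta>) \<eta>"
      proof (cases "\<eta> \<in> ball 0 \<rho>")
        case True
        then have \<eta>: "norm \<eta> < 1 / (1 + norm z)" by (simp add: \<rho>_def)
        have "ennreal c * ennreal (norm (f (z + axis j \<eta>)) powr q) = ennreal (norm (f (z + axis j \<eta>)) powr q * c)"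
          using c0 by (simp add: mult.commute flip: ennreal_mult')
        also have "\<dots> \<le> ennreal (K * \<Psi> (z + axis j \<eta>))"
          using shift[OF \<eta>] by (intro ennreal_leI) (simp add: c_def)
        also have "\<dots> = ennreal K * \<Phi> (z + axis j \<eta>) \<eta>"
          using shift[OF \<eta>] K by (simp add: \<Phi>_def ennreal_mult')
        finally show ?thesis using True by simp
      qed simp
    qed
    also have "\<dots> = ennreal K * (\<integral>\<^sup>+ \<eta>. \<Phi> (z + axis j \<eta>) \<eta> \<partial>lborel)"
      unfolding \<Phi>_def by (rule nn_integral_cmult) measurable
    finally have "ennreal ((1 + norm z) powr (real k * q) * norm (partial_deriv j f z) powr q * E z)
      \<le> ennreal C * (ennreal K * (\<integral>\<^sup>+ \<eta>. \<Phi> (z + axis j \<eta>) \<eta> \<partial>lborel))"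
      by (simp add: mult_left_mono)
    then show ?thesis
      using C K by (simp add: ennreal_mult' mult.assoc)
  qed
  have "weighted_integral \<alpha> q k (partial_deriv j f)
      \<le> (\<integral>\<^sup>+ z. ennreal (C * K) * (\<integral>\<^sup>+ \<eta>. \<Phi> (z + axis j \<eta>) \<eta> \<partial>lborel) \<partial>lborel)"
    unfolding weighted_integral_def using pt unfolding E_def by (rule nn_integral_mono)
  also have "\<dots> = ennreal (C * K) * (\<integral>\<^sup>+ z. (\<integral>\<^sup>+ \<eta>. \<Phi> (z + axis j \<eta>) \<eta> \<partial>lborel) \<partial>lborel)"
    unfolding \<Phi>_def by (rule nn_integral_cmult) measurable
  also have "(\<integral>\<^sup>+ z. (\<integral>\<^sup>+ \<eta>. \<Phi> (z + axis j \<eta>) \<eta> \<partial>lborel) \<partial>lborel)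
      = (\<integral>\<^sup>+ \<eta>. (\<integral>\<^sup>+ z. \<Phi> (z + axis j \<eta>) \<eta> \<partial>lborel) \<partial>lborel)"
    unfolding \<Phi>_def by (rule lborel_Fubini) measurable
  also have "\<dots> = (\<integral>\<^sup>+ \<eta>. (\<integral>\<^sup>+ z. \<Phi> z \<eta> \<partial>lborel) \<partial>lborel)"
  proof (rule nn_integral_cong)
    fix \<eta> :: complex
    show "(\<integral>\<^sup>+ z. \<Phi> (z + axis j \<eta>) \<eta> \<partial>lborel) = (\<integral>\<^sup>+ z. \<Phi> z \<eta> \<partial>lborel)"
    proof -
      have "(\<integral>\<^sup>+ z. \<Phi> (z + axis j \<eta>) \<eta> \<partial>lborel) = (\<integral>\<^sup>+ z. \<Phi> (axis j \<eta> + z) \<eta> \<partial>lborel)"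
        by (rule nn_integral_cong) (simp add: add.commute)
      also have "\<dots> = (\<integral>\<^sup>+ z. \<Phi> z \<eta> \<partial>lborel)"
        by (rule nn_integral_translate) (unfold \<Phi>_def, measurable)
      finally show ?thesis .
    qed
  qed
  also have "\<dots> = (\<integral>\<^sup>+ z. (\<integral>\<^sup>+ \<eta>. \<Phi> z \<eta> \<partial>lborel) \<partial>lborel)"
    unfolding \<Phi>_def by (rule lborel_Fubini) measurable
  also have "\<dots> = (\<integral>\<^sup>+ z. ennreal (4 * pi) * ennreal ((1 + norm z) powr s * norm (f z) powr q * E z) \<partial>lborel)"
  proof (rule nn_integral_cong)
    fix z :: "complex ^ 'n"
    have pos: "1 + norm z > 0" by (simp add: add_pos_nonneg)
    have "(\<integral>\<^sup>+ \<eta>. \<Phi> z \<eta> \<partial>lborel) = (\<integral>\<^sup>+ \<eta>. ennreal (\<Psi> z) * indicator (ball (0::complex) (2 / (1 + norm z))) \<eta> \<partial>lborel)"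
      using pos by (intro nn_integral_cong) (auto simp: \<Phi>_def indicator_def field_simps)
    also have "\<dots> = ennreal (\<Psi> z) * ennreal (pi * (2 / (1 + norm z))\<^sup>2)"
      using pos by (subst nn_integral_cmult_indicator) (auto simp: emeasure_ball unit_ball_vol_2)
    also have "\<dots> = ennreal (\<Psi> z * (pi * (2 / (1 + norm z))\<^sup>2))"
      using \<Psi>0 by (simp add: ennreal_mult')
    also have "\<Psi> z * (pi * (2 / (1 + norm z))\<^sup>2) = 4 * pi * ((1 + norm z) powr s * norm (f z) powr q * E z)"
      using pos by (simp add: \<Psi>_def powr_add power_divide)
    finally show "(\<integral>\<^sup>+ \<eta>. \<Phi> z \<eta> \<partial>lborel) = ennreal (4 * pi) * ennreal ((1 + norm z) powr s * norm (f z) powr q * E z)"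
      by (simp add: ennreal_mult')
  qed
  also have "\<dots> = ennreal (4 * pi) * weighted_integral \<alpha> q (Suc k) f"
    unfolding weighted_integral_def s_def[symmetric] E_def[symmetric]
    by (rule nn_integral_cmult) measurable
  finally show ?thesis
    using fin by (auto simp: ennreal_mult_less_top intro: le_less_trans)
qed

text \<open>
  Here \<open>k\<close> is the number of derivatives still available.  The enumeration of the coordinates only
  determines in which order the steps are taken.
\<close>
lemma multi_deriv_induct:
  fixes P :: "nat \<Rightarrow> (complex ^ 'n \<Rightarrow> complex) \<Rightarrow> bool"
  assumes step: "\<And>k f j. P (Suc k) f \<Longrightarrow> P k (partial_deriv j f)"
    and f: "P m f" and \<beta>: "\<beta> \<in> multi_indices m"
  shows "\<exists>k. P k (multi_deriv \<beta> f)"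
proof -
  have pow: "P k ((partial_deriv j ^^ i) g)" if "P (k + i) g" for k i j g
    using that by (induction i arbitrary: k) (auto intro: step)
  have fold: "P k (foldr (\<lambda>j. partial_deriv j ^^ \<beta> j) js f)"
    if "P (k + sum_list (map \<beta> js)) f" for k js
    using that by (induction js arbitrary: k) (auto intro!: pow simp: add.assoc)
  have "sum_list (map \<beta> coord_list) = (\<Sum>j\<in>UNIV. \<beta> j)"
    using sum_list_distinct_conv_sum_set[OF coord_list(1), of \<beta>] by (simp add: coord_list(2))
  then have "P ((m - (\<Sum>j\<in>UNIV. \<beta> j)) + sum_list (map \<beta> coord_list)) f"
    using f \<beta> by (simp add: multi_indices_def)
  then show ?thesis
    unfolding multi_deriv_def using fold by blast
qed

lemma fock_norm_finite_of_weighted: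
  fixes f :: "complex ^ 'n \<Rightarrow> complex"
  assumes q: "q > 0" and fin: "weighted_integral \<alpha> q k f < \<infinity>"
  shows "fock_norm \<alpha> (ennreal q) f < \<infinity>"
proof -
  have "(\<integral>\<^sup>+ z. ennreal (norm (f z) powr q * exp (- (\<alpha> * q / 2) * (norm z)\<^sup>2)) \<partial>lborel) \<le> weighted_integral \<alpha> q k f"
    unfolding weighted_integral_def
  proof (intro nn_integral_mono ennreal_leI)
    fix z :: "complex ^ 'n"
    have "1 \<le> (1 + norm z) powr (real k * q)"
      using q by (intro ge_one_powr_ge_zero) auto
    from mult_right_mono[OF this, of "norm (f z) powr q * exp (- (\<alpha> * q / 2) * (norm z)\<^sup>2)"]
    show "norm (f z) powr q * exp (- (\<alpha> * q / 2) * (norm z)\<^sup>2)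
        \<le> (1 + norm z) powr (real k * q) * norm (f z) powr q * exp (- (\<alpha> * q / 2) * (norm z)\<^sup>2)"
      by (simp add: mult.assoc)
  qed
  with fin show ?thesis
    using q by (auto simp: fock_norm_def Let_def infinity_ennreal_def epowr_less_top_iff ennreal_mult_less_top intro: le_less_trans)
qed

lemma weighted_integral_finite_of_sobolev:
  fixes f :: "complex ^ 'n \<Rightarrow> complex"
  assumes f: "entire f" and \<alpha>: "\<alpha> > 0" and q: "q > 0" and fin: "sobolev_integral \<alpha> q m f < \<infinity>"
  shows "weighted_integral \<alpha> q m f < \<infinity>"
proof -
  obtain B where B: "B \<ge> 0" "\<And>z. norm z \<le> 1 \<Longrightarrow> norm (f z) \<le> B"
    using bounded_on_cball[OF entire_continuous[OF f]] by metis
  have fm [measurable]: "f \<in> borel_measurable borel"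
    using entire_continuous[OF f] by (rule borel_measurable_continuous_onI)
  have cball [measurable]: "cball (0 :: complex ^ 'n) 1 \<in> sets borel" by simp
  define c where "c = 2 powr (real m * q)"
  have "weighted_integral \<alpha> q m f \<le> (\<integral>\<^sup>+ z. ennreal c * ennreal ((norm z ^ m) powr q * norm (f z) powr q * exp (- (\<alpha> * q / 2) * (norm z)\<^sup>2))
      + ennreal (c * B powr q) * indicator (cball 0 1) z \<partial>lborel)"
    unfolding weighted_integral_def
  proof (rule nn_integral_mono)
    fix z :: "complex ^ 'n"
    define e where "e = exp (- (\<alpha> * q / 2) * (norm z)\<^sup>2)"
    have e: "e > 0" "e \<le> 1" using \<alpha> q by (auto simp: e_def)
    show "ennreal ((1 + norm z) powr (real m * q) * norm (f z) powr q * exp (- (\<alpha> * q / 2) * (norm z)\<^sup>2))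
      \<le> ennreal c * ennreal ((norm z ^ m) powr q * norm (f z) powr q * exp (- (\<alpha> * q / 2) * (norm z)\<^sup>2))
      + ennreal (c * B powr q) * indicator (cball 0 1) z"
      unfolding e_def[symmetric]
    proof (cases "norm z \<le> 1")
      case True
      have "(1 + norm z) powr (real m * q) * norm (f z) powr q * e \<le> c * B powr q * 1"
        unfolding c_def using True q e B by (intro mult_mono powr_mono2) auto
      then have "ennreal ((1 + norm z) powr (real m * q) * norm (f z) powr q * e) \<le> ennreal (c * B powr q) * indicator (cball 0 1) z"
        using True by (simp add: ennreal_leI)
      then show "ennreal ((1 + norm z) powr (real m * q) * norm (f z) powr q * e)
          \<le> ennreal c * ennreal ((norm z ^ m) powr q * norm (f z) powr q * e) + ennreal (c * B powr q) * indicator (cball 0 1) z"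
        by (simp add: add_increasing)
    next
      case False
      have "(norm z ^ m) powr q = norm z powr (real m * q)"
      proof -
        have "norm z > 0" using False by linarith
        then show ?thesis by (simp add: powr_powr flip: powr_realpow)
      qed
      moreover have "(1 + norm z) powr (real m * q) \<le> (2 * norm z) powr (real m * q)"
        using False q by (intro powr_mono2) auto
      ultimately have "(1 + norm z) powr (real m * q) \<le> c * (norm z ^ m) powr q"
        by (simp add: c_def powr_mult)
      then have "(1 + norm z) powr (real m * q) * norm (f z) powr q * e \<le> (c * (norm z ^ m) powr q) * norm (f z) powr q * e"
        using e by (intro mult_right_mono) auto
      then have "ennreal ((1 + norm z) powr (real m * q) * norm (f z) powr q * e)
          \<le> ennreal c * ennreal ((norm z ^ m) powr q * norm (f z) powr q * e)"
        by (simp add: c_def mult.assoc ennreal_leI flip: ennreal_mult')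
      then show "ennreal ((1 + norm z) powr (real m * q) * norm (f z) powr q * e)
          \<le> ennreal c * ennreal ((norm z ^ m) powr q * norm (f z) powr q * e) + ennreal (c * B powr q) * indicator (cball 0 1) z"
        by (simp add: add_increasing2)
    qed
  qed
  also have "\<dots> = (\<integral>\<^sup>+ z. ennreal c * ennreal ((norm z ^ m) powr q * norm (f z) powr q * exp (- (\<alpha> * q / 2) * (norm (z :: complex ^ 'n))\<^sup>2)) \<partial>lborel)
      + (\<integral>\<^sup>+ z. ennreal (c * B powr q) * indicator (cball (0 :: complex ^ 'n) 1) z \<partial>lborel)"
    by (rule nn_integral_add) measurable
  also have "\<dots> = ennreal c * sobolev_integral \<alpha> q m f + ennreal (c * B powr q) * emeasure lborel (cball (0 :: complex ^ 'n) 1)"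
  proof -
    have "(\<integral>\<^sup>+ z. ennreal (c * B powr q) * indicator (cball (0 :: complex ^ 'n) 1) z \<partial>lborel)
        = ennreal (c * B powr q) * emeasure lborel (cball (0 :: complex ^ 'n) 1)"
      by (rule nn_integral_cmult_indicator) simp
    moreover have "(\<integral>\<^sup>+ z. ennreal c * ennreal ((norm z ^ m) powr q * norm (f z) powr q * exp (- (\<alpha> * q / 2) * (norm z)\<^sup>2)) \<partial>lborel)
        = ennreal c * sobolev_integral \<alpha> q m f"
      unfolding sobolev_integral_def by (rule nn_integral_cmult) measurable
    ultimately show ?thesis by (rule arg_cong2[where f = "(+)", rotated])
  qed
  also have "\<dots> < \<infinity>"
    using fin by (simp add: ennreal_mult_less_top emeasure_cball)
  finally show ?thesis .
qed

proposition fock_sobolev_memberI: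
  fixes f :: "complex ^ 'n \<Rightarrow> complex"
  assumes f: "entire f" and \<alpha>: "\<alpha> > 0" and q: "q > 0" and fin: "fs_norm \<alpha> (ennreal q) m f < \<infinity>"
  shows "f \<in> fock_sobolev \<alpha> (ennreal q) m"
proof -
  define P where "P k g \<longleftrightarrow> entire g \<and> weighted_integral \<alpha> q k g < \<infinity>" for k and g :: "complex ^ 'n \<Rightarrow> complex"
  have P: "P m f"
    using f fin weighted_integral_finite_of_sobolev[OF f \<alpha> q] fs_norm_less_top_iff[OF \<alpha> q, of m f]
    by (simp add: P_def)
  have step: "P k (partial_deriv j g)" if "P (Suc k) g" for k g j
    using that weighted_integral_partial_deriv[OF _ \<alpha> q, of g k j] entire_partial_deriv[of g j] by (simp add: P_def)
  have "fock_norm \<alpha> (ennreal q) (multi_deriv \<beta> f) < \<infinity>" if \<beta>: "\<beta> \<in> multi_indices m" for \<beta>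
    using multi_deriv_induct[of P, OF step P \<beta>] fock_norm_finite_of_weighted[OF q] by (auto simp: P_def)
  then show ?thesis
    using f by (simp add: fock_sobolev_def finite_multi_indices)
qed

section \<open>Growth of functions with bounded derivatives\<close>

text \<open>
  By induction on \<open>m\<close>, applied to \<open>deriv g\<close>.  Along a ray, the derivative is at most a multiple of
  \<open>exp (\<alpha> s\<^sup>2 / 2) / s\<^sup>m\<close>, and beyond \<open>s0\<close> this is dominated by the derivative of a multiple of
  \<open>exp (\<alpha> s\<^sup>2 / 2) / s\<^sup>m\<^sup>+\<^sup>1\<close>.  Inside the disc of radius \<open>s0\<close> the bound for \<open>g\<close> itself suffices.
\<close>
lemma growth_of_bounded_derivatives:
  fixes \<alpha> :: real
  assumes \<alpha>: "\<alpha> > 0"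
  shows "\<exists>C>0. \<forall>g K. g holomorphic_on UNIV \<longrightarrow>
    (\<forall>k\<le>m. \<forall>\<zeta>. norm ((deriv ^^ k) g \<zeta>) \<le> K * exp (\<alpha> / 2 * (norm \<zeta>)\<^sup>2)) \<longrightarrow>
    (\<forall>\<zeta>. norm \<zeta> ^ m * norm (g \<zeta>) \<le> C * K * exp (\<alpha> / 2 * (norm \<zeta>)\<^sup>2))"
proof (induction m)
  case 0
  show ?case by (intro exI[of _ 1]) auto
next
  case (Suc m)
  then obtain C where C: "C > 0" "\<forall>g K. g holomorphic_on UNIV \<longrightarrow>
    (\<forall>k\<le>m. \<forall>\<zeta>. norm ((deriv ^^ k) g \<zeta>) \<le> K * exp (\<alpha> / 2 * (norm \<zeta>)\<^sup>2)) \<longrightarrow>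
    (\<forall>\<zeta>. norm \<zeta> ^ m * norm (g \<zeta>) \<le> C * K * exp (\<alpha> / 2 * (norm \<zeta>)\<^sup>2))"
    by blast
  define s0 where "s0 = max 1 (sqrt (2 * (real m + 1) / \<alpha>))"
  have s0: "s0 \<ge> 1" "s0 \<ge> sqrt (2 * (real m + 1) / \<alpha>)" by (auto simp: s0_def)
  define A where "A = 2 * C / \<alpha>"
  have A: "A > 0" using C \<alpha> by (simp add: A_def)
  define e where "e s = exp (\<alpha> / 2 * s\<^sup>2)" for s :: real
  have e_pos: "e s > 0" for s by (simp add: e_def)
  show ?case
  proof (intro exI[of _ "A + s0 ^ Suc m"] conjI allI impI)
    show "A + s0 ^ Suc m > 0" using A s0 by (intro add_pos_nonneg) auto
    fix g K \<zeta>
    assume g: "g holomorphic_on UNIV"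
      and K: "\<forall>k\<le>Suc m. \<forall>\<zeta>. norm ((deriv ^^ k) g \<zeta>) \<le> K * exp (\<alpha> / 2 * (norm \<zeta>)\<^sup>2)"
    have g0: "norm (g w) \<le> K * e (norm w)" for w
      using K[rule_format, of 0 w] by (simp add: e_def)
    have K0: "K \<ge> 0" using order_trans[OF norm_ge_zero g0[of 0]] by (simp add: e_def)
    have "norm ((deriv ^^ k) (deriv g) w) \<le> K * exp (\<alpha> / 2 * (norm w)\<^sup>2)" if "k \<le> m" for k w
      using K[rule_format, of "Suc k" w] that by (simp add: funpow_swap1)
    moreover have "deriv g holomorphic_on UNIV" using g by (auto intro: holomorphic_deriv)
    ultimately have g': "norm w ^ m * norm (deriv g w) \<le> C * K * e (norm w)" for w
      using C(2)[rule_format, of "deriv g" K w] by (simp add: e_def)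
    have "norm \<zeta> ^ Suc m * norm (g \<zeta>) \<le> (A + s0 ^ Suc m) * K * e (norm \<zeta>)"
    proof (cases "norm \<zeta> \<le> s0")
      case True
      have "norm \<zeta> ^ Suc m * norm (g \<zeta>) \<le> s0 ^ Suc m * (K * e (norm \<zeta>))"
        using True s0 g0[of \<zeta>] by (intro mult_mono power_mono) auto
      also have "\<dots> \<le> (A + s0 ^ Suc m) * (K * e (norm \<zeta>))"
        using A K0 e_pos[of "norm \<zeta>"] by (intro mult_right_mono) auto
      finally show ?thesis by (simp add: mult.assoc)
    next
      case False
      define b where "b = norm \<zeta>"
      have b: "s0 < b" "b > 0" using False s0 by (auto simp: b_def)
      define v where "v = \<zeta> / of_real b"
      have v: "norm v = 1" using b by (simp add: v_def b_def norm_divide)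
      have bv: "of_real b * v = \<zeta>" using b by (simp add: v_def)
      define \<phi> where "\<phi> s = e s / s ^ Suc m" for s
      define \<phi>' where "\<phi>' s = e s / s ^ m * (\<alpha> - (real m + 1) / s\<^sup>2)" for s
      have d\<phi>: "(\<phi> has_vector_derivative \<phi>' s) (at s)" if s: "s > 0" for s
      proof -
        have "(\<phi> has_real_derivative
            ((\<alpha> * s * e s) * s ^ Suc m - e s * (real (Suc m) * s ^ m)) / (s ^ Suc m * s ^ Suc m)) (at s)"
          unfolding \<phi>_def
        proof (rule DERIV_divide)
          show "(e has_real_derivative \<alpha> * s * e s) (at s)"
            unfolding e_def by (auto intro!: derivative_eq_intros)
          show "((\<lambda>s. s ^ Suc m) has_real_derivative real (Suc m) * s ^ m) (at s)"
            using DERIV_pow[of "Suc m" s UNIV] by simp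
        qed (use s in auto)
        also have "((\<alpha> * s * e s) * s ^ Suc m - e s * (real (Suc m) * s ^ m)) / (s ^ Suc m * s ^ Suc m) = \<phi>' s"
          using s by (simp add: \<phi>'_def field_simps power2_eq_square)
        finally show ?thesis by (simp add: has_real_derivative_iff_has_vector_derivative)
      qed
      have \<phi>'_ge: "\<alpha> / 2 * (e s / s ^ m) \<le> \<phi>' s" if s: "s \<ge> s0" for s
      proof -
        have "sqrt (2 * (real m + 1) / \<alpha>) \<le> s" using s s0 by linarith
        then have "(sqrt (2 * (real m + 1) / \<alpha>))\<^sup>2 \<le> s\<^sup>2"
          using \<alpha> by (intro power_mono) auto
        then have "2 * (real m + 1) / \<alpha> \<le> s\<^sup>2" using \<alpha> by simp
        then have "(real m + 1) / s\<^sup>2 \<le> \<alpha> / 2"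
          using \<alpha> s s0 by (simp add: field_simps)
        then have "e s / s ^ m * (\<alpha> / 2) \<le> e s / s ^ m * (\<alpha> - (real m + 1) / s\<^sup>2)"
          using e_pos[of s] s s0 by (intro mult_left_mono) auto
        then show ?thesis by (simp add: \<phi>'_def mult.commute)
      qed
      have cont\<phi>: "continuous_on {s0..b} \<phi>"
        unfolding \<phi>_def e_def using s0 by (intro continuous_intros) auto
      have "norm (g (of_real b * v) - g (of_real s0 * v)) \<le> A * K * \<phi> b - A * K * \<phi> s0"
      proof (rule differentiable_bound_general[where f = "\<lambda>s. g (of_real s * v)"
            and f' = "\<lambda>s. v * deriv g (of_real s * v)" and \<phi> = "\<lambda>s. A * K * \<phi> s"
            and \<phi>' = "\<lambda>s. A * K * \<phi>' s"])
        show "continuous_on {s0..b} (\<lambda>s. g (of_real s * v))"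
          by (intro continuous_on_compose2[OF holomorphic_on_imp_continuous_on[OF g]] continuous_intros) auto
        show "continuous_on {s0..b} (\<lambda>s. A * K * \<phi> s)"
          by (intro continuous_intros cont\<phi>)
        fix s assume s: "s0 < s" "s < b"
        have "((\<lambda>s. of_real s * v) has_vector_derivative v) (at s)"
          by (auto intro!: derivative_eq_intros simp: has_vector_derivative_def scaleR_conv_of_real)
        moreover have "(g has_field_derivative deriv g (of_real s * v)) (at (of_real s * v))"
          by (rule holomorphic_derivI[OF g open_UNIV UNIV_I])
        ultimately show "((\<lambda>s. g (of_real s * v)) has_vector_derivative v * deriv g (of_real s * v)) (at s)"
          using field_vector_diff_chain_at[of "\<lambda>s. of_real s * v" v s g] by (simp add: o_def)
        show "((\<lambda>s. A * K * \<phi> s) has_vector_derivative A * K * \<phi>' s) (at s)"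
          using d\<phi>[of s] s s0 by (intro has_vector_derivative_mult_right) auto
        have "s ^ m * norm (deriv g (of_real s * v)) \<le> C * K * e s"
          using g'[of "of_real s * v"] v s s0 by (simp add: norm_mult)
        then have "norm (v * deriv g (of_real s * v)) \<le> C * K * (e s / s ^ m)"
          using v s s0 by (simp add: norm_mult field_simps)
        also have "\<dots> = A * K * (\<alpha> / 2 * (e s / s ^ m))"
          using \<alpha> by (simp add: A_def)
        also have "\<dots> \<le> A * K * \<phi>' s"
          using \<phi>'_ge[of s] s A K0 by (intro mult_left_mono) auto
        finally show "norm (v * deriv g (of_real s * v)) \<le> A * K * \<phi>' s" .
      qed (use b in auto)
      then have 1: "norm (g \<zeta>) \<le> norm (g (of_real s0 * v)) + (A * K * \<phi> b - A * K * \<phi> s0)"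
        unfolding bv using norm_triangle_sub[of "g \<zeta>" "g (of_real s0 * v)"] by linarith
      have \<phi>_mono: "\<phi> s0 \<le> \<phi> b"
      proof -
        have "norm (0 - 0 :: real) \<le> \<phi> b - \<phi> s0"
        proof (rule differentiable_bound_general[where f = "\<lambda>s. 0 :: real" and f' = "\<lambda>s. 0" and \<phi> = \<phi> and \<phi>' = \<phi>'])
          fix s assume s: "s0 < s" "s < b"
          show "(\<phi> has_vector_derivative \<phi>' s) (at s)" using d\<phi> s s0 by auto
          have "0 \<le> \<alpha> / 2 * (e s / s ^ m)"
            using \<alpha> s s0 e_pos[of s] by (intro mult_nonneg_nonneg divide_nonneg_nonneg) auto
          with \<phi>'_ge[of s] s show "norm (0::real) \<le> \<phi>' s" by simp
        qed (use b cont\<phi> in auto)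
        then show ?thesis by simp
      qed
      have "norm (g (of_real s0 * v)) \<le> K * e s0"
        using g0[of "of_real s0 * v"] v s0 by (simp add: norm_mult)
      also have "K * e s0 = K * s0 ^ Suc m * \<phi> s0" using s0 by (simp add: \<phi>_def)
      also have "\<dots> \<le> K * s0 ^ Suc m * \<phi> b"
        using K0 s0 \<phi>_mono by (intro mult_left_mono) auto
      finally have le: "norm (g (of_real s0 * v)) \<le> K * s0 ^ Suc m * \<phi> b" .
      have "norm (g \<zeta>) \<le> K * s0 ^ Suc m * \<phi> b + A * K * \<phi> b"
      proof -
        have "\<phi> s0 \<ge> 0" using s0 e_pos[of s0] by (simp add: \<phi>_def)
        then have "A * K * \<phi> s0 \<ge> 0" using A K0 by simp
        then show ?thesis using 1 le by linarith
      qed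
      also have "\<dots> = (A + s0 ^ Suc m) * K * (e b / b ^ Suc m)"
        by (simp add: \<phi>_def algebra_simps add_divide_distrib)
      finally show ?thesis
        using b unfolding b_def[symmetric] by (simp add: field_simps)
    qed
    then show "norm \<zeta> ^ Suc m * norm (g \<zeta>) \<le> (A + s0 ^ Suc m) * K * exp (\<alpha> / 2 * (norm \<zeta>)\<^sup>2)"
      by (simp add: e_def)
  qed
qed

lemma deriv_iterate_slice:
  "(deriv ^^ k) (\<lambda>t. f (z + axis j t)) = (\<lambda>t. (partial_deriv j ^^ k) f (z + axis j t))"
proof (induction k)
  case (Suc k)
  have "deriv (\<lambda>t. (partial_deriv j ^^ k) f (z + axis j t)) t
      = partial_deriv j ((partial_deriv j ^^ k) f) (z + axis j t)" for t
    by (simp only: partial_deriv_axis)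
  then show ?case using Suc by (simp only: funpow.simps o_apply)
qed simp

lemma multi_deriv_pure:
  "multi_deriv (\<lambda>i. if i = j then k else 0) f = (partial_deriv j ^^ k) f"
proof -
  have "foldr (\<lambda>i. partial_deriv i ^^ (if i = j then k else 0)) js f
      = (if j \<in> set js then (partial_deriv j ^^ k) f else f)" if "distinct js" for js
    using that by (induction js) auto
  then show ?thesis
    unfolding multi_deriv_def using coord_list[where 'n = 'a] by simp
qed

lemma fock_norm_infinity_le:
  assumes "fock_norm \<alpha> \<infinity> f \<le> ennreal K" "K \<ge> 0"
  shows "norm (f z) \<le> K * exp (\<alpha> / 2 * (norm z)\<^sup>2)"
proof -
  have "ennreal (norm (f z) * exp (- (\<alpha> / 2) * (norm z)\<^sup>2)) \<le> ennreal K"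
    using assms(1) unfolding fock_norm_def by (auto simp: SUP_le_iff)
  then have "norm (f z) * exp (- (\<alpha> / 2) * (norm z)\<^sup>2) \<le> K"
    using assms(2) by simp
  then show ?thesis
    by (simp add: exp_minus field_simps)
qed

text \<open>
  At a given point, take the pure derivatives in the coordinate of largest modulus.  The Gaussian is
  a product over the coordinates, so the one-variable growth lemma applies to that slice.
\<close>
proposition fs_norm_infinity_finite:
  fixes f :: "complex ^ 'n \<Rightarrow> complex"
  assumes f: "f \<in> fock_sobolev \<alpha> \<infinity> m" and \<alpha>: "\<alpha> > 0"
  shows "fs_norm \<alpha> \<infinity> m f < \<infinity>"
proof -
  have ent: "entire f" using f by (simp add: fock_sobolev_def)
  define S where "S = (\<Sum>\<beta>\<in>multi_indices m. fock_norm \<alpha> \<infinity> (multi_deriv \<beta> f))"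
  define K where "K = enn2real S"
  have S: "S = ennreal K" and K: "K \<ge> 0"
    using f by (auto simp: fock_sobolev_def S_def K_def)
  have bd: "norm ((partial_deriv j ^^ k) f z) \<le> K * exp (\<alpha> / 2 * (norm z)\<^sup>2)" if k: "k \<le> m" for j k z
  proof -
    have "(\<lambda>i. if i = j then k else 0) \<in> multi_indices m"
      using k by (simp add: multi_indices_def)
    then have "fock_norm \<alpha> \<infinity> (multi_deriv (\<lambda>i. if i = j then k else 0) f) \<le> S"
      unfolding S_def by (intro member_le_sum finite_multi_indices) auto
    then show ?thesis
      unfolding multi_deriv_pure S by (rule fock_norm_infinity_le) (rule K)
  qed
  obtain C where C: "C > 0" "\<forall>g K. g holomorphic_on UNIV \<longrightarrow>
    (\<forall>k\<le>m. \<forall>\<zeta>. norm ((deriv ^^ k) g \<zeta>) \<le> K * exp (\<alpha> / 2 * (norm \<zeta>)\<^sup>2)) \<longrightarrow>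
    (\<forall>\<zeta>. norm \<zeta> ^ m * norm (g \<zeta>) \<le> C * K * exp (\<alpha> / 2 * (norm \<zeta>)\<^sup>2))"
    using growth_of_bounded_derivatives[OF \<alpha>, of m] by blast
  have "norm z ^ m * norm (f z) * exp (- (\<alpha> / 2) * (norm z)\<^sup>2) \<le> real CARD('n) ^ m * (C * K)" for z
  proof -
    have "\<exists>j. \<forall>i. norm (z $ i) \<le> norm (z $ j)"
    proof -
      have "Max (range (\<lambda>i. norm (z $ i))) \<in> range (\<lambda>i. norm (z $ i))" by (intro Max_in) auto
      then obtain j where "Max (range (\<lambda>i. norm (z $ i))) = norm (z $ j)" by (rule imageE)
      then show ?thesis by (metis Max_ge finite finite_imageI rangeI)
    qed
    then obtain j where j: "\<And>i. norm (z $ i) \<le> norm (z $ j)" by blast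
    define z0 where "z0 = z - axis j (z $ j)"
    have sq: "(norm (z0 + axis j t))\<^sup>2 = (norm z0)\<^sup>2 + (norm t)\<^sup>2" for t
    proof -
      have "(norm (z0 + axis j t))\<^sup>2 = (\<Sum>i\<in>UNIV. (norm (z0 $ i))\<^sup>2 + (if i = j then (norm t)\<^sup>2 else 0))"
        unfolding norm_vec_square by (intro sum.cong) (auto simp: z0_def axis_def)
      then show ?thesis by (simp add: sum.distrib norm_vec_square)
    qed
    have hol: "(\<lambda>t. f (z0 + axis j t)) holomorphic_on UNIV" by (rule entire_slice[OF ent])
    have "norm ((deriv ^^ k) (\<lambda>t. f (z0 + axis j t)) t)
        \<le> (K * exp (\<alpha> / 2 * (norm z0)\<^sup>2)) * exp (\<alpha> / 2 * (norm t)\<^sup>2)" if "k \<le> m" for k t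
      using bd[OF that, of j "z0 + axis j t"]
      by (simp add: deriv_iterate_slice sq mult.assoc ring_distribs flip: exp_add)
    then have "norm (z $ j) ^ m * norm (f (z0 + axis j (z $ j)))
        \<le> C * (K * exp (\<alpha> / 2 * (norm z0)\<^sup>2)) * exp (\<alpha> / 2 * (norm (z $ j))\<^sup>2)"
      using C(2)[rule_format, OF hol] by blast
    also have "\<dots> = C * K * exp (\<alpha> / 2 * (norm (z0 + axis j (z $ j)))\<^sup>2)"
      unfolding sq by (simp add: ring_distribs exp_add)
    finally have 1: "norm (z $ j) ^ m * norm (f z) \<le> C * K * exp (\<alpha> / 2 * (norm z)\<^sup>2)"
      by (simp add: z0_def)
    have "norm z = norm (\<Sum>i\<in>UNIV. axis i (z $ i))" by (simp only: sum_axis_nth)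
    also have "\<dots> \<le> (\<Sum>i\<in>(UNIV::'n set). norm (z $ j))"
      by (intro sum_norm_le) (simp add: j)
    finally have "norm z \<le> real CARD('n) * norm (z $ j)" by simp
    then have "norm z ^ m \<le> real CARD('n) ^ m * norm (z $ j) ^ m"
      using power_mono[of "norm z" "real CARD('n) * norm (z $ j)" m] by (simp add: power_mult_distrib)
    then have "norm z ^ m * norm (f z) \<le> real CARD('n) ^ m * (norm (z $ j) ^ m * norm (f z))"
      by (simp add: mult_right_mono mult.assoc[symmetric])
    also have "\<dots> \<le> real CARD('n) ^ m * (C * K * exp (\<alpha> / 2 * (norm z)\<^sup>2))"
      using 1 by (intro mult_left_mono) auto
    finally show ?thesis
      by (simp add: exp_minus field_simps)
  qed
  then have "fs_norm \<alpha> \<infinity> m f \<le> ennreal (real CARD('n) ^ m * (C * K))"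
    unfolding fs_norm_def by (auto intro!: SUP_least ennreal_leI)
  then show ?thesis using le_less_trans by fastforce
qed

text \<open>
  Away from the origin this is the definition of the norm, up to comparing \<open>|z|\<close> with \<open>1 + |z|\<close>.
\<close>
lemma fs_norm_infinity_pointwise:
  fixes f :: "complex ^ 'n \<Rightarrow> complex"
  assumes f: "entire f" and \<alpha>: "\<alpha> > 0" and N: "fs_norm \<alpha> \<infinity> m f \<le> ennreal R" and R: "R \<ge> 0"
  shows "norm (f z) \<le> 2 ^ m * exp (9 * \<alpha> / 2) * R * exp (\<alpha> / 2 * (norm z)\<^sup>2) / (1 + norm z) ^ m"
proof -
  have bd: "norm w ^ m * norm (f w) \<le> R * exp (\<alpha> / 2 * (norm w)\<^sup>2)" for w
  proof -
    have "ennreal (norm w ^ m * norm (f w) * exp (- (\<alpha> / 2) * (norm w)\<^sup>2)) \<le> ennreal R"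
      using N unfolding fs_norm_def by (auto simp: SUP_le_iff)
    then have "norm w ^ m * norm (f w) * exp (- (\<alpha> / 2) * (norm w)\<^sup>2) \<le> R"
      using R by simp
    then show ?thesis by (simp add: exp_minus field_simps)
  qed
  have pos: "(1 + norm z) ^ m > 0" by (intro zero_less_power add_pos_nonneg) auto
  have "(1 + norm z) ^ m * norm (f z) \<le> 2 ^ m * exp (9 * \<alpha> / 2) * R * exp (\<alpha> / 2 * (norm z)\<^sup>2)"
  proof (cases "norm z \<ge> 1")
    case True
    have "(1 + norm z) ^ m \<le> (2 * norm z) ^ m"
      using True by (intro power_mono) auto
    then have "(1 + norm z) ^ m * norm (f z) \<le> 2 ^ m * (norm z ^ m * norm (f z))"
      by (simp add: power_mult_distrib mult_right_mono mult.assoc[symmetric])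
    also have "\<dots> \<le> 2 ^ m * (R * exp (\<alpha> / 2 * (norm z)\<^sup>2))"
      using bd by (intro mult_left_mono) auto
    also have "\<dots> \<le> 2 ^ m * (exp (9 * \<alpha> / 2) * (R * exp (\<alpha> / 2 * (norm z)\<^sup>2)))"
    proof (rule mult_left_mono)
      have "1 \<le> exp (9 * \<alpha> / 2)" using \<alpha> by simp
      from mult_right_mono[OF this, of "R * exp (\<alpha> / 2 * (norm z)\<^sup>2)"] R
      show "R * exp (\<alpha> / 2 * (norm z)\<^sup>2) \<le> exp (9 * \<alpha> / 2) * (R * exp (\<alpha> / 2 * (norm z)\<^sup>2))"
        by simp
    qed simp
    finally show ?thesis by (simp add: mult.assoc)
  next
    case False
    \<comment> \<open>The weight degenerates near the origin; there, Cauchy's estimate on a circle of radius 2 takes over.\<close>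
    fix j :: 'n
    have circ: "norm (f (z + axis j t)) \<le> R * exp (9 * \<alpha> / 2)" if t: "norm t = 2" for t
    proof -
      define w where "w = z + axis j t"
      have "norm t - norm z \<le> norm w"
        using norm_triangle_ineq2[of "axis j t" "- z"] by (simp add: w_def add.commute)
      then have w1: "norm w \<ge> 1" using t False by simp
      have "norm w \<le> norm z + norm t" unfolding w_def by (rule norm_triangle_le) simp
      then have "norm w \<le> 3" using t False by simp
      then have "(norm w)\<^sup>2 \<le> 3\<^sup>2" by (intro power_mono) auto
      then have "\<alpha> / 2 * (norm w)\<^sup>2 \<le> \<alpha> / 2 * 3\<^sup>2" using \<alpha> by (intro mult_left_mono) auto
      then have ex: "exp (\<alpha> / 2 * (norm w)\<^sup>2) \<le> exp (9 * \<alpha> / 2)" by simp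
      have "1 * norm (f w) \<le> norm w ^ m * norm (f w)"
        using w1 by (intro mult_right_mono) auto
      also have "\<dots> \<le> R * exp (9 * \<alpha> / 2)"
        using bd[of w] mult_left_mono[OF ex R] by linarith
      finally show ?thesis by (simp add: w_def)
    qed
    have "norm ((deriv ^^ 0) (\<lambda>t. f (z + axis j t)) 0) \<le> fact 0 * (R * exp (9 * \<alpha> / 2)) / 2 ^ 0"
      using circ by (intro Cauchy_inequality)
        (auto intro: holomorphic_on_subset[OF entire_slice[OF f]]
          holomorphic_on_imp_continuous_on[OF holomorphic_on_subset[OF entire_slice[OF f]]])
    then have fz: "norm (f z) \<le> R * exp (9 * \<alpha> / 2)" by simp
    have "(1 + norm z) ^ m \<le> 2 ^ m" using False by (intro power_mono) auto
    then have "(1 + norm z) ^ m * norm (f z) \<le> 2 ^ m * (R * exp (9 * \<alpha> / 2))"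
      using fz by (intro mult_mono) auto
    also have "\<dots> * 1 \<le> 2 ^ m * (R * exp (9 * \<alpha> / 2)) * exp (\<alpha> / 2 * (norm z)\<^sup>2)"
      using R \<alpha> by (intro mult_left_mono) auto
    finally show ?thesis by (simp add: mult_ac)
  qed
  then show ?thesis using pos by (simp add: field_simps)
qed

section \<open>Gaussian integrals and the kernel\<close>

lemma nn_integral_exp_half_line:
  fixes c :: real
  assumes "c > 0"
  shows "(\<integral>\<^sup>+ t. ennreal (exp (- c * t)) * indicator {0..} t \<partial>lborel) < top"
proof -
  have lim: "((\<lambda>t. - exp (- c * t) / c) \<longlongrightarrow> - 0 / c) at_top"
  proof (intro tendsto_intros)
    show "((\<lambda>t. exp (- c * t)) \<longlongrightarrow> 0) at_top"
    proof (rule filterlim_compose[OF exp_at_bot])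
      show "LIM t at_top. - c * t :> at_bot"
        using assms filterlim_tendsto_neg_mult_at_bot[OF tendsto_const _ filterlim_ident, of "- c"] by simp
    qed
  qed (use assms in auto)
  have "(\<integral>\<^sup>+ t. ennreal (exp (- c * t)) * indicator {0..} t \<partial>lborel) = ennreal (- 0 / c - (- exp (- c * 0) / c))"
  proof (rule nn_integral_FTC_atLeast[where F = "\<lambda>t. - exp (- c * t) / c"])
    show "((\<lambda>t. - exp (- c * t) / c) has_real_derivative exp (- c * t)) (at t)" for t
      using assms by (auto intro!: derivative_eq_intros)
  qed (use lim in auto)
  then show ?thesis by simp
qed

text \<open>
  The elementary bound \<open>|t| \<le> 1 + t\<^sup>2\<close> reduces this to two exponential integrals.
\<close>
lemma gaussian_integral_1d_finite:
  fixes c :: real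
  assumes c: "c > 0"
  shows "(\<integral>\<^sup>+ t. ennreal (exp (- c * t\<^sup>2)) \<partial>lborel) < top"
proof -
  define h where "h t = ennreal (exp (- c * t)) * indicator {0..} t" for t :: real
  have h [measurable]: "h \<in> borel_measurable borel" unfolding h_def by measurable
  have "(\<integral>\<^sup>+ t. ennreal (exp (- c * t\<^sup>2)) \<partial>lborel) \<le> (\<integral>\<^sup>+ t. ennreal (exp c) * (h t + h (- t)) \<partial>lborel)"
  proof (rule nn_integral_mono)
    fix t :: real
    have "\<bar>t\<bar> \<le> 1 + t\<^sup>2"
    proof (cases "\<bar>t\<bar> \<le> 1")
      case False
      then have "\<bar>t\<bar> * 1 \<le> \<bar>t\<bar> * \<bar>t\<bar>" by (intro mult_left_mono) auto
      then show ?thesis by (simp add: power2_eq_square)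
    qed (simp add: add_increasing2)
    then have "c * \<bar>t\<bar> \<le> c * (1 + t\<^sup>2)" using c by (intro mult_left_mono) auto
    then have "exp (- c * t\<^sup>2) \<le> exp (c + - c * \<bar>t\<bar>)"
      unfolding exp_le_cancel_iff by (simp add: algebra_simps)
    then have "ennreal (exp (- c * t\<^sup>2)) \<le> ennreal (exp c * exp (- c * \<bar>t\<bar>))"
      unfolding exp_add by (rule ennreal_leI)
    also have "\<dots> = ennreal (exp c) * ennreal (exp (- c * \<bar>t\<bar>))"
      by (rule ennreal_mult') simp
    also have "\<dots> \<le> ennreal (exp c) * (h t + h (- t))"
      by (intro mult_left_mono) (auto simp: h_def indicator_def abs_if)
    finally show "ennreal (exp (- c * t\<^sup>2)) \<le> ennreal (exp c) * (h t + h (- t))" .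
  qed
  also have "\<dots> = ennreal (exp c) * ((\<integral>\<^sup>+ t. h t \<partial>lborel) + (\<integral>\<^sup>+ t. h (- t) \<partial>lborel))"
  proof -
    have "(\<integral>\<^sup>+ t. h t + h (- t) \<partial>lborel) = (\<integral>\<^sup>+ t. h t \<partial>lborel) + (\<integral>\<^sup>+ t. h (- t) \<partial>lborel)"
      by (rule nn_integral_add) measurable
    moreover have "(\<integral>\<^sup>+ t. ennreal (exp c) * (h t + h (- t)) \<partial>lborel) = ennreal (exp c) * (\<integral>\<^sup>+ t. h t + h (- t) \<partial>lborel)"
      by (rule nn_integral_cmult) measurable
    ultimately show ?thesis by simp
  qed
  also have "(\<integral>\<^sup>+ t. h (- t) \<partial>lborel) = (\<integral>\<^sup>+ t. h t \<partial>lborel)"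
    using nn_integral_real_affine[OF h, of "-1" 0] by simp
  also have "ennreal (exp c) * ((\<integral>\<^sup>+ t. h t \<partial>lborel) + (\<integral>\<^sup>+ t. h t \<partial>lborel)) < top"
    using nn_integral_exp_half_line[OF c] by (simp add: h_def ennreal_mult_less_top)
  finally show ?thesis .
qed

definition gaussian_mass :: "'n::finite itself \<Rightarrow> real \<Rightarrow> real"
  where "gaussian_mass _ c = enn2real (\<integral>\<^sup>+ w. ennreal (exp (- c * (norm (w :: complex ^ 'n))\<^sup>2)) \<partial>lborel)"

lemma gaussian_integral:
  fixes c :: real and \<zeta> :: "complex ^ 'n"
  assumes c: "c > 0"
  shows "(\<integral>\<^sup>+ w. ennreal (exp (- c * (norm (w - \<zeta>))\<^sup>2)) \<partial>lborel) = ennreal (gaussian_mass TYPE('n) c)"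
    and "gaussian_mass TYPE('n) c > 0"
proof -
  define I where "I = (\<integral>\<^sup>+ w. ennreal (exp (- c * (norm (w :: complex ^ 'n))\<^sup>2)) \<partial>lborel)"
  have m: "(\<lambda>w :: complex ^ 'n. ennreal (exp (- c * (norm w)\<^sup>2))) \<in> borel_measurable borel" by measurable
  have tr: "(\<integral>\<^sup>+ w. ennreal (exp (- c * (norm (w - \<zeta>))\<^sup>2)) \<partial>lborel) = I"
    using nn_integral_translate[OF m, of "- \<zeta>"] by (simp add: I_def)
  have "I = (\<integral>\<^sup>+ w. (\<Prod>b\<in>Basis. ennreal (exp (- c * ((w :: complex ^ 'n) \<bullet> b)\<^sup>2))) \<partial>lborel)"
    unfolding I_def
  proof (rule nn_integral_cong)
    fix w :: "complex ^ 'n"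
    have "(norm w)\<^sup>2 = (\<Sum>b\<in>Basis. (w \<bullet> b)\<^sup>2)"
      unfolding power2_norm_eq_inner by (subst euclidean_inner) (simp add: power2_eq_square)
    then have "exp (- c * (norm w)\<^sup>2) = (\<Prod>b\<in>Basis. exp (- c * (w \<bullet> b)\<^sup>2))"
      by (simp add: sum_distrib_left exp_sum flip: sum_negf)
    then show "ennreal (exp (- c * (norm w)\<^sup>2)) = (\<Prod>b\<in>Basis. ennreal (exp (- c * (w \<bullet> b)\<^sup>2)))"
      by (simp add: prod_ennreal)
  qed
  also have "\<dots> = (\<Prod>b\<in>(Basis :: (complex ^ 'n) set). (\<integral>\<^sup>+ t. ennreal (exp (- c * t\<^sup>2)) \<partial>lborel))"
    by (rule nn_integral_lborel_prod) auto
  also have "\<dots> < top"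
    using gaussian_integral_1d_finite[OF c] by (simp add: power_less_top_ennreal)
  finally have fin: "I < top" .
  then show "(\<integral>\<^sup>+ w. ennreal (exp (- c * (norm (w - \<zeta>))\<^sup>2)) \<partial>lborel) = ennreal (gaussian_mass TYPE('n) c)"
    unfolding tr gaussian_mass_def I_def[symmetric] by simp
  have "0 < ennreal (exp (- c)) * emeasure lborel (ball (0 :: complex ^ 'n) 1)"
    by (simp add: emeasure_ball ennreal_zero_less_mult_iff)
  also have "\<dots> = (\<integral>\<^sup>+ w. ennreal (exp (- c)) * indicator (ball (0 :: complex ^ 'n) 1) w \<partial>lborel)"
    by (rule nn_integral_cmult_indicator[symmetric]) simp
  also have "\<dots> \<le> I"
    unfolding I_def
  proof (rule nn_integral_mono)
    fix w :: "complex ^ 'n"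
    have "exp (- c) \<le> exp (- c * (norm w)\<^sup>2)" if "norm w < 1"
    proof -
      have "(norm w)\<^sup>2 \<le> 1" using that by (simp add: power_le_one)
      then have "c * (norm w)\<^sup>2 \<le> c * 1" using c by (intro mult_left_mono) auto
      then show ?thesis by simp
    qed
    then show "ennreal (exp (- c)) * indicator (ball 0 1) w \<le> ennreal (exp (- c * (norm w)\<^sup>2))"
      by (auto simp: indicator_def ennreal_leI)
  qed
  finally show "gaussian_mass TYPE('n) c > 0"
    unfolding gaussian_mass_def I_def[symmetric] using fin by (simp add: enn2real_positive_iff)
qed

lemma norm_diff_square:
  "(norm (z - w))\<^sup>2 = (norm z)\<^sup>2 + (norm w)\<^sup>2 - 2 * Re (herm z (w :: complex ^ 'n))"
proof -
  have "Re (herm z w) = z \<bullet> w"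
    by (simp add: herm_def inner_vec_def inner_complex_def)
  then show ?thesis by (simp add: power2_norm_eq_inner inner_diff inner_commute algebra_simps)
qed

lemma norm_ker: "norm (ker \<alpha> w z) = exp (\<alpha> / 2 * (norm z)\<^sup>2) * exp (- (\<alpha> / 2) * (norm (w - z))\<^sup>2)"
  unfolding ker_def norm_exp_eq_Re norm_minus_commute[of w z]
  by (simp add: norm_diff_square algebra_simps flip: exp_add)

section \<open>Weighted composition operators\<close>

lemma entire_comp:
  fixes f :: "complex ^ 'n \<Rightarrow> complex" and \<psi> :: "complex ^ 'n \<Rightarrow> complex ^ 'n"
  assumes f: "entire f" and \<psi>: "entire_map \<psi>"
  shows "entire (\<lambda>z. f (\<psi> z))"
  unfolding entire_def
proof
  fix z
  have "\<forall>j. \<exists>D. ((\<lambda>z. \<psi> z $ j) has_derivative D) (at z) \<and> (\<forall>c v. D (c *s v) = c * D v)"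
    using \<psi> by (simp add: entire_map_def entire_def)
  then obtain D where D: "\<And>j. ((\<lambda>z. \<psi> z $ j) has_derivative D j) (at z)" "\<And>j c v. D j (c *s v) = c * D j v"
    by metis
  obtain F where F: "(f has_derivative F) (at (\<psi> z))" "\<And>c v. F (c *s v) = c * F v"
    using f unfolding entire_def by blast
  have "((\<lambda>z. \<Sum>j\<in>UNIV. axis j (\<psi> z $ j)) has_derivative (\<lambda>v. \<Sum>j\<in>UNIV. axis j (D j v))) (at z)"
    by (intro has_derivative_sum bounded_linear.has_derivative[OF bounded_linear_axis] D(1))
  then have "(\<psi> has_derivative (\<lambda>v. \<Sum>j\<in>UNIV. axis j (D j v))) (at z)"
    by (simp only: sum_axis_nth)
  from has_derivative_compose[OF this F(1)]
  have "((\<lambda>z. f (\<psi> z)) has_derivative (\<lambda>v. F (\<Sum>j\<in>UNIV. axis j (D j v)))) (at z)" .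
  moreover have "\<forall>c v. F (\<Sum>j\<in>UNIV. axis j (D j (c *s v))) = c * F (\<Sum>j\<in>UNIV. axis j (D j v))"
  proof (intro allI)
    fix c v
    have "(\<Sum>j\<in>UNIV. axis j (D j (c *s v))) = c *s (\<Sum>j\<in>UNIV. axis j (D j v))"
      by (simp add: vec_eq_iff axis_def D(2))
    then show "F (\<Sum>j\<in>UNIV. axis j (D j (c *s v))) = c * F (\<Sum>j\<in>UNIV. axis j (D j v))"
      by (simp only: F(2))
  qed
  ultimately show "\<exists>D. ((\<lambda>z. f (\<psi> z)) has_derivative D) (at z) \<and> (\<forall>c v. D (c *s v) = c * D v)"
    by (intro exI[of _ "\<lambda>v. F (\<Sum>j\<in>UNIV. axis j (D j v))"] conjI)
qed

lemma entire_mult: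
  assumes f: "entire f" and g: "entire g"
  shows "entire (\<lambda>z. f z * g z)"
  unfolding entire_def
proof
  fix z
  obtain F where F: "(f has_derivative F) (at z)" "\<And>c v. F (c *s v) = c * F v"
    using f unfolding entire_def by blast
  obtain G where G: "(g has_derivative G) (at z)" "\<And>c v. G (c *s v) = c * G v"
    using g unfolding entire_def by blast
  have "((\<lambda>z. f z * g z) has_derivative (\<lambda>v. f z * G v + F v * g z)) (at z)"
    by (rule has_derivative_mult[OF F(1) G(1)])
  moreover have "\<forall>c v. f z * G (c *s v) + F (c *s v) * g z = c * (f z * G v + F v * g z)"
    by (simp add: F(2) G(2) algebra_simps)
  ultimately show "\<exists>D. ((\<lambda>z. f z * g z) has_derivative D) (at z) \<and> (\<forall>c v. D (c *s v) = c * D v)"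
    by (intro exI[of _ "\<lambda>v. f z * G v + F v * g z"] conjI)
qed

lemma entire_wcomp: "entire u \<Longrightarrow> entire_map \<psi> \<Longrightarrow> entire f \<Longrightarrow> entire (wcomp u \<psi> f)"
  unfolding wcomp_def by (rule entire_mult[OF _ entire_comp])

lemma entire_measurable: "entire f \<Longrightarrow> f \<in> borel_measurable borel"
  using entire_continuous by (rule borel_measurable_continuous_onI)

lemma entire_map_measurable:
  fixes \<psi> :: "complex ^ 'n \<Rightarrow> complex ^ 'n"
  assumes "entire_map \<psi>"
  shows "\<psi> \<in> borel_measurable borel"
proof -
  have "continuous_on UNIV (\<lambda>z. \<Sum>j\<in>UNIV. axis j (\<psi> z $ j))"
    using assms by (intro continuous_intros entire_continuous) (simp add: entire_map_def)
  then show ?thesis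
    unfolding sum_axis_nth by (rule borel_measurable_continuous_onI)
qed

text \<open>
  The integrand of the quantity \<open>I\<close> described at the beginning.
\<close>
definition berezin_density ::
    "real \<Rightarrow> real \<Rightarrow> nat \<Rightarrow> (complex ^ 'n \<Rightarrow> complex) \<Rightarrow> (complex ^ 'n \<Rightarrow> complex ^ 'n) \<Rightarrow> complex ^ 'n \<Rightarrow> real"
  where "berezin_density \<alpha> q m u \<psi> z =
    exp (\<alpha> * q / 2 * (norm (\<psi> z))\<^sup>2) / (1 + norm (\<psi> z)) powr (real m * q) *
      (norm (u z) powr q * (norm z ^ m) powr q * exp (- (\<alpha> * q / 2) * (norm z)\<^sup>2))"

lemma berezin_density_nonneg: "berezin_density \<alpha> q m u \<psi> z \<ge> 0"
  by (simp add: berezin_density_def)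

lemma
  fixes u :: "complex ^ 'n \<Rightarrow> complex"
  assumes \<alpha>: "\<alpha> > 0" and q: "q > 0" and u: "entire u" and \<psi>: "entire_map \<psi>"
  shows berezin_density_measurable: "berezin_density \<alpha> q m u \<psi> \<in> borel_measurable borel"
    and Berezin_measurable: "Berezin \<alpha> q m u \<psi> \<in> borel_measurable lborel"
    and L1_norm_Berezin: "L1_norm (Berezin \<alpha> q m u \<psi>) =
      ennreal (gaussian_mass TYPE('n) (\<alpha> * q / 2)) * (\<integral>\<^sup>+ z. ennreal (berezin_density \<alpha> q m u \<psi> z) \<partial>lborel)"
proof -
  note [measurable] = entire_measurable[OF u] entire_map_measurable[OF \<psi>]
  show dm [measurable]: "berezin_density \<alpha> q m u \<psi> \<in> borel_measurable borel"
    unfolding berezin_density_def by measurable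
  define F where "F w z = ennreal (berezin_density \<alpha> q m u \<psi> z) * ennreal (exp (- (\<alpha> * q / 2) * (norm (w - \<psi> z))\<^sup>2))"
    for w z
  have B: "Berezin \<alpha> q m u \<psi> = (\<lambda>w. \<integral>\<^sup>+ z. F w z \<partial>lborel)"
    unfolding Berezin_def F_def
  proof (intro ext nn_integral_cong)
    fix w z :: "complex ^ 'n"
    have "norm (ker \<alpha> w (\<psi> z)) powr q = exp (\<alpha> * q / 2 * (norm (\<psi> z))\<^sup>2) * exp (- (\<alpha> * q / 2) * (norm (w - \<psi> z))\<^sup>2)"
      unfolding norm_ker by (simp add: powr_def algebra_simps flip: exp_add)
    then show "ennreal (norm (ker \<alpha> w (\<psi> z)) powr q / (1 + norm (\<psi> z)) powr (real m * q) *
                    norm (u z) powr q * (norm z ^ m) powr q *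
                    exp (- (\<alpha> * q / 2) * (norm z)\<^sup>2)) =
         ennreal (berezin_density \<alpha> q m u \<psi> z) * ennreal (exp (- (\<alpha> * q / 2) * (norm (w - \<psi> z))\<^sup>2))"
      by (simp add: berezin_density_def mult_ac flip: ennreal_mult')
  qed
  have Fm: "case_prod F \<in> borel_measurable (borel \<Otimes>\<^sub>M borel)"
    unfolding F_def by measurable
  show "Berezin \<alpha> q m u \<psi> \<in> borel_measurable lborel"
  proof -
    have "case_prod F \<in> borel_measurable (borel \<Otimes>\<^sub>M lborel)"
      using Fm measurable_cong_sets[OF sets_pair_measure_cong[OF refl sets_lborel] refl] by blast
    then show ?thesis
      unfolding B by (simp add: lborel.borel_measurable_nn_integral)
  qed
  have "L1_norm (Berezin \<alpha> q m u \<psi>) = (\<integral>\<^sup>+ w. \<integral>\<^sup>+ z. F w z \<partial>lborel \<partial>lborel)"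
    by (simp add: L1_norm_def B)
  also have "\<dots> = (\<integral>\<^sup>+ z. \<integral>\<^sup>+ w. F w z \<partial>lborel \<partial>lborel)"
    by (rule lborel_Fubini[symmetric]) (rule Fm)
  also have "\<dots> = (\<integral>\<^sup>+ z. ennreal (berezin_density \<alpha> q m u \<psi> z) * ennreal (gaussian_mass TYPE('n) (\<alpha> * q / 2)) \<partial>lborel)"
  proof (rule nn_integral_cong)
    fix z
    have "(\<integral>\<^sup>+ w. F w z \<partial>lborel) = ennreal (berezin_density \<alpha> q m u \<psi> z) *
        (\<integral>\<^sup>+ w. ennreal (exp (- (\<alpha> * q / 2) * (norm (w - \<psi> z))\<^sup>2)) \<partial>lborel)"
      unfolding F_def by (rule nn_integral_cmult) measurable
    then show "(\<integral>\<^sup>+ w. F w z \<partial>lborel) = ennreal (berezin_density \<alpha> q m u \<psi> z) * ennreal (gaussian_mass TYPE('n) (\<alpha> * q / 2))"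
      using gaussian_integral(1)[of "\<alpha> * q / 2" "\<psi> z"] \<alpha> q by simp
  qed
  also have "\<dots> = (\<integral>\<^sup>+ z. ennreal (berezin_density \<alpha> q m u \<psi> z) \<partial>lborel) * ennreal (gaussian_mass TYPE('n) (\<alpha> * q / 2))"
    by (rule nn_integral_multc) measurable
  finally show "L1_norm (Berezin \<alpha> q m u \<psi>) =
      ennreal (gaussian_mass TYPE('n) (\<alpha> * q / 2)) * (\<integral>\<^sup>+ z. ennreal (berezin_density \<alpha> q m u \<psi> z) \<partial>lborel)"
    by (simp add: mult.commute)
qed

text \<open>
  The density is what remains of the integrand of the norm of \<open>u \<cdot> (f \<circ> \<psi>)\<close> when the second factor, the
  weighted size of \<open>f\<close> at the point \<open>\<psi>(z)\<close>, is split off.  Upper and lower estimates of the operator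
  are upper and lower bounds for that factor.
\<close>
lemma sobolev_integrand_wcomp:
  "(norm z ^ m) powr q * norm (wcomp u \<psi> f z) powr q * exp (- (\<alpha> * q / 2) * (norm z)\<^sup>2) =
    berezin_density \<alpha> q m u \<psi> z *
      (norm (f (\<psi> z)) powr q * (1 + norm (\<psi> z)) powr (real m * q) * exp (- (\<alpha> * q / 2) * (norm (\<psi> z))\<^sup>2))"
proof -
  have "1 + norm (\<psi> z) > 0" by (simp add: add_pos_nonneg)
  then have "(1 + norm (\<psi> z)) powr (real m * q) > 0" by (metis less_irrefl powr_gt_zero)
  moreover have "exp (\<alpha> * q / 2 * (norm (\<psi> z))\<^sup>2) * exp (- (\<alpha> * q / 2) * (norm (\<psi> z))\<^sup>2) = 1"
    by (simp flip: exp_add)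
  ultimately show ?thesis
    by (simp add: berezin_density_def wcomp_def norm_mult powr_mult field_simps)
qed

lemma weighted_powr_le:
  fixes c p q x :: real
  assumes "q > 0" "c \<ge> 0" "p \<ge> 0" "x \<ge> 0" and x: "x \<le> c * exp (\<alpha> / 2 * p\<^sup>2) / (1 + p) ^ m"
  shows "x powr q * (1 + p) powr (real m * q) * exp (- (\<alpha> * q / 2) * p\<^sup>2) \<le> c powr q"
proof -
  have p: "1 + p > 0" using assms by simp
  have "x powr q \<le> (c * exp (\<alpha> / 2 * p\<^sup>2) / (1 + p) ^ m) powr q"
    using assms by (intro powr_mono2) auto
  also have "\<dots> = c powr q * exp (\<alpha> * q / 2 * p\<^sup>2) / (1 + p) powr (real m * q)"
    using p assms by (simp add: powr_mult powr_divide powr_powr exp_powr_real mult_ac flip: powr_realpow)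
  finally have "x powr q * ((1 + p) powr (real m * q) * exp (- (\<alpha> * q / 2) * p\<^sup>2))
      \<le> (c powr q * exp (\<alpha> * q / 2 * p\<^sup>2) / (1 + p) powr (real m * q)) * ((1 + p) powr (real m * q) * exp (- (\<alpha> * q / 2) * p\<^sup>2))"
    by (rule mult_right_mono) simp
  also have "\<dots> = c powr q * (exp (\<alpha> * q / 2 * p\<^sup>2) * exp (- (\<alpha> * q / 2) * p\<^sup>2))"
    using p by (simp add: field_simps)
  also have "\<dots> = c powr q" by (simp flip: exp_add)
  finally show ?thesis by (simp add: mult.assoc)
qed

lemma sobolev_integral_wcomp_le:
  fixes u :: "complex ^ 'n \<Rightarrow> complex"
  assumes \<alpha>: "\<alpha> > 0" and q: "q > 0" and u: "entire u" and \<psi>: "entire_map \<psi>"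
    and f: "entire f" and N: "fs_norm \<alpha> \<infinity> m f \<le> ennreal R" and R: "R \<ge> 0"
  shows "sobolev_integral \<alpha> q m (wcomp u \<psi> f) \<le>
    ennreal ((2 ^ m * exp (9 * \<alpha> / 2) * R) powr q) * (\<integral>\<^sup>+ z. ennreal (berezin_density \<alpha> q m u \<psi> z) \<partial>lborel)"
proof -
  define c where "c = 2 ^ m * exp (9 * \<alpha> / 2) * R"
  have c: "c \<ge> 0" using R by (simp add: c_def)
  have "sobolev_integral \<alpha> q m (wcomp u \<psi> f) \<le> (\<integral>\<^sup>+ z. ennreal (c powr q) * ennreal (berezin_density \<alpha> q m u \<psi> z) \<partial>lborel)"
    unfolding sobolev_integral_def sobolev_integrand_wcomp
  proof (rule nn_integral_mono)
    fix z
    have "norm (f (\<psi> z)) \<le> c * exp (\<alpha> / 2 * (norm (\<psi> z))\<^sup>2) / (1 + norm (\<psi> z)) ^ m"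
      unfolding c_def by (rule fs_norm_infinity_pointwise[OF f \<alpha> N R])
    then have "norm (f (\<psi> z)) powr q * (1 + norm (\<psi> z)) powr (real m * q) * exp (- (\<alpha> * q / 2) * (norm (\<psi> z))\<^sup>2) \<le> c powr q"
      using q c by (intro weighted_powr_le) auto
    from mult_left_mono[OF this berezin_density_nonneg[of \<alpha> q m u \<psi> z]]
    show "ennreal (berezin_density \<alpha> q m u \<psi> z *
      (norm (f (\<psi> z)) powr q * (1 + norm (\<psi> z)) powr (real m * q) * exp (- (\<alpha> * q / 2) * (norm (\<psi> z))\<^sup>2)))
      \<le> ennreal (c powr q) * ennreal (berezin_density \<alpha> q m u \<psi> z)"
      by (simp add: mult.commute ennreal_leI flip: ennreal_mult')
  qed
  also have "\<dots> = ennreal (c powr q) * (\<integral>\<^sup>+ z. ennreal (berezin_density \<alpha> q m u \<psi> z) \<partial>lborel)"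
    using berezin_density_measurable[OF \<alpha> q u \<psi>, of m] by (intro nn_integral_cmult) measurable
  finally show ?thesis by (simp add: c_def)
qed

section \<open>Test functions\<close>

definition kernel_sum :: "real \<Rightarrow> (complex ^ 'n \<Rightarrow> complex) \<Rightarrow> (complex ^ 'n) set \<Rightarrow> complex ^ 'n \<Rightarrow> complex"
  where "kernel_sum \<alpha> c D z = (\<Sum>w\<in>D. c w * ker \<alpha> w z)"

lemma herm_axis: "herm (z + axis j t) w = herm z w + t * cnj (w $ j)"
proof -
  have "herm (z + axis j t) w = (\<Sum>i\<in>UNIV. z $ i * cnj (w $ i) + (if i = j then t * cnj (w $ j) else 0))"
    unfolding herm_def by (intro sum.cong) (auto simp: axis_def algebra_simps)
  then show ?thesis by (simp add: sum.distrib herm_def)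
qed

lemma ker_axis: "ker \<alpha> w (z + axis j t) = ker \<alpha> w z * exp (complex_of_real \<alpha> * cnj (w $ j) * t)"
  unfolding ker_def herm_axis by (simp add: algebra_simps flip: exp_add)

lemma entire_kernel_sum: "entire (kernel_sum \<alpha> c D)"
  unfolding entire_iff_separately_holomorphic separately_holomorphic_def
proof (intro conjI allI)
  show "continuous_on UNIV (kernel_sum \<alpha> c D)"
    unfolding kernel_sum_def ker_def herm_def by (intro continuous_intros)
  show "(\<lambda>t. kernel_sum \<alpha> c D (z + axis j t)) holomorphic_on UNIV" for z j
    unfolding kernel_sum_def ker_axis by (intro holomorphic_intros)
qed

lemma partial_deriv_kernel_sum:
  "partial_deriv j (kernel_sum \<alpha> c D) = kernel_sum \<alpha> (\<lambda>w. c w * (complex_of_real \<alpha> * cnj (w $ j))) D"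
proof
  fix z
  have "((\<lambda>t. \<Sum>w\<in>D. c w * (ker \<alpha> w z * exp (complex_of_real \<alpha> * cnj (w $ j) * t))) has_field_derivative
      (\<Sum>w\<in>D. c w * (complex_of_real \<alpha> * cnj (w $ j)) * ker \<alpha> w z)) (at 0)"
    by (rule DERIV_sum) (auto intro!: derivative_eq_intros)
  then show "partial_deriv j (kernel_sum \<alpha> c D) z = kernel_sum \<alpha> (\<lambda>w. c w * (complex_of_real \<alpha> * cnj (w $ j))) D z"
    unfolding partial_deriv_def kernel_sum_def ker_axis by (rule DERIV_imp_deriv)
qed

lemma norm_kernel_sum_le:
  "norm (kernel_sum \<alpha> c D z) * exp (- (\<alpha> / 2) * (norm z)\<^sup>2) \<le>
    (\<Sum>w\<in>D. norm (c w) * exp (- (\<alpha> / 2) * (norm (w - z))\<^sup>2))"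
proof -
  have ee: "exp (\<alpha> / 2 * (norm z)\<^sup>2) * exp (- (\<alpha> / 2) * (norm z)\<^sup>2) = 1" by (simp flip: exp_add)
  have "norm (kernel_sum \<alpha> c D z) \<le> (\<Sum>w\<in>D. norm (c w) * norm (ker \<alpha> w z))"
    unfolding kernel_sum_def by (intro sum_norm_le) (simp add: norm_mult)
  then have "norm (kernel_sum \<alpha> c D z) * exp (- (\<alpha> / 2) * (norm z)\<^sup>2)
      \<le> (\<Sum>w\<in>D. norm (c w) * norm (ker \<alpha> w z)) * exp (- (\<alpha> / 2) * (norm z)\<^sup>2)"
    by (rule mult_right_mono) simp
  also have "\<dots> = (\<Sum>w\<in>D. norm (c w) * exp (- (\<alpha> / 2) * (norm (w - z))\<^sup>2) *
      (exp (\<alpha> / 2 * (norm z)\<^sup>2) * exp (- (\<alpha> / 2) * (norm z)\<^sup>2)))"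
    unfolding norm_ker sum_distrib_right by (intro sum.cong) (simp_all only: mult_ac)
  finally show ?thesis unfolding ee by simp
qed

lemma kernel_sum_in_fock_sobolev:
  fixes c :: "complex ^ 'n \<Rightarrow> complex"
  assumes \<alpha>: "\<alpha> > 0"
  shows "kernel_sum \<alpha> c D \<in> fock_sobolev \<alpha> \<infinity> m"
proof -
  define P where "P k f \<longleftrightarrow> (\<exists>c. f = kernel_sum \<alpha> c D)" for k :: nat and f :: "complex ^ 'n \<Rightarrow> complex"
  have step: "P k (partial_deriv j f)" if "P (Suc k) f" for k f j
    using that by (auto simp: P_def partial_deriv_kernel_sum)
  have fin: "fock_norm \<alpha> \<infinity> (kernel_sum \<alpha> c D) < top" for c :: "complex ^ 'n \<Rightarrow> complex"
  proof -
    have "norm (kernel_sum \<alpha> c D z) * exp (- (\<alpha> / 2) * (norm z)\<^sup>2) \<le> (\<Sum>w\<in>D. norm (c w) * 1)" for z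
      using \<alpha> by (intro order_trans[OF norm_kernel_sum_le] sum_mono mult_left_mono) auto
    then have "fock_norm \<alpha> \<infinity> (kernel_sum \<alpha> c D) \<le> ennreal (\<Sum>w\<in>D. norm (c w) * 1)"
      unfolding fock_norm_def by (auto intro!: SUP_least ennreal_leI)
    then show ?thesis by (rule le_less_trans) simp
  qed
  have "fock_norm \<alpha> \<infinity> (multi_deriv \<beta> (kernel_sum \<alpha> c D)) < top" if \<beta>: "\<beta> \<in> multi_indices m" for \<beta>
  proof -
    have "P m (kernel_sum \<alpha> c D)" by (auto simp: P_def)
    from multi_deriv_induct[of P, OF step this \<beta>] show ?thesis
      using fin by (auto simp: P_def)
  qed
  then show ?thesis
    using entire_kernel_sum by (simp add: fock_sobolev_def finite_multi_indices)
qed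

definition one_separated :: "'a::metric_space set \<Rightarrow> bool"
  where "one_separated D \<longleftrightarrow> (\<forall>w\<in>D. \<forall>w'\<in>D. w \<noteq> w' \<longrightarrow> 1 \<le> dist w w')"

lemma polynomial_times_gaussian_bound:
  fixes c t :: real
  assumes "c > 0" "t \<ge> 0"
  shows "(1 + t) ^ m * exp (- c * t\<^sup>2) \<le> exp ((real m)\<^sup>2 / (4 * c))"
proof -
  have "(1 + t) ^ m \<le> exp t ^ m"
    using assms exp_ge_add_one_self[of t] by (intro power_mono) auto
  then have "(1 + t) ^ m * exp (- c * t\<^sup>2) \<le> exp (real m * t) * exp (- c * t\<^sup>2)"
    by (simp add: exp_of_nat_mult)
  also have "\<dots> = exp (real m * t - c * t\<^sup>2)" by (simp flip: exp_add)
  also have "\<dots> \<le> exp ((real m)\<^sup>2 / (4 * c))"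
  proof -
    have "0 \<le> (real m - 2 * c * t)\<^sup>2" by simp
    then have "4 * c * (real m * t - c * t\<^sup>2) \<le> (real m)\<^sup>2"
      by (simp add: power2_eq_square algebra_simps)
    then show ?thesis using assms by (simp add: field_simps)
  qed
  finally show ?thesis .
qed

text \<open>
  Each summand is at most a constant times the mean, over the ball of radius \<open>1/2\<close> about \<open>w\<close>, of a flatter
  Gaussian centred at \<open>z\<close>; these balls are disjoint, so the sum is at most a Gaussian integral,
  independently of the number of points.
\<close>
lemma separated_gaussian_sum:
  fixes \<alpha> :: real
  assumes \<alpha>: "\<alpha> > 0"
  shows "\<exists>C>0. \<forall>D :: (complex ^ 'n) set. \<forall>z. finite D \<longrightarrow> one_separated D \<longrightarrow>
    (\<Sum>w\<in>D. (1 + norm (w - z)) ^ m * exp (- (\<alpha> / 2) * (norm (w - z))\<^sup>2)) \<le> C"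
proof -
  define K where "K = exp ((real m)\<^sup>2 / (4 * (\<alpha> / 4))) * exp (\<alpha> / 16)"
  have K: "K > 0" by (simp add: K_def)
  define G where "G = gaussian_mass TYPE('n) (\<alpha> / 8)"
  have G: "G > 0" unfolding G_def using \<alpha> by (intro gaussian_integral(2)) auto
  define v where "v = measure lborel (ball (0 :: complex ^ 'n) (1 / 2))"
  have v: "v > 0" by (simp add: v_def)
  have em: "emeasure lborel (ball w (1 / 2)) = ennreal v" for w :: "complex ^ 'n"
    by (simp add: v_def emeasure_ball content_ball)
  show ?thesis
  proof (intro exI[of _ "K * G / v"] conjI allI impI)
    show "K * G / v > 0" using K G v by simp
    fix D :: "(complex ^ 'n) set" and z :: "complex ^ 'n"
    assume D: "finite D" "one_separated D"
    define T where "T w = (1 + norm (w - z)) ^ m * exp (- (\<alpha> / 2) * (norm (w - z))\<^sup>2)" for w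
    have T0: "T w \<ge> 0" for w by (simp add: T_def)
    define E where "E x = exp (- (\<alpha> / 8) * (norm (x - z))\<^sup>2)" for x
    have Em [measurable]: "E \<in> borel_measurable borel" unfolding E_def
      by (intro borel_measurable_continuous_onI continuous_intros)
    have [measurable]: "ball w (1 / 2) \<in> sets borel" for w :: "complex ^ 'n" by simp
    have TE: "T w \<le> K * E x" if x: "x \<in> ball w (1 / 2)" for w x
    proof -
      define t where "t = norm (w - z)"
      have "norm (x - z) \<le> norm (w - z) + norm (x - w)"
        using norm_triangle_ineq[of "w - z" "x - w"] by simp
      also have "\<dots> \<le> t + 1 / 2" using x by (simp add: t_def dist_norm norm_minus_commute)
      finally have "(norm (x - z))\<^sup>2 \<le> (t + 1 / 2)\<^sup>2" by (intro power_mono) auto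
      also have "\<dots> \<le> 2 * t\<^sup>2 + 1 / 2"
      proof -
        have "0 \<le> (t - 1 / 2)\<^sup>2" by simp
        then show ?thesis by (simp add: power2_eq_square algebra_simps)
      qed
      finally have "\<alpha> / 8 * (norm (x - z))\<^sup>2 \<le> \<alpha> / 8 * (2 * t\<^sup>2 + 1 / 2)"
        using \<alpha> by (intro mult_left_mono) auto
      then have "exp (- (\<alpha> / 4) * t\<^sup>2) \<le> exp (\<alpha> / 16 + - (\<alpha> / 8) * (norm (x - z))\<^sup>2)"
        unfolding exp_le_cancel_iff by (simp add: algebra_simps)
      then have ex: "exp (- (\<alpha> / 4) * t\<^sup>2) \<le> exp (\<alpha> / 16) * E x"
        by (simp only: exp_add E_def)
      have "exp (- (\<alpha> / 2) * t\<^sup>2) = exp (- (\<alpha> / 4) * t\<^sup>2) * exp (- (\<alpha> / 4) * t\<^sup>2)"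
        by (simp flip: exp_add)
      then have "T w = ((1 + t) ^ m * exp (- (\<alpha> / 4) * t\<^sup>2)) * exp (- (\<alpha> / 4) * t\<^sup>2)"
        by (simp add: T_def t_def)
      also have "\<dots> \<le> exp ((real m)\<^sup>2 / (4 * (\<alpha> / 4))) * (exp (\<alpha> / 16) * E x)"
        using \<alpha> ex by (intro mult_mono polynomial_times_gaussian_bound) (auto simp: t_def)
      finally show ?thesis by (simp add: K_def mult.assoc)
    qed
    have disj: "(\<Sum>w\<in>D. indicator (ball w (1 / 2)) x) \<le> (1 :: ennreal)" for x
    proof -
      have "(\<Sum>w\<in>D. indicator (ball w (1 / 2)) x) = (\<Sum>w\<in>D. if x \<in> ball w (1 / 2) then 1 else 0 :: ennreal)"
        by (intro sum.cong) (auto simp: indicator_def)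
      also have "\<dots> = of_nat (card {w \<in> D. x \<in> ball w (1 / 2)})"
        using D(1) by (simp add: sum.If_cases Int_def)
      also have "card {w \<in> D. x \<in> ball w (1 / 2)} \<le> 1"
      proof (rule card_le_Suc0_iff_eq[THEN iffD2, folded One_nat_def])
        show "\<forall>a\<in>{w \<in> D. x \<in> ball w (1 / 2)}. \<forall>b\<in>{w \<in> D. x \<in> ball w (1 / 2)}. a = b"
        proof (intro ballI)
          fix a b assume ab: "a \<in> {w \<in> D. x \<in> ball w (1 / 2)}" "b \<in> {w \<in> D. x \<in> ball w (1 / 2)}"
          have "dist a b < 1" using ab dist_triangle2[of a b x] by (simp add: dist_commute)
          then show "a = b" using ab D(2) by (force simp: one_separated_def)
        qed
      qed (use D in auto)
      then have "of_nat (card {w \<in> D. x \<in> ball w (1 / 2)}) \<le> (1 :: ennreal)"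
        by (metis of_nat_1 of_nat_mono)
      finally show ?thesis .
    qed
    have "ennreal ((\<Sum>w\<in>D. T w) * v) = (\<Sum>w\<in>D. ennreal (T w) * emeasure lborel (ball w (1 / 2)))"
      using T0 v by (simp add: em sum_distrib_right ennreal_mult' flip: sum_ennreal)
    also have "\<dots> = (\<Sum>w\<in>D. \<integral>\<^sup>+ x. ennreal (T w) * indicator (ball w (1 / 2)) x \<partial>lborel)"
      by (intro sum.cong refl nn_integral_cmult_indicator[symmetric]) simp
    also have "\<dots> = (\<integral>\<^sup>+ x. (\<Sum>w\<in>D. ennreal (T w) * indicator (ball w (1 / 2)) x) \<partial>lborel)"
      by (rule nn_integral_sum[symmetric]) measurable
    also have "\<dots> \<le> (\<integral>\<^sup>+ x. ennreal K * ennreal (E x) \<partial>lborel)"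
    proof (rule nn_integral_mono)
      fix x
      have "(\<Sum>w\<in>D. ennreal (T w) * indicator (ball w (1 / 2)) x)
          \<le> (\<Sum>w\<in>D. ennreal (K * E x) * indicator (ball w (1 / 2)) x)"
      proof (rule sum_mono)
        fix w
        show "ennreal (T w) * indicator (ball w (1 / 2)) x \<le> ennreal (K * E x) * indicator (ball w (1 / 2)) x"
          using TE[of x w] by (cases "x \<in> ball w (1 / 2)") (simp_all add: ennreal_leI)
      qed
      also have "\<dots> = ennreal (K * E x) * (\<Sum>w\<in>D. indicator (ball w (1 / 2)) x)"
        by (rule sum_distrib_left[symmetric])
      also have "\<dots> \<le> ennreal (K * E x) * 1" by (intro mult_left_mono disj) simp
      finally show "(\<Sum>w\<in>D. ennreal (T w) * indicator (ball w (1 / 2)) x) \<le> ennreal K * ennreal (E x)"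
        using K by (simp add: ennreal_mult')
    qed
    also have "\<dots> = ennreal K * (\<integral>\<^sup>+ x. ennreal (E x) \<partial>lborel)"
      by (rule nn_integral_cmult) measurable
    also have "(\<integral>\<^sup>+ x. ennreal (E x) \<partial>lborel) = ennreal G"
      unfolding E_def G_def using \<alpha> by (intro gaussian_integral(1)) auto
    finally have "ennreal ((\<Sum>w\<in>D. T w) * v) \<le> ennreal (K * G)"
      using K by (simp add: ennreal_mult')
    then have "(\<Sum>w\<in>D. T w) * v \<le> K * G"
      using K G by simp
    then show "(\<Sum>w\<in>D. (1 + norm (w - z)) ^ m * exp (- (\<alpha> / 2) * (norm (w - z))\<^sup>2)) \<le> K * G / v"
      unfolding T_def[symmetric] using v by (simp add: field_simps)
  qed
qed

lemma finite_one_separated_net: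
  "\<exists>D :: (complex ^ 'n) set. finite D \<and> one_separated D \<and>
    (\<forall>z. norm z \<le> real L \<longrightarrow> (\<exists>w\<in>D. norm (w - z) \<le> real CARD('n)))"
proof -
  define S where "S = {- int L..int L} \<times> {- int L..int L}"
  define p where "p h = (\<chi> j. Complex (of_int (fst (h j))) (of_int (snd (h j))))" for h :: "'n \<Rightarrow> int \<times> int"
  define D where "D = p ` (PiE UNIV (\<lambda>_. S))"
  have "finite D"
    unfolding D_def by (intro finite_imageI finite_PiE) (auto simp: S_def)
  moreover have "one_separated D"
    unfolding one_separated_def
  proof (intro ballI impI)
    fix w w' assume "w \<in> D" "w' \<in> D" and ne: "w \<noteq> w'"
    then obtain h h' where h: "w = p h" "w' = p h'" by (auto simp: D_def)
    from ne have "h \<noteq> h'" unfolding h by blast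
    then obtain j where "h j \<noteq> h' j" by (meson ext)
    then have "fst (h j) \<noteq> fst (h' j) \<or> snd (h j) \<noteq> snd (h' j)" by (simp add: prod_eq_iff)
    then have "1 \<le> \<bar>fst (h j) - fst (h' j)\<bar> \<or> 1 \<le> \<bar>snd (h j) - snd (h' j)\<bar>" by linarith
    then have "(1::real) \<le> \<bar>of_int (fst (h j) - fst (h' j))\<bar> \<or> (1::real) \<le> \<bar>of_int (snd (h j) - snd (h' j))\<bar>"
      by (simp only: of_int_abs[symmetric] of_int_1_le_iff)
    then have "1 \<le> \<bar>Re ((w - w') $ j)\<bar> \<or> 1 \<le> \<bar>Im ((w - w') $ j)\<bar>"
      by (simp add: h p_def)
    then have "1 \<le> norm ((w - w') $ j)"
      using abs_Re_le_cmod[of "(w - w') $ j"] abs_Im_le_cmod[of "(w - w') $ j"] by linarith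
    also have "\<dots> \<le> norm (w - w')" by (rule Finite_Cartesian_Product.norm_nth_le)
    finally show "1 \<le> dist w w'" by (simp add: dist_norm)
  qed
  moreover have "\<exists>w\<in>D. norm (w - z) \<le> real CARD('n)" if z: "norm z \<le> real L" for z :: "complex ^ 'n"
  proof -
    define h where "h j = (round (Re (z $ j)), round (Im (z $ j)))" for j
    have rnd: "round x \<in> {- int L..int L}" if "\<bar>x\<bar> \<le> real L" for x :: real
    proof -
      have "x \<le> real_of_int (int L)" "real_of_int (- int L) \<le> x"
        using that by (simp_all add: abs_le_iff)
      then have "round x \<le> round (real_of_int (int L))" "round (real_of_int (- int L)) \<le> round x"
        by (simp_all only: round_mono)
      then show ?thesis unfolding round_of_int by simp
    qed
    have comp: "\<bar>Re (z $ j)\<bar> \<le> real L \<and> \<bar>Im (z $ j)\<bar> \<le> real L" for j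
      using abs_Re_le_cmod[of "z $ j"] abs_Im_le_cmod[of "z $ j"] z
        Finite_Cartesian_Product.norm_nth_le[of z j] by linarith
    have "p h \<in> D"
      unfolding D_def
    proof (intro imageI PiE_I)
      show "h j \<in> S" for j
        unfolding S_def h_def using rnd comp[of j] by (intro SigmaI) blast+
    qed simp
    moreover have "norm (p h - z) \<le> real CARD('n)"
    proof -
      have "norm (p h - z) = norm (\<Sum>j\<in>UNIV. axis j ((p h - z) $ j))" by (simp only: sum_axis_nth)
      also have "\<dots> \<le> (\<Sum>j\<in>(UNIV::'n set). 1)"
      proof (rule sum_norm_le)
        fix j
        have "norm ((p h - z) $ j) \<le> \<bar>Re ((p h - z) $ j)\<bar> + \<bar>Im ((p h - z) $ j)\<bar>" by (rule cmod_le)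
        also have "\<dots> \<le> 1 / 2 + 1 / 2"
          using of_int_round_abs_le[of "Re (z $ j)"] of_int_round_abs_le[of "Im (z $ j)"]
          by (intro add_mono) (simp_all add: p_def h_def)
        finally show "norm (axis j ((p h - z) $ j)) \<le> 1" by simp
      qed
      finally show ?thesis by simp
    qed
    ultimately show ?thesis by blast
  qed
  ultimately show ?thesis by blast
qed

text \<open>
  The signs are coded by the set \<open>A\<close> of points with sign \<open>+\<close>.  Pairing \<open>A\<close> with \<open>insert w0 A\<close> reverses the sign
  of \<open>a w0\<close> alone, and one of the two sums of a pair is at least \<open>|a w0|\<close> in modulus.
\<close>
lemma sum_over_signs_ge:
  fixes a :: "'b \<Rightarrow> complex" and q :: real
  assumes D: "finite D" "w0 \<in> D" and q: "q > 0"
  shows "2 ^ card D * norm (a w0) powr q \<le>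
    2 * (\<Sum>A\<in>Pow D. norm (\<Sum>w\<in>D. if w \<in> A then a w else - a w) powr q)"
proof -
  define D' where "D' = D - {w0}"
  have D': "D = insert w0 D'" "w0 \<notin> D'" "finite D'" using D by (auto simp: D'_def)
  define s where "s A = (\<Sum>w\<in>D. if w \<in> A then a w else - a w)" for A
  define b where "b A = (\<Sum>w\<in>D'. if w \<in> A then a w else - a w)" for A
  have s1: "s A = b A - a w0" if "A \<in> Pow D'" for A
    using that D' by (auto simp: s_def b_def)
  have s2: "s (insert w0 A) = b A + a w0" if "A \<in> Pow D'" for A
  proof -
    have "(\<Sum>w\<in>D'. if w \<in> insert w0 A then a w else - a w) = b A"
      unfolding b_def using D'(2) by (intro sum.cong) auto
    then show ?thesis using D' by (simp add: s_def)
  qed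
  have "(\<Sum>A\<in>Pow D. norm (s A) powr q) =
      (\<Sum>A\<in>Pow D'. norm (s A) powr q) + (\<Sum>A\<in>insert w0 ` Pow D'. norm (s A) powr q)"
    unfolding D'(1) Pow_insert using D' by (intro sum.union_disjoint) auto
  also have "(\<Sum>A\<in>insert w0 ` Pow D'. norm (s A) powr q) = (\<Sum>A\<in>Pow D'. norm (s (insert w0 A)) powr q)"
  proof (rule sum.reindex_cong[of "insert w0"])
    show "inj_on (insert w0) (Pow D')" using D'(2) by (auto simp: inj_on_def)
  qed auto
  finally have "(\<Sum>A\<in>Pow D. norm (s A) powr q) = (\<Sum>A\<in>Pow D'. norm (b A - a w0) powr q + norm (b A + a w0) powr q)"
    by (simp add: sum.distrib s1 s2)
  also have "\<dots> \<ge> (\<Sum>A\<in>Pow D'. norm (a w0) powr q)"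
  proof (rule sum_mono)
    fix A
    have "2 * norm (a w0) = norm ((b A + a w0) - (b A - a w0))"
      by (simp add: norm_mult flip: mult_2)
    also have "\<dots> \<le> norm (b A + a w0) + norm (b A - a w0)" by (rule norm_triangle_ineq4)
    finally have "norm (a w0) \<le> norm (b A - a w0) \<or> norm (a w0) \<le> norm (b A + a w0)" by linarith
    then show "norm (a w0) powr q \<le> norm (b A - a w0) powr q + norm (b A + a w0) powr q"
    proof
      assume "norm (a w0) \<le> norm (b A - a w0)"
      then have "norm (a w0) powr q \<le> norm (b A - a w0) powr q" using q by (intro powr_mono2) auto
      then show ?thesis by (simp add: add_increasing2)
    next
      assume "norm (a w0) \<le> norm (b A + a w0)"
      then have "norm (a w0) powr q \<le> norm (b A + a w0) powr q" using q by (intro powr_mono2) auto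
      then show ?thesis by (simp add: add_increasing)
    qed
  qed
  also have "(\<Sum>A\<in>Pow D'. norm (a w0) powr q) = 2 ^ card D' * norm (a w0) powr q"
    using D' by (simp add: card_Pow)
  finally have "2 ^ card D' * norm (a w0) powr q \<le> (\<Sum>A\<in>Pow D. norm (s A) powr q)" .
  moreover have "card D = Suc (card D')" using D' by simp
  ultimately show ?thesis by (simp add: s_def)
qed


text \<open>
  The norm of the signed kernel sums is controlled by \<open>separated_gaussian_sum\<close>, because
  \<open>|z| \<le> (1 + |w|) (1 + |w - z|)\<close>.  The constant \<open>\<kappa>\<close> must not depend on \<open>L\<close>: the number \<open>2 ^ card D\<close> of sign
  patterns grows with \<open>L\<close>, but only the mean over the patterns enters later.
\<close>
lemma test_functions:
  fixes \<alpha> q :: real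
  assumes \<alpha>: "\<alpha> > 0" and q: "q > 0"
  shows "\<exists>\<kappa>>0. \<forall>L::nat. \<exists>D f. finite D \<and>
    (\<forall>A. (f A :: complex ^ 'n \<Rightarrow> complex) \<in> fock_sobolev \<alpha> \<infinity> m \<and> fs_norm \<alpha> \<infinity> m (f A) \<le> 1) \<and>
    (\<forall>z. norm z \<le> real L \<longrightarrow> \<kappa> * 2 ^ card (D :: (complex ^ 'n) set) \<le>
      (\<Sum>A\<in>Pow D. norm (f A z) powr q * (1 + norm z) powr (real m * q) * exp (- (\<alpha> * q / 2) * (norm z)\<^sup>2)))"
proof -
  obtain C where C: "C > 0" "\<forall>D :: (complex ^ 'n) set. \<forall>z. finite D \<longrightarrow> one_separated D \<longrightarrow>
    (\<Sum>w\<in>D. (1 + norm (w - z)) ^ m * exp (- (\<alpha> / 2) * (norm (w - z))\<^sup>2)) \<le> C"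
    using separated_gaussian_sum[OF \<alpha>, of m] by blast
  define n where "n = real CARD('n)"
  have n: "n \<ge> 0" by (simp add: n_def)
  define \<delta> where "\<delta> = exp (- (\<alpha> / 2) * n\<^sup>2) / ((1 + n) ^ m * C)"
  have \<delta>: "\<delta> > 0" unfolding \<delta>_def using n C by (intro divide_pos_pos mult_pos_pos zero_less_power) auto
  show ?thesis
  proof (intro exI[of _ "\<delta> powr q / 2"] conjI allI)
    show "\<delta> powr q / 2 > 0" using \<delta> by simp
    fix L :: nat
    obtain D :: "(complex ^ 'n) set" where D: "finite D" "one_separated D"
      "\<And>z. norm z \<le> real L \<Longrightarrow> \<exists>w\<in>D. norm (w - z) \<le> n"
      using finite_one_separated_net[where 'n = 'n, of L] unfolding n_def by blast
    define c where "c A w = (if w \<in> A then 1 else - 1) / complex_of_real ((1 + norm w) ^ m * C)"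
      for A and w :: "complex ^ 'n"
    have pos: "(1 + norm w) ^ m > 0" for w :: "complex ^ 'n"
      by (intro zero_less_power add_pos_nonneg) auto
    have norm_c: "norm (c A w) = 1 / ((1 + norm w) ^ m * C)" for A w
      unfolding c_def norm_divide norm_of_real using pos[of w] C by simp
    define f where "f A = kernel_sum \<alpha> (c A) D" for A
    show "\<exists>D f. finite D \<and>
    (\<forall>A. (f A :: complex ^ 'n \<Rightarrow> complex) \<in> fock_sobolev \<alpha> \<infinity> m \<and> fs_norm \<alpha> \<infinity> m (f A) \<le> 1) \<and>
    (\<forall>z. norm z \<le> real L \<longrightarrow> \<delta> powr q / 2 * 2 ^ card (D :: (complex ^ 'n) set) \<le>
      (\<Sum>A\<in>Pow D. norm (f A z) powr q * (1 + norm z) powr (real m * q) * exp (- (\<alpha> * q / 2) * (norm z)\<^sup>2)))"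
    proof (rule exI[of _ D], rule exI[of _ f], intro conjI allI impI)
      fix A
      show "f A \<in> fock_sobolev \<alpha> \<infinity> m"
        unfolding f_def by (rule kernel_sum_in_fock_sobolev[OF \<alpha>])
      have "norm z ^ m * norm (f A z) * exp (- (\<alpha> / 2) * (norm z)\<^sup>2) \<le> 1" for z
      proof -
        have "norm z ^ m * norm (f A z) * exp (- (\<alpha> / 2) * (norm z)\<^sup>2)
            \<le> norm z ^ m * (\<Sum>w\<in>D. norm (c A w) * exp (- (\<alpha> / 2) * (norm (w - z))\<^sup>2))"
          unfolding f_def mult.assoc by (intro mult_left_mono norm_kernel_sum_le) simp
        also have "\<dots> = (\<Sum>w\<in>D. norm z ^ m / ((1 + norm w) ^ m * C) * exp (- (\<alpha> / 2) * (norm (w - z))\<^sup>2))"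
          by (simp add: norm_c sum_distrib_left)
        also have "\<dots> \<le> (\<Sum>w\<in>D. (1 + norm (w - z)) ^ m / C * exp (- (\<alpha> / 2) * (norm (w - z))\<^sup>2))"
        proof (intro sum_mono mult_right_mono)
          fix w
          have "norm z \<le> norm w + norm (w - z)"
            using norm_triangle_ineq4[of w "w - z"] by simp
          also have "\<dots> \<le> (1 + norm w) * (1 + norm (w - z))"
            by (simp add: algebra_simps)
          finally have "norm z ^ m \<le> (1 + norm w) ^ m * (1 + norm (w - z)) ^ m"
            unfolding power_mult_distrib[symmetric] by (intro power_mono) auto
          then show "norm z ^ m / ((1 + norm w) ^ m * C) \<le> (1 + norm (w - z)) ^ m / C"
            using pos[of w] C by (simp add: field_simps)
        qed simp
        also have "\<dots> = (\<Sum>w\<in>D. (1 + norm (w - z)) ^ m * exp (- (\<alpha> / 2) * (norm (w - z))\<^sup>2)) / C"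
          by (simp add: sum_divide_distrib)
        also have "\<dots> \<le> 1" using C(2) D C(1) by simp
        finally show ?thesis .
      qed
      then show "fs_norm \<alpha> \<infinity> m (f A) \<le> 1"
        unfolding fs_norm_def by (auto intro!: SUP_least simp: ennreal_le_1)
    next
      fix z :: "complex ^ 'n" assume z: "norm z \<le> real L"
      obtain w0 where w0: "w0 \<in> D" "norm (w0 - z) \<le> n" using D(3)[OF z] by blast
      define a where "a w = ker \<alpha> w z / complex_of_real ((1 + norm w) ^ m * C)" for w
      have fa: "f A z = (\<Sum>w\<in>D. if w \<in> A then a w else - a w)" for A
        unfolding f_def kernel_sum_def by (intro sum.cong) (auto simp: c_def a_def)
      define p where "p = (1 + norm z) powr (real m * q) * exp (- (\<alpha> * q / 2) * (norm z)\<^sup>2)"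
      have p: "p \<ge> 0" by (simp add: p_def)
      have zpos: "1 + norm z > 0" by (simp add: add_pos_nonneg)
      have "\<delta> * exp (\<alpha> / 2 * (norm z)\<^sup>2) / (1 + norm z) ^ m \<le> norm (a w0)"
      proof -
        have "norm w0 \<le> norm z + n" using w0 norm_triangle_ineq[of z "w0 - z"] by simp
        then have "1 + norm w0 \<le> (1 + n) * (1 + norm z)"
        proof -
          assume le: "norm w0 \<le> norm z + n"
          have "0 \<le> n * norm z" using n by simp
          moreover have "(1 + n) * (1 + norm z) = 1 + norm z + n + n * norm z"
            by (simp add: algebra_simps)
          ultimately show ?thesis using le by linarith
        qed
        then have 1: "(1 + norm w0) ^ m \<le> (1 + n) ^ m * (1 + norm z) ^ m"
          unfolding power_mult_distrib[symmetric] by (intro power_mono) auto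
        have "(norm (w0 - z))\<^sup>2 \<le> n\<^sup>2" using w0 by (intro power_mono) auto
        then have "\<alpha> / 2 * (norm (w0 - z))\<^sup>2 \<le> \<alpha> / 2 * n\<^sup>2" using \<alpha> by (intro mult_left_mono) auto
        then have 2: "exp (- (\<alpha> / 2) * n\<^sup>2) \<le> exp (- (\<alpha> / 2) * (norm (w0 - z))\<^sup>2)" by simp
        have "\<delta> * exp (\<alpha> / 2 * (norm z)\<^sup>2) / (1 + norm z) ^ m
            = (exp (\<alpha> / 2 * (norm z)\<^sup>2) * exp (- (\<alpha> / 2) * n\<^sup>2)) / ((1 + n) ^ m * (1 + norm z) ^ m * C)"
          by (simp add: \<delta>_def mult_ac)
        also have "\<dots> \<le> (exp (\<alpha> / 2 * (norm z)\<^sup>2) * exp (- (\<alpha> / 2) * (norm (w0 - z))\<^sup>2)) / ((1 + norm w0) ^ m * C)"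
          using 1 2 pos[of w0] C by (intro frac_le mult_left_mono mult_right_mono mult_pos_pos) auto
        also have "\<dots> = norm (a w0)"
          unfolding a_def norm_divide norm_of_real norm_ker using pos[of w0] C by simp
        finally show ?thesis .
      qed
      then have "(\<delta> * exp (\<alpha> / 2 * (norm z)\<^sup>2) / (1 + norm z) ^ m) powr q \<le> norm (a w0) powr q"
        using q \<delta> by (intro powr_mono2) auto
      moreover have "(\<delta> * exp (\<alpha> / 2 * (norm z)\<^sup>2) / (1 + norm z) ^ m) powr q
          = \<delta> powr q * exp (\<alpha> * q / 2 * (norm z)\<^sup>2) / (1 + norm z) powr (real m * q)"
        using zpos \<delta> by (simp add: powr_mult powr_divide powr_powr exp_powr_real mult_ac flip: powr_realpow)
      moreover have "\<delta> powr q * exp (\<alpha> * q / 2 * (norm z)\<^sup>2) / (1 + norm z) powr (real m * q) * p = \<delta> powr q"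
      proof -
        have "exp (\<alpha> * q / 2 * (norm z)\<^sup>2) * exp (- (\<alpha> * q / 2) * (norm z)\<^sup>2) = 1" by (simp flip: exp_add)
        then show ?thesis using zpos by (simp add: p_def field_simps)
      qed
      ultimately have dp: "\<delta> powr q \<le> norm (a w0) powr q * p"
        using mult_right_mono[OF _ p] by metis
      have "\<delta> powr q / 2 * 2 ^ card D \<le> (norm (a w0) powr q * p) / 2 * 2 ^ card D"
        using dp by (intro mult_right_mono divide_right_mono) auto
      also have "\<dots> = (2 ^ card D * norm (a w0) powr q) / 2 * p" by simp
      also have "\<dots> \<le> (\<Sum>A\<in>Pow D. norm (f A z) powr q) * p"
        using sum_over_signs_ge[OF D(1) w0(1) q, of a] unfolding fa
        by (intro mult_right_mono p) simp
      finally show "\<delta> powr q / 2 * 2 ^ card D \<le>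
        (\<Sum>A\<in>Pow D. norm (f A z) powr q * (1 + norm z) powr (real m * q) * exp (- (\<alpha> * q / 2) * (norm z)\<^sup>2))"
        by (simp add: p_def sum_distrib_right mult.assoc)
    qed (rule D(1))
  qed
qed

text \<open>
  Averaging the hypothesis over the test functions bounds the integral over the set where
  \<open>|\<psi>(z)| \<le> L\<close>, uniformly in \<open>L\<close>; monotone convergence gives the whole integral.
\<close>
lemma berezin_density_integral_le:
  fixes \<alpha> q :: real
  assumes \<alpha>: "\<alpha> > 0" and q: "q > 0"
  shows "\<exists>C>0. \<forall>u (\<psi> :: complex ^ 'n \<Rightarrow> complex ^ 'n) b. entire u \<longrightarrow> entire_map \<psi> \<longrightarrow> b \<ge> 0 \<longrightarrow>
    (\<forall>f \<in> fock_sobolev \<alpha> \<infinity> m. fs_norm \<alpha> \<infinity> m f \<le> 1 \<longrightarrow> sobolev_integral \<alpha> q m (wcomp u \<psi> f) \<le> ennreal b) \<longrightarrow>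
    (\<integral>\<^sup>+ z. ennreal (berezin_density \<alpha> q m u \<psi> z) \<partial>lborel) \<le> ennreal (C * b)"
proof -
  obtain \<kappa> where \<kappa>: "\<kappa> > 0" "\<forall>L::nat. \<exists>D f. finite D \<and>
    (\<forall>A. (f A :: complex ^ 'n \<Rightarrow> complex) \<in> fock_sobolev \<alpha> \<infinity> m \<and> fs_norm \<alpha> \<infinity> m (f A) \<le> 1) \<and>
    (\<forall>z. norm z \<le> real L \<longrightarrow> \<kappa> * 2 ^ card (D :: (complex ^ 'n) set) \<le>
      (\<Sum>A\<in>Pow D. norm (f A z) powr q * (1 + norm z) powr (real m * q) * exp (- (\<alpha> * q / 2) * (norm z)\<^sup>2)))"
    using test_functions[OF \<alpha> q, of m] by blast
  show ?thesis
  proof (intro exI[of _ "1 / \<kappa>"] conjI allI impI)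
    show "1 / \<kappa> > 0" using \<kappa> by simp
    fix u :: "complex ^ 'n \<Rightarrow> complex" and \<psi> :: "complex ^ 'n \<Rightarrow> complex ^ 'n" and b :: real
    assume u: "entire u" and \<psi>: "entire_map \<psi>" and b: "b \<ge> 0"
      and bd: "\<forall>f \<in> fock_sobolev \<alpha> \<infinity> m. fs_norm \<alpha> \<infinity> m f \<le> 1 \<longrightarrow> sobolev_integral \<alpha> q m (wcomp u \<psi> f) \<le> ennreal b"
    define h where "h = berezin_density \<alpha> q m u \<psi>"
    have h0: "h z \<ge> 0" for z by (simp add: h_def berezin_density_nonneg)
    note [measurable] = entire_measurable[OF u] entire_map_measurable[OF \<psi>]
    have hm [measurable]: "h \<in> borel_measurable borel"
      unfolding h_def by (rule berezin_density_measurable[OF \<alpha> q u \<psi>])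
    define H where "H L z = (if norm (\<psi> z) \<le> real L then ennreal (h z) else 0)" for L :: nat and z
    have Hm [measurable]: "H L \<in> borel_measurable borel" for L
      unfolding H_def by measurable
    have "(\<integral>\<^sup>+ z. H L z \<partial>lborel) \<le> ennreal (1 / \<kappa> * b)" for L
    proof -
      obtain D :: "(complex ^ 'n) set" and f where D: "finite D"
        "\<And>A. (f A :: complex ^ 'n \<Rightarrow> complex) \<in> fock_sobolev \<alpha> \<infinity> m" "\<And>A. fs_norm \<alpha> \<infinity> m (f A) \<le> 1"
        "\<And>z. norm z \<le> real L \<Longrightarrow> \<kappa> * 2 ^ card D \<le>
          (\<Sum>A\<in>Pow D. norm (f A z) powr q * (1 + norm z) powr (real m * q) * exp (- (\<alpha> * q / 2) * (norm z)\<^sup>2))"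
        using \<kappa>(2)[rule_format, of L] by metis
      define g where "g A z = norm (f A z) powr q * (1 + norm z) powr (real m * q) * exp (- (\<alpha> * q / 2) * (norm z)\<^sup>2)" for A z
      have g0: "g A z \<ge> 0" for A z by (simp add: g_def)
      have [measurable]: "f A \<in> borel_measurable borel" for A
        using D(2)[of A] by (intro entire_measurable) (simp add: fock_sobolev_def)
      have [measurable]: "g A \<in> borel_measurable borel" for A
        unfolding g_def by measurable
      have "ennreal (\<kappa> * 2 ^ card D) * (\<integral>\<^sup>+ z. H L z \<partial>lborel) = (\<integral>\<^sup>+ z. ennreal (\<kappa> * 2 ^ card D) * H L z \<partial>lborel)"
        by (rule nn_integral_cmult[symmetric]) measurable
      also have "\<dots> \<le> (\<integral>\<^sup>+ z. (\<Sum>A\<in>Pow D. ennreal (h z * g A (\<psi> z))) \<partial>lborel)"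
      proof (rule nn_integral_mono)
        fix z
        show "ennreal (\<kappa> * 2 ^ card D) * H L z \<le> (\<Sum>A\<in>Pow D. ennreal (h z * g A (\<psi> z)))"
        proof (cases "norm (\<psi> z) \<le> real L")
          case True
          have "h z * (\<kappa> * 2 ^ card D) \<le> h z * (\<Sum>A\<in>Pow D. g A (\<psi> z))"
            using D(4)[OF True] unfolding g_def[symmetric] by (intro mult_left_mono h0)
          then have "ennreal (h z * (\<kappa> * 2 ^ card D)) \<le> ennreal (\<Sum>A\<in>Pow D. h z * g A (\<psi> z))"
            by (simp add: sum_distrib_left ennreal_leI)
          moreover have "ennreal (\<kappa> * 2 ^ card D) * H L z = ennreal (h z * (\<kappa> * 2 ^ card D))"
            using True h0[of z] by (simp add: H_def mult.commute[of _ "ennreal (h z)"] ennreal_mult')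
          ultimately show ?thesis using h0[of z] g0 by (simp add: sum_ennreal)
        qed (simp add: H_def)
      qed
      also have "\<dots> = (\<Sum>A\<in>Pow D. (\<integral>\<^sup>+ z. ennreal (h z * g A (\<psi> z)) \<partial>lborel))"
        by (rule nn_integral_sum) measurable
      also have "\<dots> = (\<Sum>A\<in>Pow D. sobolev_integral \<alpha> q m (wcomp u \<psi> (f A)))"
        unfolding sobolev_integral_def sobolev_integrand_wcomp h_def g_def ..
      also have "\<dots> \<le> (\<Sum>A\<in>Pow D. ennreal b)"
        using bd D by (intro sum_mono) blast
      also have "\<dots> = ennreal (2 ^ card D * b)"
        using D(1) b by (simp add: card_Pow ennreal_mult' flip: ennreal_numeral ennreal_power)
      finally have le: "ennreal (\<kappa> * 2 ^ card D) * (\<integral>\<^sup>+ z. H L z \<partial>lborel) \<le> ennreal (2 ^ card D * b)" .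
      show ?thesis
      proof (cases "\<integral>\<^sup>+ z. H L z \<partial>lborel")
        case (real x)
        then have "\<kappa> * 2 ^ card D * x \<le> 2 ^ card D * b"
          using le \<kappa> b by (simp flip: ennreal_mult')
        then have "\<kappa> * x \<le> b" by simp
        then show ?thesis unfolding real using \<kappa> by (intro ennreal_leI) (simp add: field_simps)
      next
        case top
        then show ?thesis using le \<kappa>(1) by (simp add: ennreal_mult_top top_unique)
      qed
    qed
    moreover have "(\<integral>\<^sup>+ z. ennreal (h z) \<partial>lborel) = (SUP L. \<integral>\<^sup>+ z. H L z \<partial>lborel)"
    proof -
      have "(\<integral>\<^sup>+ z. ennreal (h z) \<partial>lborel) = (\<integral>\<^sup>+ z. (SUP L. H L z) \<partial>lborel)"
      proof (rule nn_integral_cong)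
        fix z
        obtain L where L: "norm (\<psi> z) \<le> real L" using real_arch_simple by blast
        show "ennreal (h z) = (SUP L. H L z)"
        proof (rule antisym)
          show "ennreal (h z) \<le> (SUP L. H L z)"
            using L by (intro SUP_upper2[of L]) (auto simp: H_def)
          show "(SUP L. H L z) \<le> ennreal (h z)"
            by (intro SUP_least) (simp add: H_def)
        qed
      qed
      also have "\<dots> = (SUP L. \<integral>\<^sup>+ z. H L z \<partial>lborel)"
      proof (rule nn_integral_monotone_convergence_SUP)
        show "incseq H" by (auto simp: incseq_def le_fun_def H_def)
      qed simp
      finally show ?thesis .
    qed
    ultimately show "(\<integral>\<^sup>+ z. ennreal (berezin_density \<alpha> q m u \<psi> z) \<partial>lborel) \<le> ennreal (1 / \<kappa> * b)"
      unfolding h_def[symmetric] by (simp add: SUP_le_iff)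
  qed
qed

section \<open>The topology of the target space\<close>

lemma epowr_ennreal: "x \<ge> 0 \<Longrightarrow> epowr (ennreal x) a = ennreal (x powr a)"
  by (simp add: epowr_def)

lemma epowr_top: "epowr top a = top"
  by (simp add: epowr_def)

lemma epowr_mono: "x \<le> y \<Longrightarrow> a > 0 \<Longrightarrow> epowr x a \<le> epowr y a"
  by (cases x; cases y) (auto simp: epowr_ennreal epowr_top top_unique intro!: ennreal_leI powr_mono2)

lemma epowr_le_iff:
  assumes "a > 0" "c \<ge> 0"
  shows "epowr x a \<le> ennreal c \<longleftrightarrow> x \<le> ennreal (c powr (1 / a))"
proof (cases x)
  case (real r)
  have "r powr a \<le> c \<longleftrightarrow> r \<le> c powr (1 / a)"
  proof
    assume "r powr a \<le> c"
    then have "(r powr a) powr (1 / a) \<le> c powr (1 / a)" using assms by (intro powr_mono2) auto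
    then show "r \<le> c powr (1 / a)" using assms real by (simp add: powr_powr)
  next
    assume "r \<le> c powr (1 / a)"
    then have "r powr a \<le> (c powr (1 / a)) powr a" using assms real by (intro powr_mono2) auto
    then show "r powr a \<le> c" using assms by (simp add: powr_powr)
  qed
  then show ?thesis using real assms by (simp add: epowr_ennreal)
qed (simp add: epowr_top top_unique)

lemma epowr_less_iff:
  assumes "a > 0" "c > 0"
  shows "epowr x a < ennreal c \<longleftrightarrow> x < ennreal (c powr (1 / a))"
proof (cases x)
  case (real r)
  have "r powr a < c \<longleftrightarrow> r < c powr (1 / a)"
  proof
    assume "r powr a < c"
    then have "(r powr a) powr (1 / a) < c powr (1 / a)" using assms by (intro powr_less_mono2) auto
    then show "r < c powr (1 / a)" using assms real by (simp add: powr_powr)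
  next
    assume "r < c powr (1 / a)"
    then have "r powr a < (c powr (1 / a)) powr a" using assms real by (intro powr_less_mono2) auto
    then show "r powr a < c" using assms by (simp add: powr_powr)
  qed
  then show ?thesis using real assms by (simp add: epowr_ennreal ennreal_less_iff)
qed (simp add: epowr_top)

lemma powr_add_le_concave:
  fixes x y q :: real
  assumes "x \<ge> 0" "y \<ge> 0" "0 < q" "q \<le> 1"
  shows "(x + y) powr q \<le> x powr q + y powr q"
proof (cases "x + y = 0")
  case False
  define s where "s = x + y"
  have s: "s > 0" using False assms by (simp add: s_def)
  have *: "a / s \<le> (a / s) powr q" if "0 \<le> a" "a \<le> s" for a
  proof (cases "a = 0")
    case False
    then have "0 < a / s" "a / s \<le> 1" using that s by auto
    then have "(a / s) powr 1 \<le> (a / s) powr q" using assms by (intro powr_mono') auto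
    then show ?thesis unfolding powr_one[OF less_imp_le[OF \<open>0 < a / s\<close>]] .
  qed simp
  have "1 = x / s + y / s" using s by (simp add: s_def flip: add_divide_distrib)
  also have "\<dots> \<le> (x / s) powr q + (y / s) powr q"
    using assms by (intro add_mono *) (auto simp: s_def)
  also have "\<dots> = (x powr q + y powr q) / s powr q"
    using assms s by (simp add: powr_divide add_divide_distrib)
  finally show ?thesis using s by (simp add: s_def field_simps)
qed (use assms in auto)

text \<open>
  Convexity of the power function at \<open>x + y = t (x / t) + (1 - t) (y / (1 - t))\<close>.  Integrated and with
  \<open>t\<close> proportional to the two norms, this is Minkowski's inequality.
\<close>
lemma powr_add_le_convex:
  fixes x y q t :: real
  assumes "x \<ge> 0" "y \<ge> 0" "q \<ge> 1" "0 < t" "t < 1"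
  shows "(x + y) powr q \<le> t powr (1 - q) * x powr q + (1 - t) powr (1 - q) * y powr q"
proof -
  have one: "1 \<le> s powr (1 - q)" if "0 < s" "s < 1" for s :: real
    using that assms powr_mono'[of "1 - q" 0 s] by simp
  consider "x = 0" | "y = 0" | "x > 0" "y > 0" using assms by linarith
  then show ?thesis
  proof cases
    case 1
    then show ?thesis using mult_right_mono[OF one[of "1 - t"], of "y powr q"] assms by simp
  next
    case 2
    then show ?thesis using mult_right_mono[OF one[of t], of "x powr q"] assms by simp
  next
    case 3
    have "((1 - t) *\<^sub>R (y / (1 - t)) + t *\<^sub>R (x / t)) powr q \<le> (1 - t) * (y / (1 - t)) powr q + t * (x / t) powr q"
      using 3 assms by (intro convex_onD[OF powr_convex]) auto
    moreover have "(1 - t) *\<^sub>R (y / (1 - t)) + t *\<^sub>R (x / t) = x + y" using assms by simp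
    moreover have "s * (a / s) powr q = s powr (1 - q) * a powr q" if "s > 0" "a \<ge> 0" for s a :: real
      using that by (simp add: powr_divide powr_diff)
    ultimately show ?thesis using 3 assms by (simp add: add.commute)
  qed
qed

text \<open>
  The power of the integral that satisfies the triangle inequality: \<open>1 / q\<close> for \<open>q \<ge> 1\<close> (the
  \<open>L\<^sup>q\<close> norm) and \<open>1\<close> for \<open>q \<le> 1\<close>, where the norm itself is only a quasi-norm.
\<close>
definition sobolev_gauge :: "real \<Rightarrow> real \<Rightarrow> nat \<Rightarrow> (complex ^ 'n \<Rightarrow> complex) \<Rightarrow> ennreal"
  where "sobolev_gauge \<alpha> q m f = epowr (sobolev_integral \<alpha> q m f) (min 1 (1 / q))"

lemma sobolev_gauge_triangle:
  fixes f g h :: "complex ^ 'n \<Rightarrow> complex"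
  assumes q: "q > 0" and m [measurable]: "f \<in> borel_measurable borel" "g \<in> borel_measurable borel"
    and le: "\<And>z. norm (h z) \<le> norm (f z) + norm (g z)"
  shows "sobolev_gauge \<alpha> q m h \<le> sobolev_gauge \<alpha> q m f + sobolev_gauge \<alpha> q m g"
proof -
  define W where "W z = (norm z ^ m) powr q * exp (- (\<alpha> * q / 2) * (norm z)\<^sup>2)" for z :: "complex ^ 'n"
  have W0: "W z \<ge> 0" for z by (simp add: W_def)
  have J: "sobolev_integral \<alpha> q m k = (\<integral>\<^sup>+ z. ennreal (W z * norm (k z) powr q) \<partial>lborel)"
    for k :: "complex ^ 'n \<Rightarrow> complex"
    unfolding sobolev_integral_def W_def by (simp add: mult_ac)
  have [measurable]: "W \<in> borel_measurable borel" unfolding W_def by measurable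
  have comb: "sobolev_integral \<alpha> q m h \<le> ennreal a * sobolev_integral \<alpha> q m f + ennreal b * sobolev_integral \<alpha> q m g"
    if ab: "a \<ge> 0" "b \<ge> 0" and pt: "\<And>x y. x \<ge> 0 \<Longrightarrow> y \<ge> 0 \<Longrightarrow> (x + y) powr q \<le> a * x powr q + b * y powr q" for a b
  proof -
    have "sobolev_integral \<alpha> q m h \<le> (\<integral>\<^sup>+ z. ennreal a * ennreal (W z * norm (f z) powr q) + ennreal b * ennreal (W z * norm (g z) powr q) \<partial>lborel)"
      unfolding J
    proof (rule nn_integral_mono)
      fix z
      have "norm (h z) powr q \<le> (norm (f z) + norm (g z)) powr q"
        using q le by (intro powr_mono2) auto
      also have "\<dots> \<le> a * norm (f z) powr q + b * norm (g z) powr q" by (rule pt) auto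
      finally have "W z * norm (h z) powr q \<le> W z * (a * norm (f z) powr q + b * norm (g z) powr q)"
        by (rule mult_left_mono[OF _ W0])
      also have "\<dots> = a * (W z * norm (f z) powr q) + b * (W z * norm (g z) powr q)"
        by (simp add: algebra_simps)
      finally have "ennreal (W z * norm (h z) powr q) \<le> ennreal (a * (W z * norm (f z) powr q) + b * (W z * norm (g z) powr q))"
        by (rule ennreal_leI)
      also have "\<dots> = ennreal a * ennreal (W z * norm (f z) powr q) + ennreal b * ennreal (W z * norm (g z) powr q)"
        using ab W0[of z] by (simp add: ennreal_plus ennreal_mult')
      finally show "ennreal (W z * norm (h z) powr q) \<le> ennreal a * ennreal (W z * norm (f z) powr q) + ennreal b * ennreal (W z * norm (g z) powr q)" .
    qed
    also have "\<dots> = (\<integral>\<^sup>+ z. ennreal a * ennreal (W z * norm (f z) powr q) \<partial>lborel) + (\<integral>\<^sup>+ z. ennreal b * ennreal (W z * norm (g z) powr q) \<partial>lborel)"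
      by (rule nn_integral_add) measurable
    also have "(\<integral>\<^sup>+ z. ennreal a * ennreal (W z * norm (f z) powr q) \<partial>lborel) = ennreal a * sobolev_integral \<alpha> q m f"
      unfolding J by (rule nn_integral_cmult) measurable
    also have "(\<integral>\<^sup>+ z. ennreal b * ennreal (W z * norm (g z) powr q) \<partial>lborel) = ennreal b * sobolev_integral \<alpha> q m g"
      unfolding J by (rule nn_integral_cmult) measurable
    finally show ?thesis .
  qed
  show ?thesis
  proof (cases "sobolev_integral \<alpha> q m f = top \<or> sobolev_integral \<alpha> q m g = top")
    case True
    then show ?thesis by (auto simp: sobolev_gauge_def epowr_top)
  next
    case False
    then obtain a b where a: "sobolev_integral \<alpha> q m f = ennreal a" "a \<ge> 0"
      and b: "sobolev_integral \<alpha> q m g = ennreal b" "b \<ge> 0"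
      by (metis ennreal_cases)
    show ?thesis
    proof (cases "q \<le> 1")
      case True
      have s: "min 1 (1 / q) = 1" using True q by (simp add: field_simps)
      have "sobolev_integral \<alpha> q m h \<le> ennreal 1 * ennreal a + ennreal 1 * ennreal b"
        unfolding a(1)[symmetric] b(1)[symmetric] using True q
        by (intro comb) (auto intro: powr_add_le_concave)
      then have "sobolev_integral \<alpha> q m h \<le> ennreal (a + b)" using a b by (simp add: ennreal_plus)
      then have "epowr (sobolev_integral \<alpha> q m h) 1 \<le> epowr (ennreal (a + b)) 1" by (rule epowr_mono) simp
      also have "\<dots> = epowr (ennreal a) 1 + epowr (ennreal b) 1"
        using a b by (simp add: epowr_ennreal del: ennreal_plus) (simp add: ennreal_plus)
      finally show ?thesis unfolding sobolev_gauge_def s a(1) b(1) .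
    next
      case False
      then have q1: "q \<ge> 1" by simp
      have s: "min 1 (1 / q) = 1 / q" using q1 by (simp add: field_simps)
      have "sobolev_gauge \<alpha> q m h \<le> ennreal (a powr (1 / q) + b powr (1 / q))"
      proof -
        \<comment> \<open>Minkowski's inequality: the convexity estimate with the optimal \<open>t\<close>, up to \<open>e\<close>.\<close>
        have le_e: "sobolev_gauge \<alpha> q m h \<le> ennreal (a powr (1 / q) + b powr (1 / q) + 2 * e)" if e: "e > 0" for e
        proof -
          define A where "A = a powr (1 / q) + e"
          define B where "B = b powr (1 / q) + e"
          have AB: "A > 0" "B > 0" using e by (auto simp: A_def B_def add_nonneg_pos)
          have aA: "a \<le> A powr q"
          proof -
            have "a = (a powr (1 / q)) powr q" using a q by (simp add: powr_powr)
            also have "\<dots> \<le> A powr q" using q e by (intro powr_mono2) (auto simp: A_def)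
            finally show ?thesis .
          qed
          have bB: "b \<le> B powr q"
          proof -
            have "b = (b powr (1 / q)) powr q" using b q by (simp add: powr_powr)
            also have "\<dots> \<le> B powr q" using q e by (intro powr_mono2) (auto simp: B_def)
            finally show ?thesis .
          qed
          define t where "t = A / (A + B)"
          have t: "0 < t" "t < 1" "1 - t = B / (A + B)" using AB by (auto simp: t_def field_simps)
          have quot: "(x / S) powr (1 - q) * x powr q = x * S powr (q - 1)" if "x > 0" "S > 0" for x S :: real
          proof -
            have "(x / S) powr (1 - q) * x powr q = (x powr (1 - q) * x powr q) * (1 / S powr (1 - q))"
              using that by (simp add: powr_divide)
            also have "x powr (1 - q) * x powr q = x" using that by (simp flip: powr_add)
            also have "1 / S powr (1 - q) = S powr (q - 1)" by (simp flip: powr_minus_divide)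
            finally show ?thesis .
          qed
          have "sobolev_integral \<alpha> q m h \<le> ennreal (t powr (1 - q)) * ennreal a + ennreal ((1 - t) powr (1 - q)) * ennreal b"
            unfolding a(1)[symmetric] b(1)[symmetric]
            by (rule comb) (simp, simp, rule powr_add_le_convex[OF _ _ q1 t(1,2)])
          also have "\<dots> = ennreal (t powr (1 - q) * a + (1 - t) powr (1 - q) * b)"
            using a b by (simp add: ennreal_plus ennreal_mult')
          also have "\<dots> \<le> ennreal ((A + B) powr q)"
          proof (rule ennreal_leI)
            have "t powr (1 - q) * a + (1 - t) powr (1 - q) * b \<le> t powr (1 - q) * A powr q + (1 - t) powr (1 - q) * B powr q"
              using aA bB by (intro add_mono mult_left_mono) auto
            also have "t powr (1 - q) * A powr q = A * (A + B) powr (q - 1)"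
              unfolding t_def using AB by (intro quot) auto
            also have "(1 - t) powr (1 - q) * B powr q = B * (A + B) powr (q - 1)"
              unfolding t(3) using AB by (intro quot) auto
            also have "A * (A + B) powr (q - 1) + B * (A + B) powr (q - 1) = (A + B) * (A + B) powr (q - 1)"
              by (rule distrib_right[symmetric])
            also have "\<dots> = (A + B) powr q"
              using AB by (simp add: powr_mult_base)
            finally show "t powr (1 - q) * a + (1 - t) powr (1 - q) * b \<le> (A + B) powr q" .
          qed
          finally have "sobolev_integral \<alpha> q m h \<le> ennreal ((A + B) powr (1 / (1 / q)))" by simp
          then have "epowr (sobolev_integral \<alpha> q m h) (1 / q) \<le> ennreal (A + B)"
            using AB q by (subst epowr_le_iff) auto
          then show ?thesis by (simp add: sobolev_gauge_def s A_def B_def add_ac)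
        qed
        show ?thesis
        proof (cases "sobolev_gauge \<alpha> q m h")
          case (real x)
          have "x \<le> (a powr (1 / q) + b powr (1 / q)) + e" if "e > 0" for e
          proof -
            have "ennreal x \<le> ennreal (a powr (1 / q) + b powr (1 / q) + 2 * (e / 2))"
              unfolding real(2)[symmetric] using that by (intro le_e) simp
            moreover have "0 \<le> a powr (1 / q) + b powr (1 / q) + 2 * (e / 2)"
              using that by (simp add: add_nonneg_nonneg)
            ultimately have "x \<le> a powr (1 / q) + b powr (1 / q) + 2 * (e / 2)"
              by (simp only: ennreal_le_iff)
            then show ?thesis by simp
          qed
          then show ?thesis unfolding real(2) by (rule ennreal_leI[OF field_le_epsilon])
        next
          case top
          then show ?thesis using le_e[of 1] by (simp add: top_unique)
        qed
      qed
      then show ?thesis using a b by (simp add: sobolev_gauge_def s epowr_ennreal ennreal_plus)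
    qed
  qed
qed

lemma sobolev_gauge_eq_0_imp_eq:
  fixes f g :: "complex ^ 'n \<Rightarrow> complex"
  assumes f: "entire f" and g: "entire g" and q: "q > 0"
    and z0: "sobolev_gauge \<alpha> q m (\<lambda>z. f z - g z) = 0"
  shows "f = g"
proof -
  note [measurable] = entire_measurable[OF f] entire_measurable[OF g]
  have W: "(\<lambda>z. ennreal ((norm z ^ m) powr q * norm (f z - g z) powr q * exp (- (\<alpha> * q / 2) * (norm z)\<^sup>2)))
      \<in> borel_measurable lborel"
    by measurable
  have "sobolev_integral \<alpha> q m (\<lambda>z. f z - g z) = 0"
  proof (cases "sobolev_integral \<alpha> q m (\<lambda>z. f z - g z)")
    case (real x)
    then show ?thesis using z0 by (simp add: sobolev_gauge_def epowr_ennreal)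
  qed (use z0 in \<open>simp add: sobolev_gauge_def epowr_top\<close>)
  then have "AE z in lborel. ennreal ((norm z ^ m) powr q * norm (f z - g z) powr q * exp (- (\<alpha> * q / 2) * (norm z)\<^sup>2)) = 0"
    unfolding sobolev_integral_def using nn_integral_0_iff_AE[OF W] by blast
  moreover have "AE z in (lborel :: (complex ^ 'n) measure). z \<noteq> 0" by (rule AE_lborel_singleton)
  ultimately have "AE z in lborel. z \<in> {z. f z = g z}"
  proof eventually_elim
    case (elim z)
    from elim(1) have le: "(norm z ^ m) powr q * norm (f z - g z) powr q * exp (- (\<alpha> * q / 2) * (norm z)\<^sup>2) \<le> 0"
      by (simp only: ennreal_eq_0_iff)
    have "f z = g z"
    proof (rule ccontr)
      assume "f z \<noteq> g z"
      then have "(norm z ^ m) powr q * norm (f z - g z) powr q * exp (- (\<alpha> * q / 2) * (norm z)\<^sup>2) > 0"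
        using elim(2) by (intro mult_pos_pos) auto
      with le show False by linarith
    qed
    then show ?case by simp
  qed
  then have "AE z in lebesgue. z \<in> {z. f z = g z}" by (rule AE_completion)
  moreover have "closed {z. f z = g z}"
    using entire_continuous[OF f] entire_continuous[OF g] by (rule closed_Collect_eq)
  ultimately have "z \<in> {z. f z = g z}" for z
    using mem_closed_if_AE_lebesgue by blast
  then show ?thesis by auto
qed

text \<open>
  The space is defined by derivatives, so a priori the norm of a difference may be infinite.
  Truncation at 1 makes the distance finite without changing the topology.
\<close>
definition gauge_dist :: "real \<Rightarrow> real \<Rightarrow> nat \<Rightarrow> (complex ^ 'n \<Rightarrow> complex) \<Rightarrow> (complex ^ 'n \<Rightarrow> complex) \<Rightarrow> real"
  where "gauge_dist \<alpha> q m f g = enn2real (min 1 (sobolev_gauge \<alpha> q m (\<lambda>z. f z - g z)))"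

lemma Metric_space_gauge_dist:
  fixes Y :: "(complex ^ 'n \<Rightarrow> complex) set"
  assumes q: "q > 0" and Y: "\<And>f. f \<in> Y \<Longrightarrow> entire f"
  shows "Metric_space Y (gauge_dist \<alpha> q m)"
proof
  fix f g h :: "complex ^ 'n \<Rightarrow> complex"
  show "0 \<le> gauge_dist \<alpha> q m f g" by (simp add: gauge_dist_def)
  show "gauge_dist \<alpha> q m f g = gauge_dist \<alpha> q m g f"
    by (simp add: gauge_dist_def sobolev_gauge_def sobolev_integral_def norm_minus_commute)
  have fin: "min 1 x < top" for x :: ennreal by (simp add: min_less_iff_disj)
  assume f: "f \<in> Y" and g: "g \<in> Y"
  show "gauge_dist \<alpha> q m f g = 0 \<longleftrightarrow> f = g"
  proof
    assume "gauge_dist \<alpha> q m f g = 0"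
    then have "min 1 (sobolev_gauge \<alpha> q m (\<lambda>z. f z - g z)) = 0"
      using fin[of "sobolev_gauge \<alpha> q m (\<lambda>z. f z - g z)"] by (auto simp: gauge_dist_def enn2real_eq_0_iff)
    then have "sobolev_gauge \<alpha> q m (\<lambda>z. f z - g z) = 0" by (simp add: min_def split: if_splits)
    then show "f = g" using sobolev_gauge_eq_0_imp_eq Y f g q by blast
  next
    assume "f = g"
    then show "gauge_dist \<alpha> q m f g = 0"
      using q by (simp add: gauge_dist_def sobolev_gauge_def sobolev_integral_def epowr_def)
  qed
  assume h: "h \<in> Y"
  have "sobolev_gauge \<alpha> q m (\<lambda>z. f z - h z) \<le> sobolev_gauge \<alpha> q m (\<lambda>z. f z - g z) + sobolev_gauge \<alpha> q m (\<lambda>z. g z - h z)"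
  proof (rule sobolev_gauge_triangle[OF q])
    note [measurable] = entire_measurable[OF Y[OF f]] entire_measurable[OF Y[OF g]] entire_measurable[OF Y[OF h]]
    show "(\<lambda>z. f z - g z) \<in> borel_measurable borel" "(\<lambda>z. g z - h z) \<in> borel_measurable borel" by measurable
    show "norm (f z - h z) \<le> norm (f z - g z) + norm (g z - h z)" for z
      using norm_triangle_ineq[of "f z - g z" "g z - h z"] by simp
  qed
  then have "min 1 (sobolev_gauge \<alpha> q m (\<lambda>z. f z - h z)) \<le>
      min 1 (sobolev_gauge \<alpha> q m (\<lambda>z. f z - g z)) + min 1 (sobolev_gauge \<alpha> q m (\<lambda>z. g z - h z))"
    by (auto simp: min_def add_increasing add_increasing2 intro: order_trans)
  then have "gauge_dist \<alpha> q m f h \<le> enn2real (min 1 (sobolev_gauge \<alpha> q m (\<lambda>z. f z - g z)) + min 1 (sobolev_gauge \<alpha> q m (\<lambda>z. g z - h z)))"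
    unfolding gauge_dist_def using fin by (intro enn2real_mono) (auto simp: min_less_iff_disj)
  also have "\<dots> = gauge_dist \<alpha> q m f g + gauge_dist \<alpha> q m g h"
    unfolding gauge_dist_def using fin by (intro enn2real_plus)
  finally show "gauge_dist \<alpha> q m f h \<le> gauge_dist \<alpha> q m f g + gauge_dist \<alpha> q m g h" .
qed

lemma gauge_dist_less_iff:
  assumes "0 < r" "r \<le> 1"
  shows "gauge_dist \<alpha> q m f g < r \<longleftrightarrow> sobolev_gauge \<alpha> q m (\<lambda>z. f z - g z) < ennreal r"
proof -
  define x where "x = sobolev_gauge \<alpha> q m (\<lambda>z. f z - g z)"
  have "enn2real (min 1 x) < r \<longleftrightarrow> min 1 x < ennreal r"
    by (cases "min 1 x") (auto simp: ennreal_less_iff assms min_def split: if_splits)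
  also have "\<dots> \<longleftrightarrow> x < ennreal r"
    using assms by (auto simp: min_less_iff_disj ennreal_less_one_iff)
  finally show ?thesis by (simp add: gauge_dist_def x_def)
qed

lemma qnorm_topology_eq_mtopology:
  fixes Y :: "(complex ^ 'n \<Rightarrow> complex) set"
  assumes \<alpha>: "\<alpha> > 0" and q: "q > 0" and Y: "\<And>f. f \<in> Y \<Longrightarrow> entire f"
  shows "qnorm_topology Y (fs_norm \<alpha> (ennreal q) m) = Metric_space.mtopology Y (gauge_dist \<alpha> q m)"
proof -
  interpret Metric_space Y "gauge_dist \<alpha> q m" by (rule Metric_space_gauge_dist[OF q Y])
  define s where "s = min 1 (1 / q)"
  have s: "s > 0" using q by (simp add: s_def)
  define c where "c = fs_const \<alpha> q m CARD('n)"
  have c: "c > 0" unfolding c_def using \<alpha> q by (intro fs_const_pos) auto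
  have M_iff: "fs_norm \<alpha> (ennreal q) m (h :: complex ^ 'n \<Rightarrow> complex) < ennreal e \<longleftrightarrow>
      sobolev_integral \<alpha> q m h < ennreal (e powr q / c)" if "e > 0" for e h
  proof -
    have "ennreal c * x < ennreal (e powr q) \<longleftrightarrow> x < ennreal (e powr q / c)" for x
    proof (cases x)
      case (real r)
      then show ?thesis using c by (simp add: ennreal_less_iff field_simps flip: ennreal_mult')
    qed (use c in \<open>simp add: ennreal_mult_top\<close>)
    then show ?thesis
      unfolding fs_norm_eq[OF q] c_def[symmetric] using that q by (simp add: epowr_less_iff)
  qed
  have D_iff: "gauge_dist \<alpha> q m f g < r \<longleftrightarrow> sobolev_integral \<alpha> q m (\<lambda>z. f z - g z) < ennreal (r powr (1 / s))"
    if "0 < r" "r \<le> 1" for f g :: "complex ^ 'n \<Rightarrow> complex" and r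
    unfolding gauge_dist_less_iff[OF that] sobolev_gauge_def s_def[symmetric] by (rule epowr_less_iff[OF s that(1)])
  have "openin mtopology U \<longleftrightarrow> qnorm_open Y (fs_norm \<alpha> (ennreal q) m) U" for U
    unfolding openin_mtopology qnorm_open_def
  proof (intro conj_cong refl iffI)
    assume UY: "U \<subseteq> Y" and *: "\<forall>f. f \<in> U \<longrightarrow> (\<exists>r>0. mball f r \<subseteq> U)"
    show "\<forall>f\<in>U. \<exists>e>0. \<forall>g\<in>Y. fs_norm \<alpha> (ennreal q) m (\<lambda>z. g z - f z) < ennreal e \<longrightarrow> g \<in> U"
    proof
      fix f assume f: "f \<in> U"
      then obtain r where r: "r > 0" "mball f r \<subseteq> U" using * by blast
      define r' where "r' = min r 1"
      have r': "0 < r'" "r' \<le> 1" "r' \<le> r" using r by (auto simp: r'_def)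
      define e where "e = (c * r' powr (1 / s)) powr (1 / q)"
      have e: "e > 0" "e powr q / c = r' powr (1 / s)"
        using c r' q by (auto simp: e_def powr_powr)
      show "\<exists>e>0. \<forall>g\<in>Y. fs_norm \<alpha> (ennreal q) m (\<lambda>z. g z - f z) < ennreal e \<longrightarrow> g \<in> U"
      proof (intro exI[of _ e] conjI ballI impI)
        fix g assume g: "g \<in> Y" and M: "fs_norm \<alpha> (ennreal q) m (\<lambda>z. g z - f z) < ennreal e"
        from M have "gauge_dist \<alpha> q m g f < r'"
          unfolding D_iff[OF r'(1,2)] M_iff[OF e(1)] e(2) .
        then have "g \<in> mball f r"
          using g f UY r' commute[of g f] by auto
        then show "g \<in> U" using r by blast
      qed (rule e)
    qed
  next
    assume UY: "U \<subseteq> Y" and *: "\<forall>f\<in>U. \<exists>e>0. \<forall>g\<in>Y. fs_norm \<alpha> (ennreal q) m (\<lambda>z. g z - f z) < ennreal e \<longrightarrow> g \<in> U"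
    show "\<forall>f. f \<in> U \<longrightarrow> (\<exists>r>0. mball f r \<subseteq> U)"
    proof (intro allI impI)
      fix f assume f: "f \<in> U"
      then obtain e where e: "e > 0" "\<forall>g\<in>Y. fs_norm \<alpha> (ennreal q) m (\<lambda>z. g z - f z) < ennreal e \<longrightarrow> g \<in> U"
        using * by blast
      define r where "r = min 1 ((e powr q / c) powr s)"
      have r: "0 < r" "r \<le> 1" using e c by (auto simp: r_def)
      have "r powr (1 / s) \<le> ((e powr q / c) powr s) powr (1 / s)"
        using s r by (intro powr_mono2) (auto simp: r_def)
      then have r2: "r powr (1 / s) \<le> e powr q / c" using s c by (simp add: powr_powr)
      have "mball f r \<subseteq> U"
      proof
        fix g assume g: "g \<in> mball f r"
        then have "gauge_dist \<alpha> q m g f < r" using commute[of g f] by auto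
        then have "sobolev_integral \<alpha> q m (\<lambda>z. g z - f z) < ennreal (e powr q / c)"
          unfolding D_iff[OF r] using ennreal_leI[OF r2] by (rule less_le_trans)
        then show "g \<in> U" using e(2) g unfolding M_iff[OF e(1), symmetric] by auto
      qed
      then show "\<exists>r>0. mball f r \<subseteq> U" using r by blast
    qed
  qed
  then show ?thesis
    unfolding topology_eq openin_qnorm_topology by blast
qed

section \<open>Boundedness, compactness and the operator norm\<close>

lemma fs_norm_infinity_limit:
  fixes f :: "complex ^ 'n \<Rightarrow> complex"
  assumes F: "\<And>k. fs_norm \<alpha> \<infinity> m (F k) \<le> ennreal R" and R: "R \<ge> 0" and lim: "\<And>z. (\<lambda>k. F k z) \<longlonglongrightarrow> f z"
  shows "fs_norm \<alpha> \<infinity> m f \<le> ennreal R"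
proof -
  have "norm z ^ m * norm (f z) * exp (- (\<alpha> / 2) * (norm z)\<^sup>2) \<le> R" for z
  proof (rule LIMSEQ_le_const2)
    show "(\<lambda>k. norm z ^ m * norm (F k z) * exp (- (\<alpha> / 2) * (norm z)\<^sup>2))
        \<longlonglongrightarrow> norm z ^ m * norm (f z) * exp (- (\<alpha> / 2) * (norm z)\<^sup>2)"
      by (intro tendsto_intros lim)
    have "norm z ^ m * norm (F k z) * exp (- (\<alpha> / 2) * (norm z)\<^sup>2) \<le> R" for k
    proof -
      have "ennreal (norm z ^ m * norm (F k z) * exp (- (\<alpha> / 2) * (norm z)\<^sup>2)) \<le> fs_norm \<alpha> \<infinity> m (F k)"
        unfolding fs_norm_def by (auto intro: SUP_upper)
      also have "\<dots> \<le> ennreal R" by (rule F)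
      finally show ?thesis using R by (simp only: ennreal_le_iff)
    qed
    then show "\<exists>N. \<forall>k\<ge>N. norm z ^ m * norm (F k z) * exp (- (\<alpha> / 2) * (norm z)\<^sup>2) \<le> R"
      by blast
  qed
  then show ?thesis
    unfolding fs_norm_def by (auto intro!: SUP_least ennreal_leI)
qed

lemma wcomp_diff: "wcomp u \<psi> f z - wcomp u \<psi> g z = wcomp u \<psi> (\<lambda>z. f z - g z) z"
  by (simp add: wcomp_def algebra_simps)

text \<open>
  Dominated convergence: the pointwise bound in terms of \<open>R\<close> holds for all \<open>F k\<close> and passes to the limit
  \<open>f\<close>, so a multiple of the density is a majorant.
\<close>
lemma sobolev_integral_wcomp_tendsto_0:
  fixes u :: "complex ^ 'n \<Rightarrow> complex"
  assumes \<alpha>: "\<alpha> > 0" and q: "q > 0" and u: "entire u" and \<psi>: "entire_map \<psi>"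
    and fin: "(\<integral>\<^sup>+ z. ennreal (berezin_density \<alpha> q m u \<psi> z) \<partial>lborel) < top"
    and F: "\<And>k. entire (F k)" "\<And>k. fs_norm \<alpha> \<infinity> m (F k) \<le> ennreal R" and R: "R \<ge> 0"
    and f: "entire f" and lim: "\<And>z. (\<lambda>k. F k z) \<longlonglongrightarrow> f z"
  shows "(\<lambda>k. sobolev_integral \<alpha> q m (\<lambda>z. wcomp u \<psi> (F k) z - wcomp u \<psi> f z)) \<longlonglongrightarrow> 0"
proof -
  define c where "c = 2 ^ m * exp (9 * \<alpha> / 2) * R"
  have c: "c \<ge> 0" using R by (simp add: c_def)
  define h where "h = berezin_density \<alpha> q m u \<psi>"
  have h0: "h z \<ge> 0" for z by (simp add: h_def berezin_density_nonneg)
  define v where "v k z = h z * (norm (F k (\<psi> z) - f (\<psi> z)) powr q * (1 + norm (\<psi> z)) powr (real m * q) *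
      exp (- (\<alpha> * q / 2) * (norm (\<psi> z))\<^sup>2))" for k z
  have v0: "v k z \<ge> 0" for k z using h0[of z] by (simp add: v_def)
  note [measurable] = entire_map_measurable[OF \<psi>] entire_measurable[OF f] entire_measurable[OF F(1)]
  have hm [measurable]: "h \<in> borel_measurable borel"
    unfolding h_def by (rule berezin_density_measurable[OF \<alpha> q u \<psi>])
  have vm [measurable]: "v k \<in> borel_measurable borel" for k
    unfolding v_def by measurable
  have "(\<lambda>k. \<integral>\<^sup>+ z. norm (0 - v k z) \<partial>lborel) \<longlonglongrightarrow> 0"
  proof (rule nn_integral_dominated_convergence_norm[where w = "\<lambda>z. (2 * c) powr q * h z"])
    show "AE z in lborel. norm (v k z) \<le> (2 * c) powr q * h z" for k
    proof (rule AE_I2)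
      fix z
      have "norm (F k (\<psi> z)) \<le> c * exp (\<alpha> / 2 * (norm (\<psi> z))\<^sup>2) / (1 + norm (\<psi> z)) ^ m"
        unfolding c_def by (rule fs_norm_infinity_pointwise[OF F(1) \<alpha> F(2) R])
      moreover have "norm (f (\<psi> z)) \<le> c * exp (\<alpha> / 2 * (norm (\<psi> z))\<^sup>2) / (1 + norm (\<psi> z)) ^ m"
        unfolding c_def by (rule fs_norm_infinity_pointwise[OF f \<alpha> fs_norm_infinity_limit[OF F(2) R lim] R])
      ultimately have "norm (F k (\<psi> z) - f (\<psi> z)) \<le> 2 * c * exp (\<alpha> / 2 * (norm (\<psi> z))\<^sup>2) / (1 + norm (\<psi> z)) ^ m"
        using order_trans[OF norm_triangle_ineq4 add_mono] by fastforce
      then have "norm (F k (\<psi> z) - f (\<psi> z)) powr q * (1 + norm (\<psi> z)) powr (real m * q) *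
          exp (- (\<alpha> * q / 2) * (norm (\<psi> z))\<^sup>2) \<le> (2 * c) powr q"
        using q c by (intro weighted_powr_le) auto
      from mult_left_mono[OF this h0[of z]] show "norm (v k z) \<le> (2 * c) powr q * h z"
        using v0[of k z] by (simp add: v_def mult.commute)
    qed
    have "(\<integral>\<^sup>+ z. ennreal ((2 * c) powr q * h z) \<partial>lborel) = ennreal ((2 * c) powr q) * (\<integral>\<^sup>+ z. ennreal (h z) \<partial>lborel)"
    proof -
      have "(\<integral>\<^sup>+ z. ennreal ((2 * c) powr q * h z) \<partial>lborel) = (\<integral>\<^sup>+ z. ennreal ((2 * c) powr q) * ennreal (h z) \<partial>lborel)"
        by (simp add: ennreal_mult')
      also have "\<dots> = ennreal ((2 * c) powr q) * (\<integral>\<^sup>+ z. ennreal (h z) \<partial>lborel)"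
        by (rule nn_integral_cmult) measurable
      finally show ?thesis .
    qed
    then show "(\<integral>\<^sup>+ z. ennreal ((2 * c) powr q * h z) \<partial>lborel) < \<infinity>"
      using fin by (simp add: h_def ennreal_mult_less_top)
    show "AE z in lborel. (\<lambda>k. v k z) \<longlonglongrightarrow> 0"
    proof (rule AE_I2)
      fix z
      have "(\<lambda>k. norm (F k (\<psi> z) - f (\<psi> z))) \<longlonglongrightarrow> 0"
        using tendsto_norm[OF tendsto_diff[OF lim[of "\<psi> z"] tendsto_const[of "f (\<psi> z)"]]] by simp
      then have "(\<lambda>k. norm (F k (\<psi> z) - f (\<psi> z)) powr q) \<longlonglongrightarrow> 0"
        using q by (intro tendsto_zero_powrI[where b = q] tendsto_const) auto
      then have "(\<lambda>k. v k z) \<longlonglongrightarrow> h z * (0 * (1 + norm (\<psi> z)) powr (real m * q) * exp (- (\<alpha> * q / 2) * (norm (\<psi> z))\<^sup>2))"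
        unfolding v_def by (intro tendsto_mult tendsto_const)
      then show "(\<lambda>k. v k z) \<longlonglongrightarrow> 0" by simp
    qed
  qed measurable
  moreover have "(\<integral>\<^sup>+ z. norm (0 - v k z) \<partial>lborel) = sobolev_integral \<alpha> q m (\<lambda>z. wcomp u \<psi> (F k) z - wcomp u \<psi> f z)" for k
    unfolding sobolev_integral_def wcomp_diff sobolev_integrand_wcomp
    using v0 by (simp add: v_def h_def)
  ultimately show ?thesis by simp
qed

lemma finite_density_imp_member:
  fixes u :: "complex ^ 'n \<Rightarrow> complex"
  assumes \<alpha>: "\<alpha> > 0" and q: "q > 0" and u: "entire u" and \<psi>: "entire_map \<psi>"
    and fin: "(\<integral>\<^sup>+ z. ennreal (berezin_density \<alpha> q m u \<psi> z) \<partial>lborel) < top"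
    and f: "entire f" and N: "fs_norm \<alpha> \<infinity> m f < top"
  shows "wcomp u \<psi> f \<in> fock_sobolev \<alpha> (ennreal q) m"
proof (rule fock_sobolev_memberI[OF entire_wcomp[OF u \<psi> f] \<alpha> q])
  obtain R where R: "fs_norm \<alpha> \<infinity> m f = ennreal R" "R \<ge> 0"
    using N by (metis ennreal_cases less_irrefl)
  have "sobolev_integral \<alpha> q m (wcomp u \<psi> f) < top"
    using sobolev_integral_wcomp_le[OF \<alpha> q u \<psi> f _ R(2), of m] R fin
    by (auto simp: ennreal_mult_less_top intro: le_less_trans)
  then show "fs_norm \<alpha> (ennreal q) m (wcomp u \<psi> f) < \<infinity>"
    using fs_norm_less_top_iff[OF \<alpha> q, of m "wcomp u \<psi> f"] by simp
qed

text \<open>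
  The image of the full ball \<open>B\<close> of entire functions of norm at most \<open>R'\<close> is sequentially compact, because
  \<open>B\<close> is closed under pointwise limits.  It is therefore closed and contains the closure of the image
  of every subset.
\<close>
proposition compact_op_of_finite_density:
  fixes u :: "complex ^ 'n \<Rightarrow> complex"
  assumes \<alpha>: "\<alpha> > 0" and q: "q > 0" and u: "entire u" and \<psi>: "entire_map \<psi>"
    and fin: "(\<integral>\<^sup>+ z. ennreal (berezin_density \<alpha> q m u \<psi> z) \<partial>lborel) < top"
  shows "compact_op (fock_sobolev \<alpha> \<infinity> m) (fs_norm \<alpha> \<infinity> m)
    (fock_sobolev \<alpha> (ennreal q) m) (fs_norm \<alpha> (ennreal q) m) (wcomp u \<psi>)"
proof -
  define X where "X = (fock_sobolev \<alpha> \<infinity> m :: (complex ^ 'n \<Rightarrow> complex) set)"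
  define Y where "Y = (fock_sobolev \<alpha> (ennreal q) m :: (complex ^ 'n \<Rightarrow> complex) set)"
  have Xe: "entire f" if "f \<in> X" for f using that by (simp add: X_def fock_sobolev_def)
  have Ye: "entire f" if "f \<in> Y" for f using that by (simp add: Y_def fock_sobolev_def)
  have TXY: "wcomp u \<psi> ` X \<subseteq> Y"
    using finite_density_imp_member[OF \<alpha> q u \<psi> fin Xe] fs_norm_infinity_finite[OF _ \<alpha>]
    by (auto simp: X_def Y_def)
  interpret Metric_space Y "gauge_dist \<alpha> q m" by (rule Metric_space_gauge_dist[OF q Ye])
  have top_eq: "qnorm_topology Y (fs_norm \<alpha> (ennreal q) m) = mtopology"
    by (rule qnorm_topology_eq_mtopology[OF \<alpha> q Ye])
  have "compactin mtopology (mtopology closure_of (wcomp u \<psi> ` S))"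
    if S: "S \<subseteq> X" and R: "\<forall>f\<in>S. fs_norm \<alpha> \<infinity> m f \<le> ennreal R" for S and R :: real
  proof -
    define R' where "R' = max R 0"
    have R': "R' \<ge> 0" "ennreal R \<le> ennreal R'" by (auto simp: R'_def intro: ennreal_leI)
    define B where "B = {f :: complex ^ 'n \<Rightarrow> complex. entire f \<and> fs_norm \<alpha> \<infinity> m f \<le> ennreal R'}"
    have SB: "S \<subseteq> B" using S R Xe R' by (auto simp: B_def intro: order_trans)
    have TB: "wcomp u \<psi> ` B \<subseteq> Y"
    proof
      fix g assume "g \<in> wcomp u \<psi> ` B"
      then obtain f where f: "g = wcomp u \<psi> f" "entire f" "fs_norm \<alpha> \<infinity> m f \<le> ennreal R'" by (auto simp: B_def)
      have "fs_norm \<alpha> \<infinity> m f < top" using f(3) by (rule le_less_trans) simp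
      then show "g \<in> Y" unfolding f(1) Y_def by (rule finite_density_imp_member[OF \<alpha> q u \<psi> fin f(2)])
    qed
    have K: "compactin mtopology (wcomp u \<psi> ` B)"
      unfolding compactin_sequentially
    proof (intro conjI allI impI TB)
      fix \<sigma> :: "nat \<Rightarrow> complex ^ 'n \<Rightarrow> complex" assume "range \<sigma> \<subseteq> wcomp u \<psi> ` B"
      then have "\<forall>k. \<exists>f. f \<in> B \<and> \<sigma> k = wcomp u \<psi> f" by blast
      then obtain F where F: "\<And>k. F k \<in> B" "\<And>k. \<sigma> k = wcomp u \<psi> (F k)" by metis
      have Fe: "entire (F k)" and FN: "fs_norm \<alpha> \<infinity> m (F k) \<le> ennreal R'" for k
        using F(1)[of k] by (auto simp: B_def)
      define c where "c = 2 ^ m * exp (9 * \<alpha> / 2) * R'"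
      have c: "c \<ge> 0" using R' by (simp add: c_def)
      obtain f s where f: "entire f" and s: "strict_mono s" and lim: "\<And>z. (\<lambda>k. F (s k) z) \<longlonglongrightarrow> f z"
      proof (rule entire_Montel[of F])
        show "entire (F k)" for k by (rule Fe)
        fix r :: real
        have "norm (F k z) \<le> c * exp (\<alpha> / 2 * r\<^sup>2)" if z: "norm z \<le> r" for k z
        proof -
          have "norm (F k z) \<le> c * exp (\<alpha> / 2 * (norm z)\<^sup>2) / (1 + norm z) ^ m"
            unfolding c_def by (rule fs_norm_infinity_pointwise[OF Fe \<alpha> FN R'(1)])
          also have "\<dots> \<le> c * exp (\<alpha> / 2 * (norm z)\<^sup>2) / 1"
            using c by (intro divide_left_mono) (auto intro!: one_le_power zero_less_power add_pos_nonneg)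
          also have "\<dots> \<le> c * exp (\<alpha> / 2 * r\<^sup>2)"
          proof -
            have "(norm z)\<^sup>2 \<le> r\<^sup>2" using z by (intro power_mono) auto
            then have "\<alpha> / 2 * (norm z)\<^sup>2 \<le> \<alpha> / 2 * r\<^sup>2" using \<alpha> by (intro mult_left_mono) auto
            then show ?thesis using c by (simp add: mult_left_mono)
          qed
          finally show ?thesis .
        qed
        then show "\<exists>B. \<forall>k z. norm z \<le> r \<longrightarrow> norm (F k z) \<le> B" by blast
      qed (rule that)
      have fB: "f \<in> B"
        using f fs_norm_infinity_limit[of \<alpha> m "\<lambda>k. F (s k)" R' f, OF FN R'(1) lim] by (simp add: B_def)
      have J: "(\<lambda>k. sobolev_integral \<alpha> q m (\<lambda>z. wcomp u \<psi> (F (s k)) z - wcomp u \<psi> f z)) \<longlonglongrightarrow> 0"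
        by (rule sobolev_integral_wcomp_tendsto_0[OF \<alpha> q u \<psi> fin Fe FN R'(1) f lim])
      have "limitin mtopology (\<sigma> \<circ> s) (wcomp u \<psi> f) sequentially"
        unfolding limitin_metric
      proof (intro conjI allI impI)
        show "wcomp u \<psi> f \<in> Y" using fB TB by blast
        fix e :: real assume e: "e > 0"
        define e' where "e' = min e 1"
        have e': "0 < e'" "e' \<le> 1" "e' \<le> e" using e by (auto simp: e'_def)
        define t where "t = min 1 (1 / q)"
        have t: "t > 0" using q by (simp add: t_def)
        have "\<forall>\<^sub>F k in sequentially. sobolev_integral \<alpha> q m (\<lambda>z. wcomp u \<psi> (F (s k)) z - wcomp u \<psi> f z) < ennreal (e' powr (1 / t))"
          using J e' by (intro order_tendstoD(2)) auto
        then show "\<forall>\<^sub>F k in sequentially. (\<sigma> \<circ> s) k \<in> Y \<and> gauge_dist \<alpha> q m ((\<sigma> \<circ> s) k) (wcomp u \<psi> f) < e"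
        proof eventually_elim
          case (elim k)
          then have "gauge_dist \<alpha> q m (\<sigma> (s k)) (wcomp u \<psi> f) < e'"
            unfolding gauge_dist_less_iff[OF e'(1,2)] sobolev_gauge_def t_def[symmetric] epowr_less_iff[OF t e'(1)] F(2) .
          moreover have "\<sigma> (s k) \<in> Y" using TB F by auto
          ultimately show ?case using e' by simp
        qed
      qed
      then show "\<exists>l r. l \<in> wcomp u \<psi> ` B \<and> strict_mono r \<and> limitin mtopology (\<sigma> \<circ> r) l sequentially"
        using fB s by blast
    qed
    then have "closedin mtopology (wcomp u \<psi> ` B)"
      by (rule compactin_imp_closedin[OF Hausdorff_space_mtopology])
    then have "mtopology closure_of (wcomp u \<psi> ` S) \<subseteq> wcomp u \<psi> ` B"
      using SB by (intro closure_of_minimal) auto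
    then show ?thesis
      by (rule closed_compactin[OF K]) simp
  qed
  then have "\<forall>S\<subseteq>X. (\<exists>R::real. \<forall>f\<in>S. fs_norm \<alpha> \<infinity> m f \<le> ennreal R) \<longrightarrow>
      compactin mtopology (mtopology closure_of (wcomp u \<psi> ` S))" by blast
  with TXY show ?thesis
    unfolding compact_op_def X_def[symmetric] Y_def[symmetric] top_eq by blast
qed

lemma partial_deriv_scale:
  assumes "entire f"
  shows "partial_deriv j (\<lambda>z. c * f z) = (\<lambda>z. c * partial_deriv j f z)"
proof
  fix z
  have "(\<lambda>t. f (z + axis j t)) field_differentiable at 0"
    using entire_slice[OF assms, of z j] by (simp add: holomorphic_on_def)
  then show "partial_deriv j (\<lambda>z. c * f z) z = c * partial_deriv j f z"
    unfolding partial_deriv_def by (rule deriv_cmult)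
qed

lemma fock_sobolev_infinity_scale:
  fixes f :: "complex ^ 'n \<Rightarrow> complex"
  assumes f: "f \<in> fock_sobolev \<alpha> \<infinity> m" and c: "norm c \<le> 1"
  shows "(\<lambda>z. c * f z) \<in> fock_sobolev \<alpha> \<infinity> m"
proof -
  have ent: "entire f" using f by (simp add: fock_sobolev_def)
  have pow: "entire ((partial_deriv j ^^ k) g) \<and>
      (partial_deriv j ^^ k) (\<lambda>z. c * g z) = (\<lambda>z. c * (partial_deriv j ^^ k) g z)"
    if "entire g" for j k and g :: "complex ^ 'n \<Rightarrow> complex"
    using that by (induction k) (simp_all add: entire_partial_deriv partial_deriv_scale)
  have "entire (foldr (\<lambda>j. partial_deriv j ^^ \<beta> j) js f) \<and>
      foldr (\<lambda>j. partial_deriv j ^^ \<beta> j) js (\<lambda>z. c * f z) = (\<lambda>z. c * foldr (\<lambda>j. partial_deriv j ^^ \<beta> j) js f z)"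
    for \<beta> :: "'n \<Rightarrow> nat" and js
    by (induction js) (use ent pow in auto)
  then have md: "multi_deriv \<beta> (\<lambda>z. c * f z) = (\<lambda>z. c * multi_deriv \<beta> f z)" for \<beta>
    by (simp add: multi_deriv_def)
  have "fock_norm \<alpha> \<infinity> (\<lambda>z. c * g z) \<le> fock_norm \<alpha> \<infinity> g" for g :: "complex ^ 'n \<Rightarrow> complex"
  proof -
    have "ennreal (norm (c * g z) * exp (- (\<alpha> / 2) * (norm z)\<^sup>2)) \<le> fock_norm \<alpha> \<infinity> g" for z
    proof -
      have "norm (c * g z) * exp (- (\<alpha> / 2) * (norm z)\<^sup>2) \<le> norm (g z) * exp (- (\<alpha> / 2) * (norm z)\<^sup>2)"
        using c mult_right_mono[OF c, of "norm (g z)"] by (intro mult_right_mono) (auto simp: norm_mult)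
      then have "ennreal (norm (c * g z) * exp (- (\<alpha> / 2) * (norm z)\<^sup>2)) \<le> ennreal (norm (g z) * exp (- (\<alpha> / 2) * (norm z)\<^sup>2))"
        by (rule ennreal_leI)
      also have "\<dots> \<le> fock_norm \<alpha> \<infinity> g"
        unfolding fock_norm_def by (auto intro: SUP_upper)
      finally show ?thesis .
    qed
    then show ?thesis by (subst fock_norm_def) (auto intro!: SUP_least)
  qed
  then have "(\<Sum>\<beta>\<in>multi_indices m. fock_norm \<alpha> \<infinity> (multi_deriv \<beta> (\<lambda>z. c * f z)))
      \<le> (\<Sum>\<beta>\<in>multi_indices m. fock_norm \<alpha> \<infinity> (multi_deriv \<beta> f))"
    unfolding md by (intro sum_mono)
  moreover have "(\<Sum>\<beta>\<in>multi_indices m. fock_norm \<alpha> \<infinity> (multi_deriv \<beta> f)) < \<infinity>"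
    using f by (simp add: fock_sobolev_def)
  moreover have "entire (\<lambda>z. c * f z)"
  proof -
    have "entire (\<lambda>z :: complex ^ 'n. c)"
      unfolding entire_def by (intro allI exI[of _ "\<lambda>_. 0"]) auto
    from entire_mult[OF this ent] show ?thesis .
  qed
  ultimately show ?thesis unfolding fock_sobolev_def by (auto intro: le_less_trans)
qed

lemma sobolev_integral_scale:
  assumes [measurable]: "f \<in> borel_measurable borel"
  shows "sobolev_integral \<alpha> q m (\<lambda>z. c * f z) = ennreal (norm c powr q) * sobolev_integral \<alpha> q m f"
proof -
  have "sobolev_integral \<alpha> q m (\<lambda>z. c * f z) =
      (\<integral>\<^sup>+ z. ennreal (norm c powr q) * ennreal ((norm z ^ m) powr q * norm (f z) powr q * exp (- (\<alpha> * q / 2) * (norm z)\<^sup>2)) \<partial>lborel)"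
    unfolding sobolev_integral_def
  proof (rule nn_integral_cong)
    fix z
    have "(norm z ^ m) powr q * norm (c * f z) powr q * exp (- (\<alpha> * q / 2) * (norm z)\<^sup>2)
        = norm c powr q * ((norm z ^ m) powr q * norm (f z) powr q * exp (- (\<alpha> * q / 2) * (norm z)\<^sup>2))"
      by (simp add: norm_mult powr_mult)
    then show "ennreal ((norm z ^ m) powr q * norm (c * f z) powr q * exp (- (\<alpha> * q / 2) * (norm z)\<^sup>2))
        = ennreal (norm c powr q) * ennreal ((norm z ^ m) powr q * norm (f z) powr q * exp (- (\<alpha> * q / 2) * (norm z)\<^sup>2))"
      by (simp only: ennreal_mult'[OF powr_ge_zero])
  qed
  also have "\<dots> = ennreal (norm c powr q) * sobolev_integral \<alpha> q m f"
    unfolding sobolev_integral_def by (rule nn_integral_cmult) measurable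
  finally show ?thesis .
qed

text \<open>
  Every sequence in the image of the unit ball has a subsequence whose members are eventually at
  distance less than 1 from each other.  If some \<open>T f\<close> had infinite norm, the images of the multiples
  \<open>f / (k + 1)\<close> would be infinitely far from each other.  If the norms were finite but unbounded, a sequence
  of rapidly growing norms would violate the triangle inequality.
\<close>
proposition bounded_integrals_of_compact_op:
  fixes u :: "complex ^ 'n \<Rightarrow> complex"
  assumes \<alpha>: "\<alpha> > 0" and q: "q > 0" and u: "entire u" and \<psi>: "entire_map \<psi>"
    and cpt: "compact_op (fock_sobolev \<alpha> \<infinity> m) (fs_norm \<alpha> \<infinity> m)
      (fock_sobolev \<alpha> (ennreal q) m) (fs_norm \<alpha> (ennreal q) m) (wcomp u \<psi>)"
  shows "\<exists>b\<ge>0. \<forall>f \<in> fock_sobolev \<alpha> \<infinity> m. fs_norm \<alpha> \<infinity> m f \<le> 1 \<longrightarrow>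
    sobolev_integral \<alpha> q m (wcomp u \<psi> f) \<le> ennreal b"
proof -
  define X where "X = (fock_sobolev \<alpha> \<infinity> m :: (complex ^ 'n \<Rightarrow> complex) set)"
  define Y where "Y = (fock_sobolev \<alpha> (ennreal q) m :: (complex ^ 'n \<Rightarrow> complex) set)"
  have Xe: "entire f" if "f \<in> X" for f using that by (simp add: X_def fock_sobolev_def)
  have Ye: "entire f" if "f \<in> Y" for f using that by (simp add: Y_def fock_sobolev_def)
  interpret Metric_space Y "gauge_dist \<alpha> q m" by (rule Metric_space_gauge_dist[OF q Ye])
  have top_eq: "qnorm_topology Y (fs_norm \<alpha> (ennreal q) m) = mtopology"
    by (rule qnorm_topology_eq_mtopology[OF \<alpha> q Ye])
  define S where "S = {f \<in> X. fs_norm \<alpha> \<infinity> m f \<le> 1}"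
  define T where "T = wcomp u \<psi>"
  have SX: "S \<subseteq> X" by (auto simp: S_def)
  have TXY: "T ` X \<subseteq> Y" using cpt by (simp add: compact_op_def X_def Y_def T_def)
  have Tm: "T f \<in> borel_measurable borel" if "f \<in> X" for f
    using TXY that by (intro entire_measurable Ye) auto
  have "\<exists>R::real. \<forall>f\<in>S. fs_norm \<alpha> \<infinity> m f \<le> ennreal R"
    by (rule exI[of _ 1]) (auto simp: S_def)
  then have K: "compactin mtopology (mtopology closure_of (T ` S))"
    using cpt SX unfolding compact_op_def X_def[symmetric] Y_def[symmetric] top_eq T_def by blast
  have sub: "T ` S \<subseteq> mtopology closure_of (T ` S)"
    using SX TXY by (intro closure_of_subset) auto
  have conv: "\<exists>r :: nat \<Rightarrow> nat. strict_mono r \<and> (\<exists>N. \<forall>i\<ge>N. \<forall>j\<ge>N. sobolev_gauge \<alpha> q m (\<lambda>z. \<sigma> (r i) z - \<sigma> (r j) z) < 1)"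
    if \<sigma>: "range \<sigma> \<subseteq> T ` S" for \<sigma> :: "nat \<Rightarrow> complex ^ 'n \<Rightarrow> complex"
  proof -
    have "range \<sigma> \<subseteq> mtopology closure_of (T ` S)" using \<sigma> sub by blast
    then obtain l r where r: "strict_mono (r :: nat \<Rightarrow> nat)" and lim: "limitin mtopology (\<sigma> \<circ> r) l sequentially"
      using K unfolding compactin_sequentially by blast
    have l: "l \<in> Y" and ev: "\<forall>\<^sub>F i in sequentially. (\<sigma> \<circ> r) i \<in> Y \<and> gauge_dist \<alpha> q m ((\<sigma> \<circ> r) i) l < 1 / 2"
      using lim unfolding limitin_metric by (auto dest: spec[of _ "1 / 2"])
    obtain N where N: "\<And>i. i \<ge> N \<Longrightarrow> \<sigma> (r i) \<in> Y \<and> gauge_dist \<alpha> q m (\<sigma> (r i)) l < 1 / 2"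
      using ev unfolding eventually_sequentially by auto
    have "sobolev_gauge \<alpha> q m (\<lambda>z. \<sigma> (r i) z - \<sigma> (r j) z) < 1" if "i \<ge> N" "j \<ge> N" for i j
    proof -
      have "gauge_dist \<alpha> q m (\<sigma> (r i)) (\<sigma> (r j)) \<le> gauge_dist \<alpha> q m (\<sigma> (r i)) l + gauge_dist \<alpha> q m l (\<sigma> (r j))"
        using N that l by (intro triangle) auto
      also have "\<dots> < 1 / 2 + 1 / 2"
        using N that commute[of l "\<sigma> (r j)"] by (intro add_strict_mono) auto
      finally have "gauge_dist \<alpha> q m (\<sigma> (r i)) (\<sigma> (r j)) < 1" by simp
      then show ?thesis using gauge_dist_less_iff[of 1 \<alpha> q m "\<sigma> (r i)" "\<sigma> (r j)"] by simp
    qed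
    then show ?thesis using r by blast
  qed
  have fin: "sobolev_integral \<alpha> q m (T f) < top" if f: "f \<in> S" for f
  proof (rule ccontr)
    assume "\<not> sobolev_integral \<alpha> q m (T f) < top"
    then have inf: "sobolev_integral \<alpha> q m (T f) = top" using less_top by blast
    define a where "a k = complex_of_real (1 / (real k + 1))" for k
    have a1: "norm (a k) \<le> 1" for k unfolding a_def norm_of_real by simp
    define \<sigma> where "\<sigma> k = T (\<lambda>z. a k * f z)" for k
    have "(\<lambda>z. a k * f z) \<in> S" for k
    proof -
      have "fs_norm \<alpha> \<infinity> m (\<lambda>z. a k * f z) \<le> 1"
      proof -
        have "ennreal (norm z ^ m * norm (a k * f z) * exp (- (\<alpha> / 2) * (norm z)\<^sup>2)) \<le> 1" for z
        proof -
          have "norm (a k * f z) \<le> norm (f z)"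
            using mult_right_mono[OF a1[of k], of "norm (f z)"] by (simp add: norm_mult)
          then have "norm z ^ m * norm (a k * f z) * exp (- (\<alpha> / 2) * (norm z)\<^sup>2)
              \<le> norm z ^ m * norm (f z) * exp (- (\<alpha> / 2) * (norm z)\<^sup>2)"
            by (intro mult_right_mono mult_left_mono) auto
          then have "ennreal (norm z ^ m * norm (a k * f z) * exp (- (\<alpha> / 2) * (norm z)\<^sup>2))
              \<le> ennreal (norm z ^ m * norm (f z) * exp (- (\<alpha> / 2) * (norm z)\<^sup>2))" by (rule ennreal_leI)
          also have "\<dots> \<le> fs_norm \<alpha> \<infinity> m f" unfolding fs_norm_def by (auto intro: SUP_upper)
          also have "\<dots> \<le> 1" using f by (simp add: S_def)
          finally show ?thesis .
        qed
        then show ?thesis by (subst fs_norm_def) (auto intro!: SUP_least)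
      qed
      moreover have "(\<lambda>z. a k * f z) \<in> X"
        using fock_sobolev_infinity_scale[OF _ a1, of f \<alpha> m k] f by (simp add: S_def X_def)
      ultimately show ?thesis by (simp add: S_def)
    qed
    then have "range \<sigma> \<subseteq> T ` S" by (auto simp: \<sigma>_def)
    from conv[OF this] obtain r N where r: "strict_mono (r :: nat \<Rightarrow> nat)"
      and N: "\<And>i j. i \<ge> N \<Longrightarrow> j \<ge> N \<Longrightarrow> sobolev_gauge \<alpha> q m (\<lambda>z. \<sigma> (r i) z - \<sigma> (r j) z) < 1" by blast
    define c where "c = a (r N) - a (r (Suc N))"
    have "r N < r (Suc N)" using r by (rule strict_monoD) simp
    then have "1 / (real (r (Suc N)) + 1) \<noteq> 1 / (real (r N) + 1)" by simp
    then have "c \<noteq> 0" unfolding c_def a_def by (simp del: of_real_divide of_real_add)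
    then have c: "norm c powr q > 0" by simp
    have "(\<lambda>z. \<sigma> (r N) z - \<sigma> (r (Suc N)) z) = (\<lambda>z. c * T f z)"
      by (simp add: \<sigma>_def T_def wcomp_def c_def algebra_simps)
    then have "sobolev_integral \<alpha> q m (\<lambda>z. \<sigma> (r N) z - \<sigma> (r (Suc N)) z) = ennreal (norm c powr q) * top"
      using sobolev_integral_scale[OF Tm, of f \<alpha> q m c] f SX inf by auto
    also have "\<dots> = top" using c by (simp add: ennreal_mult_top)
    finally show False using N[of N "Suc N"] by (simp add: sobolev_gauge_def epowr_top)
  qed
  show ?thesis
  proof (rule ccontr)
    assume neg: "\<not> ?thesis"
    have "\<exists>f. f \<in> S \<and> \<not> sobolev_integral \<alpha> q m (T f) \<le> ennreal (real k)" for k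
    proof (rule ccontr)
      assume "\<nexists>f. f \<in> S \<and> \<not> sobolev_integral \<alpha> q m (T f) \<le> ennreal (real k)"
      then have "\<forall>f \<in> X. fs_norm \<alpha> \<infinity> m f \<le> 1 \<longrightarrow> sobolev_integral \<alpha> q m (T f) \<le> ennreal (real k)"
        by (auto simp: S_def)
      then show False
        using neg unfolding X_def T_def by (meson of_nat_0_le_iff)
    qed
    then obtain F where F: "\<And>k. F k \<in> S" "\<And>k. \<not> sobolev_integral \<alpha> q m (T (F k)) \<le> ennreal (real k)"
      by metis
    define \<sigma> where "\<sigma> k = T (F k)" for k
    have "range \<sigma> \<subseteq> T ` S" using F by (auto simp: \<sigma>_def)
    from conv[OF this] obtain r N where r: "strict_mono (r :: nat \<Rightarrow> nat)"
      and N: "\<And>i j. i \<ge> N \<Longrightarrow> j \<ge> N \<Longrightarrow> sobolev_gauge \<alpha> q m (\<lambda>z. \<sigma> (r i) z - \<sigma> (r j) z) < 1" by blast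
    define t where "t = min 1 (1 / q)"
    have t: "t > 0" using q by (simp add: t_def)
    have \<sigma>m: "\<sigma> k \<in> borel_measurable borel" for k
      unfolding \<sigma>_def using F(1)[of k] SX by (intro Tm) auto
    obtain g where g: "sobolev_gauge \<alpha> q m (\<sigma> (r N)) = ennreal g" "g \<ge> 0"
    proof -
      have "sobolev_gauge \<alpha> q m (\<sigma> (r N)) < top"
        unfolding sobolev_gauge_def epowr_less_top_iff \<sigma>_def using F(1) by (rule fin)
      then show thesis using that by (cases "sobolev_gauge \<alpha> q m (\<sigma> (r N))") auto
    qed
    have bound: "sobolev_integral \<alpha> q m (\<sigma> (r i)) \<le> ennreal ((1 + g) powr (1 / t))" if i: "i \<ge> N" for i
    proof -
      note [measurable] = \<sigma>m
      have "sobolev_gauge \<alpha> q m (\<sigma> (r i)) \<le> sobolev_gauge \<alpha> q m (\<lambda>z. \<sigma> (r i) z - \<sigma> (r N) z) + sobolev_gauge \<alpha> q m (\<sigma> (r N))"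
      proof (rule sobolev_gauge_triangle[OF q])
        show "(\<lambda>z. \<sigma> (r i) z - \<sigma> (r N) z) \<in> borel_measurable borel" by measurable
        show "norm (\<sigma> (r i) z) \<le> norm (\<sigma> (r i) z - \<sigma> (r N) z) + norm (\<sigma> (r N) z)" for z
          using norm_triangle_ineq[of "\<sigma> (r i) z - \<sigma> (r N) z" "\<sigma> (r N) z"] by simp
      qed (rule \<sigma>m)
      also have "\<dots> \<le> 1 + ennreal g"
        unfolding g(1) using N[OF i order_refl] by (intro add_right_mono less_imp_le)
      also have "\<dots> = ennreal (1 + g)" using g(2) by (simp add: ennreal_plus)
      finally show ?thesis
        unfolding sobolev_gauge_def t_def[symmetric] using t g by (subst (asm) epowr_le_iff) auto
    qed
    obtain k where k: "(1 + g) powr (1 / t) \<le> real k" using real_arch_simple by blast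
    define i where "i = max N k"
    have "k \<le> r i" using seq_suble[OF r, of i] by (simp add: i_def)
    then have "ennreal ((1 + g) powr (1 / t)) \<le> ennreal (real (r i))"
      using k by (intro ennreal_leI) linarith
    moreover have "sobolev_integral \<alpha> q m (T (F (r i))) \<le> ennreal ((1 + g) powr (1 / t))"
      using bound[of i] by (simp add: i_def \<sigma>_def)
    ultimately have "sobolev_integral \<alpha> q m (T (F (r i))) \<le> ennreal (real (r i))"
      by (rule order_trans[rotated])
    with F(2)[of "r i"] show False by blast
  qed
qed

lemma sobolev_integral_le_of_fs_norm:
  fixes f :: "complex ^ 'n \<Rightarrow> complex"
  assumes \<alpha>: "\<alpha> > 0" and q: "q > 0" and c: "c \<ge> 0"
  shows "fs_norm \<alpha> (ennreal q) m f \<le> ennreal c \<longleftrightarrow>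
    sobolev_integral \<alpha> q m f \<le> ennreal (c powr q / fs_const \<alpha> q m CARD('n))"
proof -
  define d where "d = fs_const \<alpha> q m CARD('n)"
  have d: "d > 0" unfolding d_def using \<alpha> q by (intro fs_const_pos) auto
  have "ennreal d * x \<le> ennreal (c powr q) \<longleftrightarrow> x \<le> ennreal (c powr q / d)" for x
  proof (cases x)
    case (real r)
    then show ?thesis using d by (simp add: field_simps flip: ennreal_mult')
  qed (use d in \<open>simp add: ennreal_mult_top top_unique\<close>)
  then show ?thesis
    unfolding fs_norm_eq[OF q] d_def[symmetric] using c q by (simp add: epowr_le_iff)
qed

theorem theorem3p4:
  fixes \<alpha> q :: real and m :: nat
  assumes "\<alpha> > 0" and "q > 0"
  defines "X \<equiv> fock_sobolev \<alpha> \<infinity> m :: (complex ^ 'n \<Rightarrow> complex) set"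
    and "N \<equiv> fs_norm \<alpha> \<infinity> m :: (complex ^ 'n \<Rightarrow> complex) \<Rightarrow> ennreal"
    and "Y \<equiv> fock_sobolev \<alpha> (ennreal q) m :: (complex ^ 'n \<Rightarrow> complex) set"
    and "M \<equiv> fs_norm \<alpha> (ennreal q) m :: (complex ^ 'n \<Rightarrow> complex) \<Rightarrow> ennreal"
  shows "(\<forall>(u :: complex ^ 'n \<Rightarrow> complex) \<psi>. entire u \<and> entire_map \<psi> \<longrightarrow>
           (bounded_op X N Y M (wcomp u \<psi>) \<longleftrightarrow> compact_op X N Y M (wcomp u \<psi>)) \<and>
           (compact_op X N Y M (wcomp u \<psi>) \<longleftrightarrow> in_L1 (Berezin \<alpha> q m u \<psi>))) \<and>
         (\<exists>C::real. C > 0 \<and> (\<forall>(u :: complex ^ 'n \<Rightarrow> complex) \<psi>. entire u \<and> entire_map \<psi> \<longrightarrow>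
           op_norm X N M (wcomp u \<psi>)
             \<le> ennreal C * epowr (L1_norm (Berezin \<alpha> q m u \<psi>)) (1 / q) \<and>
           epowr (L1_norm (Berezin \<alpha> q m u \<psi>)) (1 / q)
             \<le> ennreal C * op_norm X N M (wcomp u \<psi>)))"
proof -
  note \<alpha> = assms(1) and q = assms(2)
  define G where "G = gaussian_mass TYPE('n) (\<alpha> * q / 2)"
  have G: "G > 0" unfolding G_def using \<alpha> q by (intro gaussian_integral(2)) auto
  define d where "d = fs_const \<alpha> q m CARD('n)"
  have d: "d > 0" unfolding d_def using \<alpha> q by (intro fs_const_pos) auto
  define \<kappa> where "\<kappa> = 2 ^ m * exp (9 * \<alpha> / 2)"
  have \<kappa>: "\<kappa> > 0" by (simp add: \<kappa>_def)
  obtain C where C: "C > 0" "\<forall>u (\<psi> :: complex ^ 'n \<Rightarrow> complex ^ 'n) b. entire u \<longrightarrow> entire_map \<psi> \<longrightarrow> b \<ge> 0 \<longrightarrow>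
    (\<forall>f \<in> X. N f \<le> 1 \<longrightarrow> sobolev_integral \<alpha> q m (wcomp u \<psi> f) \<le> ennreal b) \<longrightarrow>
    (\<integral>\<^sup>+ z. ennreal (berezin_density \<alpha> q m u \<psi> z) \<partial>lborel) \<le> ennreal (C * b)"
    using berezin_density_integral_le[OF \<alpha> q, of m] unfolding X_def N_def by blast
  define I where "I u \<psi> = (\<integral>\<^sup>+ z. ennreal (berezin_density \<alpha> q m u \<psi> z) \<partial>lborel)"
    for u and \<psi> :: "complex ^ 'n \<Rightarrow> complex ^ 'n"
  have L1: "L1_norm (Berezin \<alpha> q m u \<psi>) = ennreal G * I u \<psi>" if "entire u" "entire_map \<psi>" for u \<psi>
    unfolding G_def I_def by (rule L1_norm_Berezin[OF \<alpha> q that])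
  have in_L1: "in_L1 (Berezin \<alpha> q m u \<psi>) \<longleftrightarrow> I u \<psi> < top" if "entire u" "entire_map \<psi>" for u \<psi>
    using Berezin_measurable[OF \<alpha> q that, of m] G
    by (auto simp: in_L1_def L1[OF that] ennreal_mult_less_top)
  have M_le: "M f \<le> ennreal c \<longleftrightarrow> sobolev_integral \<alpha> q m f \<le> ennreal (c powr q / d)" if "c \<ge> 0" for f c
    unfolding M_def d_def by (rule sobolev_integral_le_of_fs_norm[OF \<alpha> q that])
  have Xe: "entire f" and N_fin: "N f < top" if "f \<in> X" for f
    using that fs_norm_infinity_finite[OF _ \<alpha>] by (auto simp: X_def N_def fock_sobolev_def)
  \<comment> \<open>The upper estimate, in the form needed both for boundedness and for the operator norm.\<close>
  have upper: "M (wcomp u \<psi> f) \<le> ennreal ((d * i) powr (1 / q) * \<kappa> * R)"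
    if u: "entire u" "entire_map \<psi>" and i: "I u \<psi> = ennreal i" "i \<ge> 0"
      and f: "f \<in> X" "N f \<le> ennreal R" "R \<ge> 0" for u \<psi> f i R
  proof -
    have "sobolev_integral \<alpha> q m (wcomp u \<psi> f) \<le> ennreal ((\<kappa> * R) powr q) * I u \<psi>"
      unfolding I_def \<kappa>_def using f by (intro sobolev_integral_wcomp_le[OF \<alpha> q u Xe]) (auto simp: N_def)
    also have "\<dots> = ennreal ((\<kappa> * R) powr q * i)" unfolding i(1) by (simp add: ennreal_mult')
    also have "(\<kappa> * R) powr q * i = ((d * i) powr (1 / q) * \<kappa> * R) powr q / d"
      using d i \<kappa> f q by (simp add: powr_mult powr_powr)
    finally show ?thesis
      using d i \<kappa> f by (subst M_le) auto
  qed
  have bounded: "bounded_op X N Y M (wcomp u \<psi>)" if u: "entire u" "entire_map \<psi>" and fin: "I u \<psi> < top" for u \<psi>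
    unfolding bounded_op_def
  proof (intro conjI)
    show "wcomp u \<psi> ` X \<subseteq> Y"
      unfolding Y_def using finite_density_imp_member[OF \<alpha> q u _ Xe] fin N_fin
      by (auto simp: I_def N_def)
    obtain i where i: "I u \<psi> = ennreal i" "i \<ge> 0" using fin by (cases "I u \<psi>") auto
    show "\<exists>C::real. \<forall>f\<in>X. M (wcomp u \<psi> f) \<le> ennreal C * N f"
    proof (intro exI ballI)
      fix f assume f: "f \<in> X"
      obtain R where R: "N f = ennreal R" "R \<ge> 0" using N_fin[OF f] by (cases "N f") auto
      show "M (wcomp u \<psi> f) \<le> ennreal ((d * i) powr (1 / q) * \<kappa>) * N f"
        using upper[OF u i f _ R(2)] R \<kappa> by (simp add: ennreal_mult')
    qed
  qed
  have op_norm_bound: "I u \<psi> \<le> ennreal (C * (c powr q / d))"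
    if u: "entire u" "entire_map \<psi>" and le: "op_norm X N M (wcomp u \<psi>) \<le> ennreal c" and c: "c \<ge> 0" for u \<psi> c
  proof -
    have "sobolev_integral \<alpha> q m (wcomp u \<psi> f) \<le> ennreal (c powr q / d)" if "f \<in> X" "N f \<le> 1" for f
    proof -
      have "M (wcomp u \<psi> f) \<le> op_norm X N M (wcomp u \<psi>)"
        unfolding op_norm_def using that by (intro SUP_upper) auto
      then have "M (wcomp u \<psi> f) \<le> ennreal c" using le by (rule order_trans)
      then show ?thesis using M_le[OF c] by blast
    qed
    moreover have "c powr q / d \<ge> 0" using d by simp
    ultimately show ?thesis unfolding I_def using C(2) u by blast
  qed
  have bounded_imp: "I u \<psi> < top" if u: "entire u" "entire_map \<psi>" and b: "bounded_op X N Y M (wcomp u \<psi>)" for u \<psi>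
  proof -
    obtain c :: real where c: "\<And>f. f \<in> X \<Longrightarrow> M (wcomp u \<psi> f) \<le> ennreal c * N f"
      using b unfolding bounded_op_def by blast
    have "op_norm X N M (wcomp u \<psi>) \<le> ennreal (max c 0)"
      unfolding op_norm_def
    proof (rule SUP_least)
      fix f assume f: "f \<in> {f \<in> X. N f \<le> 1}"
      have "M (wcomp u \<psi> f) \<le> ennreal c * N f" using f c by blast
      also have "\<dots> \<le> ennreal (max c 0) * 1" using f by (intro mult_mono ennreal_leI) auto
      finally show "M (wcomp u \<psi> f) \<le> ennreal (max c 0)" by simp
    qed
    then have "I u \<psi> \<le> ennreal (C * (max c 0 powr q / d))" by (rule op_norm_bound[OF u]) simp
    then show ?thesis by (rule le_less_trans) simp
  qed
  have compact: "compact_op X N Y M (wcomp u \<psi>)" if u: "entire u" "entire_map \<psi>" and fin: "I u \<psi> < top" for u \<psi>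
    unfolding X_def N_def Y_def M_def using fin unfolding I_def by (rule compact_op_of_finite_density[OF \<alpha> q u])
  have compact_imp: "I u \<psi> < top" if u: "entire u" "entire_map \<psi>" and c: "compact_op X N Y M (wcomp u \<psi>)" for u \<psi>
  proof -
    obtain b where "b \<ge> 0" "\<forall>f \<in> X. N f \<le> 1 \<longrightarrow> sobolev_integral \<alpha> q m (wcomp u \<psi> f) \<le> ennreal b"
      using bounded_integrals_of_compact_op[OF \<alpha> q u c[unfolded X_def N_def Y_def M_def]] unfolding X_def N_def by blast
    then have "I u \<psi> \<le> ennreal (C * b)" unfolding I_def using C(2) u by blast
    then show ?thesis by (rule le_less_trans) simp
  qed
  define C1 where "C1 = (d / G) powr (1 / q) * \<kappa>"
  define C2 where "C2 = (G * C / d) powr (1 / q)"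
  have C1: "C1 > 0" and C2: "C2 > 0" using G d C \<kappa> by (auto simp: C1_def C2_def)
  have est: "op_norm X N M (wcomp u \<psi>) \<le> ennreal (C1 + C2) * epowr (L1_norm (Berezin \<alpha> q m u \<psi>)) (1 / q) \<and>
           epowr (L1_norm (Berezin \<alpha> q m u \<psi>)) (1 / q) \<le> ennreal (C1 + C2) * op_norm X N M (wcomp u \<psi>)"
    if u: "entire u" "entire_map \<psi>" for u \<psi>
  proof
    show "op_norm X N M (wcomp u \<psi>) \<le> ennreal (C1 + C2) * epowr (L1_norm (Berezin \<alpha> q m u \<psi>)) (1 / q)"
    proof (cases "I u \<psi>")
      case (real i)
      have e: "epowr (L1_norm (Berezin \<alpha> q m u \<psi>)) (1 / q) = ennreal ((G * i) powr (1 / q))"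
        using real G by (simp add: L1[OF u] epowr_ennreal flip: ennreal_mult')
      have "op_norm X N M (wcomp u \<psi>) \<le> ennreal ((d * i) powr (1 / q) * \<kappa> * 1)"
        unfolding op_norm_def by (intro SUP_least upper[OF u real(2,1)]) auto
      also have "(d * i) powr (1 / q) * \<kappa> * 1 = C1 * (G * i) powr (1 / q)"
        using d G real(1) by (simp add: C1_def powr_mult powr_divide)
      also have "ennreal (C1 * (G * i) powr (1 / q)) \<le> ennreal ((C1 + C2) * (G * i) powr (1 / q))"
        using C2 by (intro ennreal_leI mult_right_mono) auto
      also have "\<dots> = ennreal (C1 + C2) * epowr (L1_norm (Berezin \<alpha> q m u \<psi>)) (1 / q)"
        unfolding e using C1 C2 by (intro ennreal_mult') simp
      finally show ?thesis .
    next
      case top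
      have "ennreal (C1 + C2) * epowr (L1_norm (Berezin \<alpha> q m u \<psi>)) (1 / q) = top"
        using G C1 C2 by (simp add: L1[OF u] top epowr_top ennreal_mult_top del: ennreal_plus)
      then show ?thesis by simp
    qed
    show "epowr (L1_norm (Berezin \<alpha> q m u \<psi>)) (1 / q) \<le> ennreal (C1 + C2) * op_norm X N M (wcomp u \<psi>)"
    proof (cases "op_norm X N M (wcomp u \<psi>)")
      case (real c)
      have "L1_norm (Berezin \<alpha> q m u \<psi>) \<le> ennreal G * ennreal (C * (c powr q / d))"
        unfolding L1[OF u] using op_norm_bound[OF u _ real(1)] real(2) by (intro mult_left_mono) auto
      also have "\<dots> = ennreal (G * (C * (c powr q / d)))" using G by (intro ennreal_mult'[symmetric]) simp
      also have "G * (C * (c powr q / d)) = (C2 * c) powr (1 / (1 / q))"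
        using G C d q real(1) by (simp add: C2_def powr_mult powr_powr)
      finally have "epowr (L1_norm (Berezin \<alpha> q m u \<psi>)) (1 / q) \<le> ennreal (C2 * c)"
        using C2 real(1) q by (subst epowr_le_iff) auto
      also have "\<dots> \<le> ennreal ((C1 + C2) * c)"
        using C1 real(1) by (intro ennreal_leI mult_right_mono) auto
      also have "\<dots> = ennreal (C1 + C2) * op_norm X N M (wcomp u \<psi>)"
        unfolding real(2) using C1 C2 by (intro ennreal_mult') simp
      finally show ?thesis .
    next
      case top
      then show ?thesis using C1 C2 by (simp add: ennreal_mult_top del: ennreal_plus)
    qed
  qed
  show ?thesis
  proof (intro conjI allI impI exI[of _ "C1 + C2"])
    fix u :: "complex ^ 'n \<Rightarrow> complex" and \<psi> :: "complex ^ 'n \<Rightarrow> complex ^ 'n"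
    assume "entire u \<and> entire_map \<psi>"
    then have u: "entire u" "entire_map \<psi>" by auto
    show "bounded_op X N Y M (wcomp u \<psi>) \<longleftrightarrow> compact_op X N Y M (wcomp u \<psi>)"
      using bounded[OF u] bounded_imp[OF u] compact[OF u] compact_imp[OF u] by blast
    show "compact_op X N Y M (wcomp u \<psi>) \<longleftrightarrow> in_L1 (Berezin \<alpha> q m u \<psi>)"
      unfolding in_L1[OF u] using compact[OF u] compact_imp[OF u] by blast
    show "op_norm X N M (wcomp u \<psi>) \<le> ennreal (C1 + C2) * epowr (L1_norm (Berezin \<alpha> q m u \<psi>)) (1 / q)"
      "epowr (L1_norm (Berezin \<alpha> q m u \<psi>)) (1 / q) \<le> ennreal (C1 + C2) * op_norm X N M (wcomp u \<psi>)"
      using est[OF u] by auto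
  qed (use C1 C2 in auto)
qed

end
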